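(* Assume: (1) $(X_i,Y_i)_{i=1}^n$ are i.i.d. copies of $(X,Y)$, where $Y=\langle\beta,X\rangle+\varepsilon$ with $\mathbb{E}[\varepsilon X]=0$, $\mathbb{E}[X]=0$, $\mathbb{E}\|X\|^4<\infty$ and $\mathbb{E}[\varepsilon^2\mid X]\le\sigma^2<\infty$; (2) the covariance operator $K=\mathbb{E}[X\otimes X]$ has no zero eigenvalues; (3) the PLS estimator $\hat\beta_m$ is computed using a number of components $m=m_n\ge1$ such that $\|\hat r-\hat K\hat\beta_m\|=o_P(n^{-1/2})$. Let $b\in\mathbb{H}$ be known and $T_n=n\|\hat K(\hat\beta_m-b)\|^2$. Then, as $n\to\infty$: (a) under $H_0:\beta=b$, $\displaystyle T_n\xrightarrow{d}\sum_{j=1}^\infty\omega_jZ_j^2$; (b) under $H_1:\beta\neq b$ (fixed), $T_n\xrightarrow{\text{a.s.}}\infty$; (c) under the local alternatives $H_{1,n}:\beta=b+n^{-1/2}\Delta$ with $\Delta\in\mathbb{H}$, $$T_n\xrightarrow{d}\sum_{j=1}^\infty\omega_jZ_j^2+2\sum_{j=1}^\infty\omega_j^{1/2}Z_j\langle\varphi_j,K\Delta\rangle+\|K\Delta\|^2.$$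
   Context: $(\mathbb{H},\langle\cdot,\cdot\rangle)$ is a separable real Hilbert space with norm $\|\cdot\|$; $X,\beta\in\mathbb{H}$, $Y,\varepsilon\in\mathbb{R}$. For $x\in\mathbb{H}$, $(x\otimes x)b=\langle x,b\rangle x$. Sample quantities: $\hat r=\frac1n\sum_{i=1}^nY_iX_i$, $\hat K=\frac1n\sum_{i=1}^nX_i\otimes X_i$. PLS estimator: for $m\ge1$, $\hat\beta_m$ is the minimizer of $\|\hat r-\hat Kb\|^2$ over $b$ in the Krylov subspace $\mathbb{H}_m=\mathrm{span}\{\hat r,\hat K\hat r,\dots,\hat K^{m-1}\hat r\}$. $V=\mathbb{E}[\varepsilon^2X\otimes X]$ is the variance operator, with spectral decomposition $V=\sum_{j\ge1}\omega_j\varphi_j\otimes\varphi_j$ (eigenvalues $\omega_j\ge0$, orthonormal eigenvectors $\varphi_j$), and $(Z_j)_{j\ge1}$ are i.i.d. $N(0,1)$. Under $H_{1,n}$ the sample of size $n$ is generated by $Y_i=\langle b+n^{-1/2}\Delta,X_i\rangle+\varepsilon_i$, with the distribution of $(X_i,\varepsilon_i)$ not depending on $n$. *)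

theory Defs
  imports "HOL-Probability.Probability"
begin

text \<open>
  A separable real Hilbert space is a type of sort
  \<open>{real_inner, banach, second_countable_topology}\<close>. A sample of size \<open>n\<close> is given by
  sequences \<open>x\<close>, \<open>y\<close> of which only the entries with index \<open>i < n\<close> are used.
\<close>

definition rank_one :: "'h::real_inner \<Rightarrow> 'h \<Rightarrow> 'h" where
  "rank_one x h = (x \<bullet> h) *\<^sub>R x"

definition eigenvalue_of :: "('h::real_vector \<Rightarrow> 'h) \<Rightarrow> real \<Rightarrow> bool" where
  "eigenvalue_of A c \<longleftrightarrow> (\<exists>h. h \<noteq> 0 \<and> A h = c *\<^sub>R h)"

text \<open>
  The space of bounded operators is not separable in general, so the Bochner integral of the
  library does not apply to operator-valued random variables. Expectations of random operators
  are taken pointwise: \<open>E[A] h = E[A h]\<close>.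
\<close>

definition cov_op ::
  "'p measure \<Rightarrow> ('p \<Rightarrow> 'h::{real_inner, banach, second_countable_topology}) \<Rightarrow> 'h \<Rightarrow> 'h" where
  "cov_op P X h = (\<integral>\<omega>. rank_one (X \<omega>) h \<partial>P)"

definition var_op ::
  "'p measure \<Rightarrow> ('p \<Rightarrow> 'h::{real_inner, banach, second_countable_topology}) \<Rightarrow> ('p \<Rightarrow> real)
     \<Rightarrow> 'h \<Rightarrow> 'h" where
  "var_op P X \<epsilon> h = (\<integral>\<omega>. (\<epsilon> \<omega>)\<^sup>2 *\<^sub>R rank_one (X \<omega>) h \<partial>P)"

text \<open>
  The index set \<open>J\<close> is all of \<open>nat\<close> in the usual infinite-dimensional setting; allowing subsets
  keeps the notion meaningful when the space (and hence every orthonormal system) is finite.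
\<close>

definition spectral_decomposition ::
  "('h::real_inner \<Rightarrow> 'h) \<Rightarrow> nat set \<Rightarrow> (nat \<Rightarrow> real) \<Rightarrow> (nat \<Rightarrow> 'h) \<Rightarrow> bool" where
  "spectral_decomposition A J w \<phi> \<longleftrightarrow>
     (\<forall>j\<in>J. 0 \<le> w j) \<and>
     (\<forall>i\<in>J. \<forall>j\<in>J. \<phi> i \<bullet> \<phi> j = (if i = j then 1 else 0)) \<and>
     (\<forall>h. ((\<lambda>j. w j *\<^sub>R rank_one (\<phi> j) h) has_sum A h) J)"

definition r_hat :: "nat \<Rightarrow> (nat \<Rightarrow> 'h::real_inner) \<Rightarrow> (nat \<Rightarrow> real) \<Rightarrow> 'h" where
  "r_hat n x y = (1 / real n) *\<^sub>R (\<Sum>i<n. y i *\<^sub>R x i)"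

definition K_hat :: "nat \<Rightarrow> (nat \<Rightarrow> 'h::real_inner) \<Rightarrow> 'h \<Rightarrow> 'h" where
  "K_hat n x h = (1 / real n) *\<^sub>R (\<Sum>i<n. rank_one (x i) h)"

definition krylov :: "('h::real_vector \<Rightarrow> 'h) \<Rightarrow> 'h \<Rightarrow> nat \<Rightarrow> 'h set" where
  "krylov A r m = span ((\<lambda>j. (A ^^ j) r) ` {..<m})"

text \<open>
  The minimizer exists and is unique: the Krylov space is contained in the span of the
  \<open>x i\<close> (\<open>i < n\<close>), which is the range of the self-adjoint operator \<open>K_hat n x\<close>, and on
  which that operator is injective.
\<close>

definition pls :: "nat \<Rightarrow> (nat \<Rightarrow> 'h::real_inner) \<Rightarrow> (nat \<Rightarrow> real) \<Rightarrow> nat \<Rightarrow> 'h" where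
  "pls n x y m =
     arg_min (\<lambda>h. (norm (r_hat n x y - K_hat n x h))\<^sup>2)
       (\<lambda>h. h \<in> krylov (K_hat n x) (r_hat n x y) m)"

definition pls_residual :: "nat \<Rightarrow> (nat \<Rightarrow> 'h::real_inner) \<Rightarrow> (nat \<Rightarrow> real) \<Rightarrow> nat \<Rightarrow> real" where
  "pls_residual n x y m = norm (r_hat n x y - K_hat n x (pls n x y m))"

definition test_stat ::
  "nat \<Rightarrow> (nat \<Rightarrow> 'h::real_inner) \<Rightarrow> (nat \<Rightarrow> real) \<Rightarrow> nat \<Rightarrow> 'h \<Rightarrow> real" where
  "test_stat n x y m b = real n * (norm (K_hat n x (pls n x y m - b)))\<^sup>2"

text \<open>
  The family \<open>(S i)\<close>, \<open>i \<in> I\<close>, on \<open>M\<close> consists of i.i.d. copies of the random variable \<open>S0\<close>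
  on \<open>P\<close>; measurability of the \<open>S i\<close> is part of \<open>indep_vars\<close>.
\<close>

definition iid_copies ::
  "'s measure \<Rightarrow> 'i set \<Rightarrow> ('i \<Rightarrow> 's \<Rightarrow> 'c::topological_space) \<Rightarrow> 'p measure \<Rightarrow> ('p \<Rightarrow> 'c)
     \<Rightarrow> bool" where
  "iid_copies M I S P S0 \<longleftrightarrow>
     prob_space.indep_vars M (\<lambda>_. borel) S I \<and>
     (\<forall>i\<in>I. distr M borel (S i) = distr P borel S0)"

text \<open>
  \<open>R n = o\<^sub>P(a n)\<close>, where the \<open>n\<close>-th variable may live on its own probability space \<open>M n\<close>.
\<close>

definition small_oP ::
  "(nat \<Rightarrow> 's measure) \<Rightarrow> (nat \<Rightarrow> 's \<Rightarrow> real) \<Rightarrow> (nat \<Rightarrow> real) \<Rightarrow> bool" where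
  "small_oP M R a \<longleftrightarrow>
     (\<forall>\<delta>>0. (\<lambda>n. measure (M n) {\<omega> \<in> space (M n). \<delta> < \<bar>R n \<omega> / a n\<bar>}) \<longlonglongrightarrow> 0)"

end

theory Submission
  imports Defs "HOL-Library.Discrete_Functions"
begin

text \<open>
  \<^bold>\<open>The limit laws.\<close> The vector \<open>K_hat n x (pls n x y m)\<close> is the orthogonal projection of \<open>r_hat\<close> onto
  \<open>span {K_hat r_hat, \<dots>, K_hat\<^sup>m r_hat}\<close> (lemma \<open>K_hat_pls\<close>), and the residual of that projection is
  negligible after multiplication by \<open>sqrt n\<close>. Hence under \<open>\<beta> = b + \<Delta> / sqrt n\<close> the statistic equals
  \<open>\<parallel>W\<^sub>n + K \<Delta> + e\<^sub>n\<parallel>\<^sup>2\<close>, where \<open>W\<^sub>n = n\<^bsup>-1/2\<^esup> \<Sum> \<epsilon>\<^sub>i X\<^sub>i\<close> and \<open>e\<^sub>n\<close> tends to \<open>0\<close> in probability;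
  the null hypothesis is the case \<open>\<Delta> = 0\<close>. What is needed is thus a central limit theorem in
  Hilbert space, but only for the functionals \<open>x \<mapsto> \<parallel>x + k\<parallel>\<^sup>2\<close>. It is obtained from one-dimensional
  characteristic functions, without tightness and without a multivariate continuity theorem:

  \<^item> By the Weierstrass theorem, convergence of the Laplace transforms at the natural numbers implies
    weak convergence of nonnegative random variables (\<open>weak_conv_m_of_Laplace\<close>).
  \<^item> Since \<open>exp (- s a\<^sup>2)\<close> is the expectation of \<open>exp (i sqrt (2 s) a Z)\<close> for a standard normal \<open>Z\<close>,
    the Laplace transform of a sum of finitely many squares is a mixture of characteristic functions
    of linear forms (\<open>Laplace_eq_Gaussian_mixture\<close>). The same identity with a second Gaussian
    family computes the limit.
  \<^item> The part of \<open>W\<^sub>n\<close> outside the first \<open>N\<close> eigenvectors has a second moment that does not depend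
    on \<open>n\<close> and vanishes as \<open>N\<close> grows (\<open>coord_proj_tail_second_moment\<close>), so finitely many
    coordinates suffice (\<open>Hilbert_CLT_Laplace\<close>).

  \<^bold>\<open>Consistency.\<close> For fixed \<open>\<beta> \<noteq> b\<close> it suffices that the residual tends to \<open>0\<close> almost surely, because
  then \<open>K_hat (pls - b)\<close> tends to \<open>K (\<beta> - b) \<noteq> 0\<close> by the strong law of large numbers. The hypothesis
  gives the residual only in probability, but its limit behaviour is deterministic. Write \<open>r = K \<beta>\<close>.
  Along indices with \<open>m n\<close> large, the residual is eventually small because \<open>r\<close> is in the closed span
  of \<open>K r, K\<^sup>2 r, \<dots>\<close> (\<open>shifted_krylov_residual_tendsto_0\<close>). If a value \<open>l\<close> is attained infinitely often,
  then at one sample point the residual tends to \<open>0\<close> along a subsequence with \<open>m n = l\<close>; passing to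
  the limit, \<open>r, K r, \<dots>, K\<^sup>l r\<close> are linearly dependent, and injectivity of \<open>K\<close> puts \<open>r\<close> itself
  into the span of \<open>K r, \<dots>, K\<^sup>l r\<close> (\<open>dependent_limit\<close>, \<open>in_shifted_krylov_of_relation\<close>). A fixed
  polynomial in \<open>K_hat\<close> then bounds the residual at almost every sample point
  (\<open>pls_residual_tendsto_0\<close>).
\<close>

section \<open>Laplace transforms and weak convergence\<close>

text \<open>
  A continuous function on \<open>[0, \<infinity>)\<close> that vanishes for large arguments is a continuous function of
  \<open>u = exp (- t)\<close> on \<open>[0, 1]\<close>, hence a uniform limit of polynomials in \<open>u\<close>. The expectation of such a
  polynomial is a linear combination of values of the Laplace transform at natural numbers, so no
  inversion or uniqueness theorem for Laplace transforms is involved.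
\<close>

lemma weak_conv_m_of_Laplace:
  fixes T :: "nat \<Rightarrow> 's \<Rightarrow> real" and U :: "'q \<Rightarrow> real"
  assumes M: "\<And>n. prob_space (M n)" and T: "\<And>n. T n \<in> borel_measurable (M n)"
    and T0: "\<And>n \<omega>. 0 \<le> T n \<omega>"
    and Q: "prob_space Q" and U: "U \<in> borel_measurable Q" and U0: "AE q in Q. 0 \<le> U q"
    and lim: "\<And>s::nat. (\<lambda>n. \<integral>\<omega>. exp (- real s * T n \<omega>) \<partial>M n) \<longlonglongrightarrow> (\<integral>q. exp (- real s * U q) \<partial>Q)"
  shows "weak_conv_m (\<lambda>n. distr (M n) borel (T n)) (distr Q borel U)"
proof (rule integral_cts_step_conv_imp_weak_conv)
  show "real_distribution (distr (M n) borel (T n))" for n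
    using prob_space.real_distribution_distr[OF M T] by simp
  show "real_distribution (distr Q borel U)"
    using prob_space.real_distribution_distr[OF Q U] by simp
  fix x y :: real assume xy: "x < y"
  have cont: "continuous_on UNIV (cts_step x y)"
    by (rule uniformly_continuous_imp_continuous) (rule cts_step_uniformly_continuous[OF xy])
  have meas: "cts_step x y \<in> borel_measurable borel"
    using cont by (rule borel_measurable_continuous_onI)
  \<comment> \<open>The step function is \<open>0\<close> beyond \<open>y\<close>, so cutting off at \<open>exp (- y)\<close> keeps its values and makes \<open>g\<close> continuous at \<open>0\<close>.\<close>
  define g where "g u = cts_step x y (- ln (max u (exp (- y))))" for u :: real
  have "continuous_on UNIV (\<lambda>u::real. - ln (max u (exp (- y))))"
    by (intro continuous_intros) (auto simp: max_def not_le intro: less_imp_neq[symmetric] less_trans[OF exp_gt_zero])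
  then have "continuous_on {0..1} (cts_step x y \<circ> (\<lambda>u::real. - ln (max u (exp (- y)))))"
    by (intro continuous_on_compose) (auto intro: continuous_on_subset[OF cont] continuous_on_subset)
  then have gc: "continuous_on {0..1} g" by (simp add: g_def comp_def)
  have g_exp: "g (exp (- t)) = cts_step x y t" for t
  proof (cases "t \<le> y")
    case True
    then have "max (exp (-t)) (exp (- y)) = exp (- t)" by auto
    then show ?thesis by (simp add: g_def)
  next
    case False
    then have "max (exp (-t)) (exp (- y)) = exp (- y)" by auto
    then show ?thesis using False xy by (simp add: g_def cts_step_def)
  qed
  show "(\<lambda>n. integral\<^sup>L (distr (M n) borel (T n)) (cts_step x y))
          \<longlonglongrightarrow> integral\<^sup>L (distr Q borel U) (cts_step x y)"
  proof (rule tendstoI)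
    fix e :: real assume e: "0 < e"
    then have e3: "0 < e / 3" by simp
    obtain p where p: "real_polynomial_function p" "\<And>u. u \<in> {0..1} \<Longrightarrow> \<bar>g u - p u\<bar> < e / 3"
      using Stone_Weierstrass_real_polynomial_function[OF compact_Icc gc e3] by blast
    obtain a N where pa: "p = (\<lambda>u. \<Sum>i\<le>N. a i * u ^ i)"
      using p(1) unfolding real_polynomial_function_iff_sum by blast
    have key: "\<bar>integral\<^sup>L (distr L borel S) (cts_step x y)
        - (\<Sum>i\<le>N. a i * (\<integral>\<omega>. exp (- real i * S \<omega>) \<partial>L))\<bar> \<le> e / 3"
      if L: "prob_space L" and S[measurable]: "S \<in> borel_measurable L" and S0: "AE \<omega> in L. 0 \<le> S \<omega>"
      for L :: "'z measure" and S
    proof -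
      interpret L: prob_space L by fact
      have i1: "integrable L (\<lambda>\<omega>. cts_step x y (S \<omega>))"
        using measurable_compose[OF S meas]
        by (intro L.integrable_const_bound[where B=1]) (use xy in \<open>auto simp: cts_step_def\<close>)
      have i2: "integrable L (\<lambda>\<omega>. exp (- real i * S \<omega>))" for i
        using S0 by (intro L.integrable_const_bound[where B=1]) auto
      have "integral\<^sup>L (distr L borel S) (cts_step x y)
          - (\<Sum>i\<le>N. a i * (\<integral>\<omega>. exp (- real i * S \<omega>) \<partial>L))
        = (\<integral>\<omega>. cts_step x y (S \<omega>) - (\<Sum>i\<le>N. a i * exp (- real i * S \<omega>)) \<partial>L)"
        using i1 i2 by (subst integral_distr) (auto simp: meas)
      also have "\<bar>\<dots>\<bar> \<le> (\<integral>\<omega>. \<bar>cts_step x y (S \<omega>) - (\<Sum>i\<le>N. a i * exp (- real i * S \<omega>))\<bar> \<partial>L)"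
        by (rule integral_abs_bound)
      also have "\<dots> \<le> (\<integral>\<omega>. e / 3 \<partial>L)"
      proof (rule integral_mono_AE)
        show "AE \<omega> in L. \<bar>cts_step x y (S \<omega>) - (\<Sum>i\<le>N. a i * exp (- real i * S \<omega>))\<bar> \<le> e / 3"
          using S0
        proof eventually_elim
          case (elim \<omega>)
          have "\<bar>g (exp (- S \<omega>)) - p (exp (- S \<omega>))\<bar> < e / 3"
            using elim by (intro p) auto
          then show ?case
            by (simp add: g_exp pa exp_of_nat_mult[symmetric])
        qed
      qed (use i1 i2 in auto)
      finally show ?thesis by (simp add: L.prob_space)
    qed
    have "(\<lambda>n. \<Sum>i\<le>N. a i * (\<integral>\<omega>. exp (- real i * T n \<omega>) \<partial>M n))
        \<longlonglongrightarrow> (\<Sum>i\<le>N. a i * (\<integral>q. exp (- real i * U q) \<partial>Q))"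
      by (intro tendsto_intros lim)
    from tendstoD[OF this e3]
    show "\<forall>\<^sub>F n in sequentially. dist (integral\<^sup>L (distr (M n) borel (T n)) (cts_step x y))
        (integral\<^sup>L (distr Q borel U) (cts_step x y)) < e"
    proof eventually_elim
      case (elim n)
      have "AE \<omega> in M n. 0 \<le> T n \<omega>" using T0 by simp
      with elim key[OF M T, of n] key[OF Q U U0] show ?case
        unfolding dist_real_def by linarith
    qed
  qed
qed

text \<open>
  The approximation error is uniform in \<open>n\<close>; this is what permits exchanging the limit in the sample
  size with the limit in the number of coordinates.
\<close>

lemma tendsto_of_uniform_approximation:
  fixes A :: "nat \<Rightarrow> real"
  assumes A: "\<And>N n. \<bar>A n - A' N n\<bar> \<le> \<delta> N" and \<delta>: "\<delta> \<longlonglongrightarrow> 0"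
    and A': "\<And>N. A' N \<longlonglongrightarrow> B N" and B: "B \<longlonglongrightarrow> b"
  shows "A \<longlonglongrightarrow> b"
proof (rule tendstoI)
  fix e :: real assume "0 < e"
  then have e: "0 < e / 3" by simp
  obtain N where N: "\<bar>\<delta> N\<bar> < e / 3" "\<bar>B N - b\<bar> < e / 3"
    using eventually_conj[OF tendstoD[OF \<delta> e] tendstoD[OF B e]]
    by (auto simp: dist_real_def eventually_sequentially)
  show "\<forall>\<^sub>F n in sequentially. dist (A n) b < e"
    using tendstoD[OF A'[of N] e]
  proof eventually_elim
    case (elim n)
    then show ?case using N A[of n N] unfolding dist_real_def by linarith
  qed
qed

lemma exp_neg_Lipschitz:
  fixes a b s :: real
  assumes "0 \<le> a" "0 \<le> b" "0 \<le> s"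
  shows "\<bar>exp (- s * a) - exp (- s * b)\<bar> \<le> s * \<bar>a - b\<bar>"
proof -
  have *: "exp (- s * a) - exp (- s * b) \<le> s * (b - a)" if "0 \<le> a" "a \<le> b" for a b
  proof -
    have "exp (- s * a) - exp (- s * b) = exp (- s * a) * (1 - exp (- s * (b - a)))"
      by (simp add: right_diff_distrib flip: exp_add)
    also have "\<dots> \<le> 1 * (1 - exp (- s * (b - a)))"
      using that assms(3) by (intro mult_right_mono) auto
    also have "\<dots> \<le> s * (b - a)"
      using exp_ge_add_one_self[of "- s * (b - a)"] by simp
    finally show ?thesis .
  qed
  have mono: "exp (- s * b) \<le> exp (- s * a)" if "a \<le> b" for a b
    using that assms(3) by (simp add: mult_left_mono)
  show ?thesis
  proof (cases "a \<le> b")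
    case True
    then show ?thesis using *[of a b] mono[of a b] assms by simp
  next
    case False
    then show ?thesis using *[of b a] mono[of b a] assms by simp
  qed
qed

text \<open>
  A Lipschitz bound that is global in \<open>a\<close> and \<open>b\<close>, so that a perturbation of the vector can be
  controlled without controlling the norm of the vector itself.
\<close>

lemma exp_neg_square_Lipschitz:
  fixes a b s :: real
  assumes s: "0 \<le> s"
  shows "\<bar>exp (- s * a\<^sup>2) - exp (- s * b\<^sup>2)\<bar> \<le> (1 + s) * \<bar>a - b\<bar>"
proof -
  have "norm (exp (- s * a\<^sup>2) - exp (- s * b\<^sup>2)) \<le> (1 + s) * norm (a - b)"
  proof (rule field_differentiable_bound[where S=UNIV and f'="\<lambda>x. exp (- s * x\<^sup>2) * (- s * (2 * x))"])
    fix x :: real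
    show "((\<lambda>x. exp (- s * x\<^sup>2)) has_field_derivative exp (- s * x\<^sup>2) * (- s * (2 * x))) (at x within UNIV)"
      by (auto intro!: derivative_eq_intros)
    have "0 \<le> (\<bar>x\<bar> - 1)\<^sup>2" by simp
    then have "2 * \<bar>x\<bar> \<le> 1 + x\<^sup>2" by (simp add: power2_diff)
    then have "s * (2 * \<bar>x\<bar>) \<le> s * (1 + x\<^sup>2)" using s by (rule mult_left_mono)
    also have "\<dots> \<le> (1 + s) * (1 + s * x\<^sup>2)" using s by (simp add: algebra_simps)
    also have "\<dots> \<le> (1 + s) * exp (s * x\<^sup>2)"
      using s exp_ge_add_one_self[of "s * x\<^sup>2"] by (intro mult_left_mono) auto
    finally show "norm (exp (- s * x\<^sup>2) * (- s * (2 * x))) \<le> 1 + s"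
      using s by (simp add: abs_mult exp_minus field_simps)
  qed auto
  then show ?thesis by simp
qed

text \<open>
  Slutsky's lemma for squared norms. The integrands differ by at most \<open>(1 + s) \<delta>\<close> where the
  perturbation is at most \<open>\<delta>\<close>, and by at most \<open>1\<close> on the remaining event.
\<close>

lemma Laplace_Slutsky:
  fixes U e :: "nat \<Rightarrow> 's \<Rightarrow> 'h::{real_normed_vector, second_countable_topology}"
  assumes M: "\<And>n. prob_space (M n)" and U: "\<And>n. U n \<in> borel_measurable (M n)"
    and e: "\<And>n. e n \<in> borel_measurable (M n)"
    and small: "\<And>\<delta>. 0 < \<delta> \<Longrightarrow> (\<lambda>n. measure (M n) {\<omega> \<in> space (M n). \<delta> < norm (e n \<omega>)}) \<longlonglongrightarrow> 0"
    and lim: "(\<lambda>n. \<integral>\<omega>. exp (- real s * (norm (U n \<omega>))\<^sup>2) \<partial>M n) \<longlonglongrightarrow> l"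
  shows "(\<lambda>n. \<integral>\<omega>. exp (- real s * (norm (U n \<omega> + e n \<omega>))\<^sup>2) \<partial>M n) \<longlonglongrightarrow> l"
proof -
  let ?f = "\<lambda>n \<omega>. exp (- real s * (norm (U n \<omega> + e n \<omega>))\<^sup>2)"
  let ?g = "\<lambda>n \<omega>. exp (- real s * (norm (U n \<omega>))\<^sup>2)"
  note [measurable] = U e
  have bound: "\<bar>(\<integral>\<omega>. ?f n \<omega> \<partial>M n) - (\<integral>\<omega>. ?g n \<omega> \<partial>M n)\<bar>
      \<le> (1 + real s) * \<delta> + measure (M n) {\<omega> \<in> space (M n). \<delta> < norm (e n \<omega>)}" if \<delta>: "0 < \<delta>" for n \<delta>
  proof -
    interpret Mn: prob_space "M n" by (rule M)
    let ?E = "{\<omega> \<in> space (M n). \<delta> < norm (e n \<omega>)}"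
    have fi: "integrable (M n) (?f n)" and gi: "integrable (M n) (?g n)"
      by (rule Mn.integrable_const_bound[where B=1]; auto)+
    have pt: "\<bar>?f n \<omega> - ?g n \<omega>\<bar> \<le> (1 + real s) * \<delta> + indicator ?E \<omega>" if "\<omega> \<in> space (M n)" for \<omega>
    proof (cases "\<omega> \<in> ?E")
      case True
      have "?f n \<omega> \<le> 1" "?g n \<omega> \<le> 1" "0 < ?f n \<omega>" "0 < ?g n \<omega>" by auto
      then have "\<bar>?f n \<omega> - ?g n \<omega>\<bar> \<le> 1" by linarith
      moreover have "0 \<le> (1 + real s) * \<delta>" using \<delta> by simp
      ultimately show ?thesis using True by simp
    next
      case False
      then have "norm (e n \<omega>) \<le> \<delta>" using that by auto
      moreover have "\<bar>norm (U n \<omega> + e n \<omega>) - norm (U n \<omega>)\<bar> \<le> norm (e n \<omega>)"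
        using norm_triangle_ineq3[of "U n \<omega> + e n \<omega>" "U n \<omega>"] by simp
      ultimately have "(1 + real s) * \<bar>norm (U n \<omega> + e n \<omega>) - norm (U n \<omega>)\<bar> \<le> (1 + real s) * \<delta>"
        by (intro mult_left_mono) auto
      then show ?thesis
        using exp_neg_square_Lipschitz[of "real s" "norm (U n \<omega> + e n \<omega>)" "norm (U n \<omega>)"] False by (simp, linarith)
    qed
    have "\<bar>(\<integral>\<omega>. ?f n \<omega> \<partial>M n) - (\<integral>\<omega>. ?g n \<omega> \<partial>M n)\<bar> = \<bar>\<integral>\<omega>. ?f n \<omega> - ?g n \<omega> \<partial>M n\<bar>"
      using fi gi by simp
    also have "\<dots> \<le> (\<integral>\<omega>. \<bar>?f n \<omega> - ?g n \<omega>\<bar> \<partial>M n)" by (rule integral_abs_bound)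
    also have "\<dots> \<le> (\<integral>\<omega>. (1 + real s) * \<delta> + indicator ?E \<omega> \<partial>M n)"
      using fi gi pt by (intro integral_mono) (auto simp: Mn.emeasure_eq_measure)
    also have "\<dots> = (1 + real s) * \<delta> + measure (M n) ?E"
      by (subst Bochner_Integration.integral_add) (auto simp: Mn.emeasure_eq_measure Mn.prob_space)
    finally show ?thesis .
  qed
  have "(\<lambda>n. (\<integral>\<omega>. ?f n \<omega> \<partial>M n) - (\<integral>\<omega>. ?g n \<omega> \<partial>M n)) \<longlonglongrightarrow> 0"
  proof (rule tendstoI)
    fix r :: real assume r: "0 < r"
    \<comment> \<open>Half of the tolerance for each of the two contributions.\<close>
    define \<delta> where "\<delta> = r / (2 * (1 + real s))"
    have \<delta>: "0 < \<delta>" "(1 + real s) * \<delta> = r / 2" using r by (auto simp: \<delta>_def field_simps)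
    have "\<forall>\<^sub>F n in sequentially. dist (measure (M n) {\<omega> \<in> space (M n). \<delta> < norm (e n \<omega>)}) 0 < r / 2"
      using small[OF \<delta>(1)] r by (intro tendstoD) auto
    then show "\<forall>\<^sub>F n in sequentially. dist ((\<integral>\<omega>. ?f n \<omega> \<partial>M n) - (\<integral>\<omega>. ?g n \<omega> \<partial>M n)) 0 < r"
    proof eventually_elim
      case (elim n)
      then show ?case using bound[OF \<delta>(1), of n] \<delta>(2) by (simp add: dist_real_def)
    qed
  qed
  from tendsto_add[OF this lim] show ?thesis by simp
qed

section \<open>Characteristic functions of Gaussian sums and of powers\<close>

lemma (in prob_space) char_std_normal_sum:
  assumes indep: "indep_vars (\<lambda>_. borel) Z UNIV"
    and Z: "\<And>j. distributed M lborel (Z j) std_normal_density"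
  shows "(CLINT q|M. iexp (\<Sum>j\<in>F. a j * Z j q)) = complex_of_real (exp (- (\<Sum>j\<in>F. (a j)\<^sup>2) / 2))"
proof -
  have [measurable]: "Z j \<in> borel_measurable M" for j
    using distributed_measurable[OF Z[of j]] by simp
  have d: "distr M borel (Z j) = std_normal_distribution" for j
    using distributed_distr_eq_density[OF Z[of j]] by (simp cong: distr_cong)
  have c: "char (distr M borel (\<lambda>q. a j * Z j q)) 1 = exp (- ((a j)\<^sup>2) / 2)" for j
  proof -
    have "char (distr M borel (\<lambda>q. a j * Z j q)) 1 = char (distr M borel (Z j)) (a j)"
      by (simp add: char_def integral_distr)
    then show ?thesis by (simp add: d char_std_normal_distribution)
  qed
  have "(CLINT q|M. iexp (\<Sum>j\<in>F. a j * Z j q)) = char (distr M borel (\<lambda>q. \<Sum>j\<in>F. a j * Z j q)) 1"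
    by (simp add: char_def integral_distr)
  also have "\<dots> = (\<Prod>j\<in>F. char (distr M borel (\<lambda>q. a j * Z j q)) 1)"
    by (rule char_distr_sum, rule indep_vars_compose2[where X=Z])
       (auto intro: indep_vars_subset[OF indep])
  also have "\<dots> = (\<Prod>j\<in>F. complex_of_real (exp (- ((a j)\<^sup>2) / 2)))"
    by (simp only: c)
  also have "\<dots> = complex_of_real (exp (- (\<Sum>j\<in>F. (a j)\<^sup>2) / 2))"
    by (cases "finite F") (simp_all add: exp_sum sum_negf[symmetric] sum_divide_distrib flip: of_real_prod)
  finally show ?thesis .
qed

text \<open>
  The analytic core of the central limit theorem, for powers of a single characteristic function. In
  this form it applies to every row of a triangular array whose rows live on different probability
  spaces, and the variance may be zero, as happens in directions of the kernel of the covariance.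
\<close>

lemma (in real_distribution) char_power_tendsto:
  assumes int: "integrable M (\<lambda>x. x)" and mean: "expectation (\<lambda>x. x) = 0"
    and int2: "integrable M (\<lambda>x. x\<^sup>2)"
  shows "(\<lambda>n. char M (t / sqrt (real n)) ^ n)
    \<longlonglongrightarrow> complex_of_real (exp (- (t\<^sup>2 * expectation (\<lambda>x. x\<^sup>2)) / 2))"
proof -
  define v where "v = expectation (\<lambda>x. x\<^sup>2)"
  have v0: "0 \<le> v" by (simp add: v_def)
  have main: "\<forall>\<^sub>F n in sequentially.
      cmod (char M (t / sqrt (real n)) ^ n - of_real ((1 + (-(t\<^sup>2 * v) / 2) / n)^n)) \<le>
      t\<^sup>2 / 6 * (LINT x|M. min (6 * x\<^sup>2) (\<bar>t / sqrt n\<bar> * \<bar>x\<bar> ^ 3))"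
  proof (rule eventually_sequentiallyI)
    fix n :: nat
    assume "n \<ge> max 1 (nat (ceiling (t\<^sup>2 * v / 4)))"
    hence n: "n \<ge> t\<^sup>2 * v / 4" and n1: "n > 0"
      by linarith+
    let ?t = "t / sqrt n"
    let ?I = "LINT x|M. min (6 * x\<^sup>2) (\<bar>?t\<bar> * \<bar>x\<bar> ^ 3)"
    have "norm (char M ?t - (1 - ?t\<^sup>2 * v / 2)) \<le> ?t\<^sup>2 / 6 * ?I"
      by (rule char_approx3[OF int mean int2]) (simp add: v_def mean)
    also have "?t\<^sup>2 = t\<^sup>2 / n" by (simp add: power_divide)
    also have "1 - t\<^sup>2 / n * v / 2 = 1 + (-(t\<^sup>2 * v) / 2) / n" by simp
    finally have **: "norm (char M ?t - of_real (1 + (-(t\<^sup>2 * v) / 2) / n)) \<le> t\<^sup>2 / n / 6 * ?I" .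
    have "norm (char M ?t ^ n - (complex_of_real (1 + (-(t\<^sup>2 * v) / 2) / n))^n) \<le>
         n * norm (char M ?t - (complex_of_real (1 + (-(t\<^sup>2 * v) / 2) / n)))"
      using n n1 v0
      by (auto intro!: norm_power_diff cmod_char_le_1 abs_leI
               simp del: of_real_diff simp: of_real_diff[symmetric] divide_le_eq)
    also have "\<dots> \<le> n * (t\<^sup>2 / n / 6 * ?I)"
      by (rule mult_left_mono [OF **], simp)
    also have "\<dots> = t\<^sup>2 / 6 * ?I" using n1 by simp
    finally show "norm (char M ?t ^ n - of_real ((1 + (-(t\<^sup>2 * v) / 2) / n)^n)) \<le> t\<^sup>2 / 6 * ?I"
      by simp
  qed
  have "(\<lambda>n. min (6 * x\<^sup>2) (\<bar>t / sqrt (real n)\<bar> * \<bar>x\<bar> ^ 3)) \<longlonglongrightarrow> min (6 * x\<^sup>2) (0 * \<bar>x\<bar> ^ 3)" for x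
    by (intro tendsto_intros tendsto_rabs_zero tendsto_divide_0[OF tendsto_const]
        filterlim_at_top_imp_at_infinity sqrt_at_top[THEN filterlim_compose] filterlim_real_sequentially)
  then have "(\<lambda>n. LINT x|M. min (6 * x\<^sup>2) (\<bar>t / sqrt (real n)\<bar> * \<bar>x\<bar> ^ 3)) \<longlonglongrightarrow> (LINT x|M. 0)"
    by (intro integral_dominated_convergence [where w = "\<lambda>x. 6 * x\<^sup>2"]) (auto simp: int2)
  then have *: "(\<lambda>n. t\<^sup>2 / 6 * (LINT x|M. min (6 * x\<^sup>2) (\<bar>t / sqrt (real n)\<bar> * \<bar>x\<bar> ^ 3))) \<longlonglongrightarrow> 0"
    by (simp only: integral_zero tendsto_mult_right_zero)
  have "(\<lambda>n. complex_of_real ((1 + (-(t\<^sup>2 * v) / 2) / n)^n)) \<longlonglongrightarrow> complex_of_real (exp (-(t\<^sup>2 * v) / 2))"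
    by (rule isCont_tendsto_compose [OF _ tendsto_exp_limit_sequentially]) auto
  then show ?thesis
    unfolding v_def[symmetric]
    by (rule Lim_transform) (rule Lim_null_comparison [OF main *])
qed

section \<open>Independent copies of a Hilbert space valued random variable\<close>

text \<open>
  All sequences averaged below (\<open>\<epsilon>\<^sub>i X\<^sub>i\<close>, \<open>(X\<^sub>i \<otimes> X\<^sub>i) h\<close>, \<open>\<parallel>X\<^sub>i\<parallel>\<^sup>2\<close>, projections of these) are obtained from the
  observed pairs by this transfer.
\<close>

lemma iid_copies_compose:
  assumes M: "prob_space M" and S: "iid_copies M I S P S0"
    and S0: "S0 \<in> borel_measurable P" and g: "g \<in> borel_measurable borel"
  shows "iid_copies M I (\<lambda>i \<omega>. g (S i \<omega>)) P (\<lambda>\<omega>. g (S0 \<omega>))"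
proof -
  interpret M: prob_space M by fact
  have ind: "M.indep_vars (\<lambda>_. borel) S I" and d: "\<And>i. i \<in> I \<Longrightarrow> distr M borel (S i) = distr P borel S0"
    using S by (auto simp: iid_copies_def)
  have [measurable]: "S i \<in> borel_measurable M" if "i \<in> I" for i
    using ind that by (auto simp: M.indep_vars_def)
  note [measurable] = S0 g
  have "distr M borel (\<lambda>\<omega>. g (S i \<omega>)) = distr P borel (\<lambda>\<omega>. g (S0 \<omega>))" if [simp]: "i \<in> I" for i
  proof -
    have "distr M borel (\<lambda>\<omega>. g (S i \<omega>)) = distr (distr M borel (S i)) borel g"
      by (subst distr_distr) (auto simp: comp_def)
    also have "\<dots> = distr P borel (\<lambda>\<omega>. g (S0 \<omega>))"
      by (simp add: d distr_distr comp_def)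
    finally show ?thesis .
  qed
  moreover have "M.indep_vars (\<lambda>_. borel) (\<lambda>i \<omega>. g (S i \<omega>)) I"
    by (rule M.indep_vars_compose2[OF ind]) simp
  ultimately show ?thesis by (simp add: iid_copies_def)
qed

lemma iid_copies_measurable:
  "prob_space M \<Longrightarrow> iid_copies M I S P S0 \<Longrightarrow> i \<in> I \<Longrightarrow> S i \<in> borel_measurable M"
  by (auto simp: iid_copies_def prob_space.indep_vars_def)

lemma iid_copies_subset:
  "prob_space M \<Longrightarrow> iid_copies M I S P S0 \<Longrightarrow> I' \<subseteq> I \<Longrightarrow> iid_copies M I' S P S0"
  by (auto simp: iid_copies_def intro: prob_space.indep_vars_subset)

lemma
  fixes f :: "'c::topological_space \<Rightarrow> 'e::{banach, second_countable_topology}"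
  assumes M: "prob_space M" and S: "iid_copies M I S P S0"
    and S0: "S0 \<in> borel_measurable P" and f: "f \<in> borel_measurable borel" and i: "i \<in> I"
  shows iid_copies_integral: "(\<integral>\<omega>. f (S i \<omega>) \<partial>M) = (\<integral>\<omega>. f (S0 \<omega>) \<partial>P)"
    and iid_copies_integrable: "integrable M (\<lambda>\<omega>. f (S i \<omega>)) \<longleftrightarrow> integrable P (\<lambda>\<omega>. f (S0 \<omega>))"
proof -
  have d: "distr M borel (S i) = distr P borel S0" using S i by (auto simp: iid_copies_def)
  note [measurable] = S0 f iid_copies_measurable[OF M S i]
  show "(\<integral>\<omega>. f (S i \<omega>) \<partial>M) = (\<integral>\<omega>. f (S0 \<omega>) \<partial>P)"
    using integral_distr[of "S i" M borel f] integral_distr[of S0 P borel f] by (simp add: d)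
  show "integrable M (\<lambda>\<omega>. f (S i \<omega>)) \<longleftrightarrow> integrable P (\<lambda>\<omega>. f (S0 \<omega>))"
    using integrable_distr_eq[of "S i" M borel f] integrable_distr_eq[of S0 P borel f] by (simp add: d)
qed

lemma integrable_of_norm_square:
  fixes f :: "'p \<Rightarrow> 'h::{banach, second_countable_topology}"
  assumes "prob_space P" and [measurable]: "f \<in> borel_measurable P" and "integrable P (\<lambda>\<omega>. (norm (f \<omega>))\<^sup>2)"
  shows "integrable P f"
proof -
  interpret prob_space P by fact
  have "integrable P (\<lambda>\<omega>. norm (f \<omega>))"
    by (rule square_integrable_imp_integrable) (use assms in auto)
  then show ?thesis by (simp add: integrable_norm_iff)
qed

text \<open>
  The joint law is a product measure, and Fubini's theorem lets the inner integral pass through the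
  inner product.
\<close>

lemma expectation_inner_independent:
  fixes S T :: "'s \<Rightarrow> 'h::{real_inner, banach, second_countable_topology}"
  assumes M: "prob_space M" and ind: "prob_space.indep_var M borel S borel T"
    and S: "integrable M S" and T: "integrable M T"
  shows "integrable M (\<lambda>\<omega>. S \<omega> \<bullet> T \<omega>)" "(\<integral>\<omega>. S \<omega> \<bullet> T \<omega> \<partial>M) = (\<integral>\<omega>. S \<omega> \<partial>M) \<bullet> (\<integral>\<omega>. T \<omega> \<partial>M)"
proof -
  interpret M: prob_space M by fact
  note [measurable] = borel_measurable_integrable[OF S] borel_measurable_integrable[OF T]
  let ?A = "distr M borel S" and ?B = "distr M borel T"
  interpret A: prob_space ?A by (rule M.prob_space_distr) simp
  interpret B: prob_space ?B by (rule M.prob_space_distr) simp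
  interpret AB: pair_sigma_finite ?A ?B ..
  have d: "?A \<Otimes>\<^sub>M ?B = distr M (borel \<Otimes>\<^sub>M borel) (\<lambda>x. (S x, T x))"
    using ind by (simp add: M.indep_var_distribution_eq)
  have A1: "integrable ?A (\<lambda>x. x)" and B1: "integrable ?B (\<lambda>x. x)"
    using S T by (simp_all add: integrable_distr_eq)
  have int: "integrable (?A \<Otimes>\<^sub>M ?B) (\<lambda>(x, y). x \<bullet> y)"
  proof (rule AB.Fubini_integrable)
    have "integrable ?A (\<lambda>x. norm x * (\<integral>y. norm y \<partial>?B))"
      using A1 by (intro integrable_mult_left integrable_norm)
    then show "integrable ?A (\<lambda>x. LINT y|?B. norm (case (x, y) of (x, y) \<Rightarrow> x \<bullet> y))"
    proof (rule Bochner_Integration.integrable_bound)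
      show "AE x in ?A. norm (LINT y|?B. norm (case (x, y) of (x, y) \<Rightarrow> x \<bullet> y))
             \<le> norm (norm x * (\<integral>y. norm y \<partial>?B))"
      proof (rule AE_I2)
        fix x
        have "(LINT y|?B. \<bar>x \<bullet> y\<bar>) \<le> (LINT y|?B. norm x * norm y)"
          using B1 by (intro integral_mono integrable_abs integrable_inner_right integrable_mult_right integrable_norm)
             (auto simp: Cauchy_Schwarz_ineq2)
        then show "norm (LINT y|?B. norm (case (x, y) of (x, y) \<Rightarrow> x \<bullet> y))
             \<le> norm (norm x * (\<integral>y. norm y \<partial>?B))"
          by (auto simp: )
      qed
    qed simp
    show "AE x in ?A. integrable ?B (\<lambda>y. case (x, y) of (x, y) \<Rightarrow> x \<bullet> y)"
      using B1 by auto
  qed simp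
  then show "integrable M (\<lambda>\<omega>. S \<omega> \<bullet> T \<omega>)"
    unfolding d by (subst (asm) integrable_distr_eq) auto
  have "(\<integral>\<omega>. S \<omega> \<bullet> T \<omega> \<partial>M) = (\<integral>z. (case z of (x, y) \<Rightarrow> x \<bullet> y) \<partial>(?A \<Otimes>\<^sub>M ?B))"
    unfolding d by (subst integral_distr) auto
  also have "\<dots> = (\<integral>x. (\<integral>y. x \<bullet> y \<partial>?B) \<partial>?A)"
    using AB.integral_fst'[OF int] by simp
  also have "\<dots> = (\<integral>x. x \<partial>?A) \<bullet> (\<integral>y. y \<partial>?B)"
    using A1 B1 by simp
  finally show "(\<integral>\<omega>. S \<omega> \<bullet> T \<omega> \<partial>M) = (\<integral>\<omega>. S \<omega> \<partial>M) \<bullet> (\<integral>\<omega>. T \<omega> \<partial>M)"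
    by (simp add: integral_distr)
qed

lemma (in prob_space) indep_vars_imp_indep_var:
  assumes "indep_vars N X I" "i \<in> I" "j \<in> I" "i \<noteq> j"
  shows "indep_var (N i) (X i) (N j) (X j)"
proof -
  have "indep_var (PiM {i} N) (\<lambda>\<omega>. restrict (\<lambda>i. X i \<omega>) {i}) (PiM {j} N) (\<lambda>\<omega>. restrict (\<lambda>i. X i \<omega>) {j})"
    using assms by (intro indep_var_restrict) auto
  then have "indep_var (N i) ((\<lambda>f. f i) \<circ> (\<lambda>\<omega>. restrict (\<lambda>i. X i \<omega>) {i})) (N j) ((\<lambda>f. f j) \<circ> (\<lambda>\<omega>. restrict (\<lambda>i. X i \<omega>) {j}))"
    by (rule indep_var_compose) auto
  then show ?thesis by (simp add: comp_def)
qed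

text \<open>
  Independent centred vectors are orthogonal in mean, so only the diagonal terms of the double sum
  survive. This is the only consequence of independence used by the laws of large numbers and by the
  bound on the discarded coordinates.
\<close>

lemma iid_copies_second_moment_sum:
  fixes \<xi> :: "nat \<Rightarrow> 's \<Rightarrow> 'h::{real_inner, banach, second_countable_topology}"
  assumes M: "prob_space M" and P: "prob_space P" and S: "iid_copies M I \<xi> P \<xi>0"
    and \<xi>0: "\<xi>0 \<in> borel_measurable P"
    and sq: "integrable P (\<lambda>\<omega>. (norm (\<xi>0 \<omega>))\<^sup>2)" and mean: "(\<integral>\<omega>. \<xi>0 \<omega> \<partial>P) = 0"
    and A: "finite A" "A \<subseteq> I"
  shows "integrable M (\<lambda>\<omega>. (norm (\<Sum>i\<in>A. \<xi> i \<omega>))\<^sup>2)"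
    and "(\<integral>\<omega>. (norm (\<Sum>i\<in>A. \<xi> i \<omega>))\<^sup>2 \<partial>M) = real (card A) * (\<integral>\<omega>. (norm (\<xi>0 \<omega>))\<^sup>2 \<partial>P)"
proof -
  interpret M: prob_space M by fact
  have int0: "integrable P \<xi>0" by (rule integrable_of_norm_square[OF P \<xi>0 sq])
  have int: "integrable M (\<xi> i)" and mean': "(\<integral>\<omega>. \<xi> i \<omega> \<partial>M) = 0" if "i \<in> I" for i
    using iid_copies_integrable[OF M S \<xi>0, of "\<lambda>x. x"] iid_copies_integral[OF M S \<xi>0, of "\<lambda>x. x"] int0 that
    by (auto simp: mean)
  have off: "integrable M (\<lambda>\<omega>. \<xi> i \<omega> \<bullet> \<xi> j \<omega>) \<and> (\<integral>\<omega>. \<xi> i \<omega> \<bullet> \<xi> j \<omega> \<partial>M) = 0"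
    if "i \<in> I" "j \<in> I" "i \<noteq> j" for i j
  proof -
    have "M.indep_var borel (\<xi> i) borel (\<xi> j)"
      using S that M.indep_vars_imp_indep_var[of "\<lambda>_. borel" \<xi> I i j] by (auto simp: iid_copies_def)
    from expectation_inner_independent[OF M this int[OF that(1)] int[OF that(2)]]
    show ?thesis by (simp add: mean' that)
  qed
  have diag: "integrable M (\<lambda>\<omega>. \<xi> i \<omega> \<bullet> \<xi> i \<omega>) \<and>
      (\<integral>\<omega>. \<xi> i \<omega> \<bullet> \<xi> i \<omega> \<partial>M) = (\<integral>\<omega>. (norm (\<xi>0 \<omega>))\<^sup>2 \<partial>P)" if "i \<in> I" for i
    using iid_copies_integrable[OF M S \<xi>0, of "\<lambda>x. x \<bullet> x"] iid_copies_integral[OF M S \<xi>0, of "\<lambda>x. x \<bullet> x"] that sq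
    by (simp add: power2_norm_eq_inner)
  have int2: "integrable M (\<lambda>\<omega>. \<xi> i \<omega> \<bullet> \<xi> j \<omega>)" if "i \<in> I" "j \<in> I" for i j
    using off[of i j] diag[of i] that by (cases "i = j") auto
  have eq: "(norm (\<Sum>i\<in>A. \<xi> i \<omega>))\<^sup>2 = (\<Sum>i\<in>A. \<Sum>j\<in>A. \<xi> i \<omega> \<bullet> \<xi> j \<omega>)" for \<omega>
    by (simp only: power2_norm_eq_inner inner_sum_left inner_sum_right) (rule sum.swap)
  show "integrable M (\<lambda>\<omega>. (norm (\<Sum>i\<in>A. \<xi> i \<omega>))\<^sup>2)"
    unfolding eq using A int2 by (intro Bochner_Integration.integrable_sum) auto
  have "(\<integral>\<omega>. (norm (\<Sum>i\<in>A. \<xi> i \<omega>))\<^sup>2 \<partial>M) = (\<Sum>i\<in>A. \<Sum>j\<in>A. \<integral>\<omega>. \<xi> i \<omega> \<bullet> \<xi> j \<omega> \<partial>M)"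
    unfolding eq using A int2
    by (subst Bochner_Integration.integral_sum)
       (auto intro!: Bochner_Integration.integrable_sum sum.cong Bochner_Integration.integral_sum)
  also have "\<dots> = (\<Sum>i\<in>A. \<Sum>j\<in>A. if i = j then (\<integral>\<omega>. (norm (\<xi>0 \<omega>))\<^sup>2 \<partial>P) else 0)"
    using A off diag by (intro sum.cong refl) (auto split: if_splits simp: subset_iff)
  also have "\<dots> = real (card A) * (\<integral>\<omega>. (norm (\<xi>0 \<omega>))\<^sup>2 \<partial>P)"
    using A by simp
  finally show "(\<integral>\<omega>. (norm (\<Sum>i\<in>A. \<xi> i \<omega>))\<^sup>2 \<partial>M) = real (card A) * (\<integral>\<omega>. (norm (\<xi>0 \<omega>))\<^sup>2 \<partial>P)" .
qed

text \<open>
  The one-dimensional central limit theorem for the linear form \<open>h\<close>, stated through characteristic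
  functions because these are what the Gaussian mixture formula consumes.
\<close>

lemma iid_char_tendsto:
  fixes \<zeta> :: "nat \<Rightarrow> nat \<Rightarrow> 's \<Rightarrow> 'h::{real_inner, banach, second_countable_topology}"
  assumes M: "\<And>n. prob_space (M n)" and P: "prob_space P"
    and S: "\<And>n. iid_copies (M n) {..<n} (\<zeta> n) P \<zeta>0"
    and \<zeta>0: "\<zeta>0 \<in> borel_measurable P"
    and sq: "integrable P (\<lambda>\<omega>. (norm (\<zeta>0 \<omega>))\<^sup>2)" and mean: "(\<integral>\<omega>. \<zeta>0 \<omega> \<partial>P) = 0"
  shows "(\<lambda>n. CLINT \<omega>|M n. iexp (h \<bullet> ((1 / sqrt (real n)) *\<^sub>R (\<Sum>i<n. \<zeta> n i \<omega>))))
     \<longlonglongrightarrow> complex_of_real (exp (- (\<integral>\<omega>. (h \<bullet> \<zeta>0 \<omega>)\<^sup>2 \<partial>P) / 2))"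
proof -
  interpret P: prob_space P by fact
  note [measurable] = \<zeta>0
  let ?\<mu> = "distr P borel (\<lambda>\<omega>. h \<bullet> \<zeta>0 \<omega>)"
  interpret \<mu>: real_distribution ?\<mu> by (rule P.real_distribution_distr) simp
  have int0: "integrable P \<zeta>0" by (rule integrable_of_norm_square[OF P \<zeta>0 sq])
  have int2: "integrable P (\<lambda>\<omega>. (h \<bullet> \<zeta>0 \<omega>)\<^sup>2)"
  proof (rule Bochner_Integration.integrable_bound)
    show "integrable P (\<lambda>\<omega>. (norm h)\<^sup>2 * (norm (\<zeta>0 \<omega>))\<^sup>2)" using sq by simp
    show "AE \<omega> in P. norm ((h \<bullet> \<zeta>0 \<omega>)\<^sup>2) \<le> norm ((norm h)\<^sup>2 * (norm (\<zeta>0 \<omega>))\<^sup>2)"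
      using Cauchy_Schwarz_ineq2[of h] by (auto simp: power_mult_distrib[symmetric] abs_le_square_iff[symmetric])
  qed simp
  have "(CLINT \<omega>|M n. iexp (h \<bullet> ((1 / sqrt (real n)) *\<^sub>R (\<Sum>i<n. \<zeta> n i \<omega>))))
      = char ?\<mu> (1 / sqrt (real n)) ^ n" for n
  proof -
    interpret Mn: prob_space "M n" by (rule M)
    have Sh: "iid_copies (M n) {..<n} (\<lambda>i \<omega>. h \<bullet> \<zeta> n i \<omega>) P (\<lambda>\<omega>. h \<bullet> \<zeta>0 \<omega>)"
      by (rule iid_copies_compose[OF M S \<zeta>0]) simp
    have [measurable]: "(\<lambda>\<omega>. h \<bullet> \<zeta> n i \<omega>) \<in> borel_measurable (M n)" if "i < n" for i
      using iid_copies_measurable[OF M Sh, of i] that by simp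
    have ind: "Mn.indep_vars (\<lambda>_. borel) (\<lambda>i \<omega>. h \<bullet> \<zeta> n i \<omega>) {..<n}"
      and d: "\<And>i. i < n \<Longrightarrow> distr (M n) borel (\<lambda>\<omega>. h \<bullet> \<zeta> n i \<omega>) = ?\<mu>"
      using Sh by (auto simp: iid_copies_def)
    have "(CLINT \<omega>|M n. iexp (h \<bullet> ((1 / sqrt (real n)) *\<^sub>R (\<Sum>i<n. \<zeta> n i \<omega>))))
        = char (distr (M n) borel (\<lambda>\<omega>. \<Sum>i<n. h \<bullet> \<zeta> n i \<omega>)) (1 / sqrt (real n))"
      by (simp add: char_def integral_distr inner_sum_right)
    also have "\<dots> = (\<Prod>i<n. char (distr (M n) borel (\<lambda>\<omega>. h \<bullet> \<zeta> n i \<omega>)) (1 / sqrt (real n)))"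
      by (rule Mn.char_distr_sum[OF ind])
    finally show ?thesis by (simp add: d)
  qed
  moreover have "(\<lambda>n. char ?\<mu> (1 / sqrt (real n)) ^ n)
      \<longlonglongrightarrow> complex_of_real (exp (- (1\<^sup>2 * \<mu>.expectation (\<lambda>x. x\<^sup>2)) / 2))"
    using int0 int2 by (intro \<mu>.char_power_tendsto) (auto simp: integrable_distr_eq integral_distr mean)
  ultimately show ?thesis by (simp add: integral_distr)
qed

lemma centered_second_moment:
  fixes f :: "'p \<Rightarrow> 'h::{real_inner, banach, second_countable_topology}"
  assumes P: "prob_space P" and [measurable]: "f \<in> borel_measurable P"
    and sq: "integrable P (\<lambda>\<omega>. (norm (f \<omega>))\<^sup>2)"
  defines "c \<equiv> \<integral>\<omega>. f \<omega> \<partial>P"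
  shows "integrable P (\<lambda>\<omega>. (norm (f \<omega> - c))\<^sup>2)" "(\<integral>\<omega>. f \<omega> - c \<partial>P) = 0"
proof -
  interpret prob_space P by fact
  have int: "integrable P f" by (rule integrable_of_norm_square[OF P _ sq]) simp
  have "(norm (f \<omega> - c))\<^sup>2 = (norm (f \<omega>))\<^sup>2 - 2 * (f \<omega> \<bullet> c) + (norm c)\<^sup>2" for \<omega>
    by (simp add: power2_norm_eq_inner inner_diff_left inner_diff_right inner_commute)
  then show "integrable P (\<lambda>\<omega>. (norm (f \<omega> - c))\<^sup>2)" using int sq by simp
  show "(\<integral>\<omega>. f \<omega> - c \<partial>P) = 0" using int by (simp add: c_def prob_space)
qed

lemma iid_mean_tendsto_in_probability:
  fixes \<xi> :: "nat \<Rightarrow> nat \<Rightarrow> 's \<Rightarrow> 'h::{real_inner, banach, second_countable_topology}"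
  assumes M: "\<And>n. prob_space (M n)" and P: "prob_space P"
    and S: "\<And>n. iid_copies (M n) {..<n} (\<xi> n) P \<xi>0"
    and \<xi>0: "\<xi>0 \<in> borel_measurable P"
    and sq: "integrable P (\<lambda>\<omega>. (norm (\<xi>0 \<omega>))\<^sup>2)" and \<delta>: "0 < \<delta>"
  shows "(\<lambda>n. measure (M n) {\<omega> \<in> space (M n).
      \<delta> < norm ((1 / real n) *\<^sub>R (\<Sum>i<n. \<xi> n i \<omega>) - (\<integral>\<omega>. \<xi>0 \<omega> \<partial>P))}) \<longlonglongrightarrow> 0"
proof -
  define c where "c = (\<integral>\<omega>. \<xi>0 \<omega> \<partial>P)"
  define v where "v = (\<integral>\<omega>. (norm (\<xi>0 \<omega> - c))\<^sup>2 \<partial>P)"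
  note cent = centered_second_moment[OF P \<xi>0 sq, folded c_def]
  have bound: "measure (M n) {\<omega> \<in> space (M n). \<delta> < norm ((1 / real n) *\<^sub>R (\<Sum>i<n. \<xi> n i \<omega>) - c)}
      \<le> v / \<delta>\<^sup>2 * (1 / real n)" if n: "0 < n" for n
  proof -
    interpret Mn: prob_space "M n" by (rule M)
    have [measurable]: "\<xi> n i \<in> borel_measurable (M n)" if "i < n" for i
      using iid_copies_measurable[OF M S] that by auto
    have Sc: "iid_copies (M n) {..<n} (\<lambda>i \<omega>. \<xi> n i \<omega> - c) P (\<lambda>\<omega>. \<xi>0 \<omega> - c)"
      by (rule iid_copies_compose[OF M S \<xi>0]) simp
    have m: "(\<lambda>\<omega>. \<xi>0 \<omega> - c) \<in> borel_measurable P" using \<xi>0 by simp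
    note mom = iid_copies_second_moment_sum[OF M P Sc m cent finite_lessThan subset_refl]
    let ?D = "\<lambda>\<omega>. (1 / real n) *\<^sub>R (\<Sum>i<n. \<xi> n i \<omega>) - c"
    have "?D \<omega> = (1 / real n) *\<^sub>R (\<Sum>i<n. \<xi> n i \<omega> - c)" for \<omega>
      using n by (simp add: sum_subtractf scaleR_diff_right scaleR_conv_of_real[symmetric] sum_constant_scaleR)
    then have eq: "(norm (?D \<omega>))\<^sup>2 = (1 / real n)\<^sup>2 * (norm (\<Sum>i<n. \<xi> n i \<omega> - c))\<^sup>2" for \<omega>
      by (simp add: power_mult_distrib power_divide)
    have int: "integrable (M n) (\<lambda>\<omega>. (norm (?D \<omega>))\<^sup>2)"
      unfolding eq by (intro integrable_mult_right mom(1))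
    have E: "(\<integral>\<omega>. (norm (?D \<omega>))\<^sup>2 \<partial>M n) = v / real n"
      unfolding eq integral_mult_right_zero mom(2) using n by (simp add: v_def power2_eq_square)
    have "measure (M n) {\<omega> \<in> space (M n). \<delta> < norm (?D \<omega>)}
        \<le> measure (M n) {\<omega> \<in> space (M n). \<delta>\<^sup>2 \<le> (norm (?D \<omega>))\<^sup>2}"
      using \<delta> by (intro Mn.finite_measure_mono) (auto intro!: power_mono)
    also have "\<dots> \<le> (\<integral>\<omega>. (norm (?D \<omega>))\<^sup>2 \<partial>M n) / \<delta>\<^sup>2"
      using \<delta> int by (intro integral_Markov_inequality_measure[where A="{}"]) auto
    finally show ?thesis by (simp add: E field_simps)
  qed
  have "(\<lambda>n. measure (M n) {\<omega> \<in> space (M n). \<delta> < norm ((1 / real n) *\<^sub>R (\<Sum>i<n. \<xi> n i \<omega>) - c)}) \<longlonglongrightarrow> 0"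
  proof (rule Lim_null_comparison)
    show "\<forall>\<^sub>F n in sequentially. norm (measure (M n) {\<omega> \<in> space (M n). \<delta> < norm ((1 / real n) *\<^sub>R (\<Sum>i<n. \<xi> n i \<omega>) - c)})
        \<le> v / \<delta>\<^sup>2 * (1 / real n)"
      using eventually_gt_at_top[of 0] by eventually_elim (use bound in simp)
    show "(\<lambda>n. v / \<delta>\<^sup>2 * (1 / real n)) \<longlonglongrightarrow> 0"
      by (intro tendsto_mult_right_zero lim_1_over_n)
  qed
  then show ?thesis by (simp add: c_def)
qed

section \<open>The strong law of large numbers with second moments\<close>

lemma AE_tendsto_zero_of_summable_expectations:
  fixes G :: "nat \<Rightarrow> 's \<Rightarrow> real"
  assumes int: "\<And>k. integrable M (G k)" and G0: "\<And>k \<omega>. 0 \<le> G k \<omega>"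
    and sum: "summable (\<lambda>k. \<integral>\<omega>. G k \<omega> \<partial>M)"
  shows "AE \<omega> in M. (\<lambda>k. G k \<omega>) \<longlonglongrightarrow> 0"
proof -
  have [measurable]: "G k \<in> borel_measurable M" for k using int by auto
  have "(\<integral>\<^sup>+\<omega>. (\<Sum>k. ennreal (G k \<omega>)) \<partial>M) = (\<Sum>k. \<integral>\<^sup>+\<omega>. ennreal (G k \<omega>) \<partial>M)"
    by (rule nn_integral_suminf) simp
  also have "\<dots> = (\<Sum>k. ennreal (\<integral>\<omega>. G k \<omega> \<partial>M))"
    using int G0 by (simp add: nn_integral_eq_integral)
  also have "\<dots> = ennreal (\<Sum>k. \<integral>\<omega>. G k \<omega> \<partial>M)"
    using sum G0 by (intro suminf_ennreal2) auto
  finally have "AE \<omega> in M. (\<Sum>k. ennreal (G k \<omega>)) \<noteq> \<infinity>"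
    by (intro nn_integral_noteq_infinite) auto
  then show ?thesis
  proof eventually_elim
    case (elim \<omega>)
    then have "summable (\<lambda>k. G k \<omega>)" by (intro summable_suminf_not_top) (auto simp: G0)
    then show ?case by (rule summable_LIMSEQ_zero)
  qed
qed

text \<open>
  The classical argument along the subsequence of squares. The quantity \<open>G k\<close> dominates the squared
  norm of the mean for all sample sizes between \<open>k\<^sup>2\<close> and \<open>(k + 1)\<^sup>2\<close>, up to a factor \<open>2\<close>. Its expectation
  is at most \<open>7 v / k\<^sup>2\<close>, with \<open>v\<close> the second moment, which is summable; so \<open>G k\<close> tends to \<open>0\<close> almost
  surely.
\<close>

lemma SLLN_centered:
  fixes \<xi> :: "nat \<Rightarrow> 's \<Rightarrow> 'h::{real_inner, banach, second_countable_topology}"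
  assumes M: "prob_space M" and P: "prob_space P" and S: "iid_copies M UNIV \<xi> P \<xi>0"
    and \<xi>0: "\<xi>0 \<in> borel_measurable P"
    and sq: "integrable P (\<lambda>\<omega>. (norm (\<xi>0 \<omega>))\<^sup>2)" and mean: "(\<integral>\<omega>. \<xi>0 \<omega> \<partial>P) = 0"
  shows "AE \<omega> in M. (\<lambda>n. (1 / real n) *\<^sub>R (\<Sum>i<n. \<xi> i \<omega>)) \<longlonglongrightarrow> 0"
proof -
  interpret M: prob_space M by fact
  note mom = iid_copies_second_moment_sum[OF M P S \<xi>0 sq mean]
  define v where "v = (\<integral>\<omega>. (norm (\<xi>0 \<omega>))\<^sup>2 \<partial>P)"
  have v0: "0 \<le> v" by (simp add: v_def)
  let ?S = "\<lambda>A \<omega>. (norm (\<Sum>i\<in>A. \<xi> i \<omega>))\<^sup>2"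
  \<comment> \<open>Bounding a maximum by a sum over the block is affordable: a block has \<open>2 k + 1\<close> terms, each of expectation at most \<open>2 k v\<close>.\<close>
  define G where "G k \<omega> = (?S {..<k\<^sup>2} \<omega> + (\<Sum>n\<in>{k\<^sup>2..<(Suc k)\<^sup>2}. ?S {k\<^sup>2..<n} \<omega>)) / real k ^ 4" for k \<omega>
  have intS: "integrable M (?S A)" if "finite A" for A using mom(1)[OF that] by simp
  have G_int: "integrable M (G k)" for k
    unfolding G_def[abs_def] by (intro integrable_divide Bochner_Integration.integrable_add
        Bochner_Integration.integrable_sum intS) auto
  have G0: "0 \<le> G k \<omega>" for k \<omega> by (auto simp: G_def intro!: divide_nonneg_nonneg add_nonneg_nonneg sum_nonneg)
  have EG: "(\<integral>\<omega>. G k \<omega> \<partial>M) \<le> 7 * v * (1 / real k ^ 2)" for k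
  proof (cases "k = 0")
    case True
    then show ?thesis by (simp add: G_def)
  next
    case False
    have "(\<integral>\<omega>. G k \<omega> \<partial>M) = (real (k\<^sup>2) * v + (\<Sum>n\<in>{k\<^sup>2..<(Suc k)\<^sup>2}. real (n - k\<^sup>2) * v)) / real k ^ 4"
      unfolding G_def[abs_def] v_def
      by (simp add: intS mom(2) Bochner_Integration.integral_sum Bochner_Integration.integrable_sum)
    also have "(\<Sum>n\<in>{k\<^sup>2..<(Suc k)\<^sup>2}. real (n - k\<^sup>2) * v) \<le> (\<Sum>n\<in>{k\<^sup>2..<(Suc k)\<^sup>2}. (2 * real k) * v)"
    proof (intro sum_mono mult_right_mono v0)
      fix n assume "n \<in> {k\<^sup>2..<(Suc k)\<^sup>2}"
      then have "n - k\<^sup>2 \<le> 2 * k" by (auto simp: power2_eq_square)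
      then show "real (n - k\<^sup>2) \<le> 2 * real k" by linarith
    qed
    also have "\<dots> = (2 * real k + 1) * (2 * real k * v)"
      by (simp add: power2_eq_square algebra_simps)
    also have "\<dots> \<le> (3 * real k) * (2 * real k * v)"
      using False v0 by (intro mult_right_mono) auto
    also have "(real (k\<^sup>2) * v + (3 * real k) * (2 * real k * v)) / real k ^ 4 = 7 * v * (1 / real k ^ 2)"
      using False by (simp add: field_simps power2_eq_square power4_eq_xxxx)
    finally show ?thesis by (simp add: divide_right_mono)
  qed
  have "summable (\<lambda>k. \<integral>\<omega>. G k \<omega> \<partial>M)"
  proof (rule summable_comparison_test')
    show "summable (\<lambda>k. 7 * v * (1 / real k ^ 2))"
      using inverse_power_summable[of 2, where 'a=real] by (intro summable_mult) (simp add: inverse_eq_divide)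
    show "norm (\<integral>\<omega>. G k \<omega> \<partial>M) \<le> 7 * v * (1 / real k ^ 2)" for k
      using EG[of k] G0 by simp
  qed
  from AE_tendsto_zero_of_summable_expectations[OF G_int G0 this] show ?thesis
  proof eventually_elim
    case (elim \<omega>)
    have fs: "filterlim floor_sqrt at_top sequentially"
      unfolding filterlim_at_top
    proof
      fix Z :: nat
      show "\<forall>\<^sub>F n in sequentially. Z \<le> floor_sqrt n"
        using eventually_ge_at_top[of "Z\<^sup>2"] by eventually_elim (rule le_floor_sqrtI)
    qed
    have bound: "(norm ((1 / real n) *\<^sub>R (\<Sum>i<n. \<xi> i \<omega>)))\<^sup>2 \<le> 2 * G (floor_sqrt n) \<omega>" if n: "0 < n" for n
    proof -
      define k where "k = floor_sqrt n"
      have k: "k\<^sup>2 \<le> n" "n < (Suc k)\<^sup>2" "0 < k"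
        using n by (simp_all add: k_def Suc_floor_sqrt_power2_gt)
      let ?a = "\<Sum>i<k\<^sup>2. \<xi> i \<omega>" and ?b = "\<Sum>i\<in>{k\<^sup>2..<n}. \<xi> i \<omega>"
      have split: "(\<Sum>i<n. \<xi> i \<omega>) = ?a + ?b"
        using k(1) by (simp add: lessThan_atLeast0 sum.atLeastLessThan_concat)
      have "(norm (?a + ?b))\<^sup>2 \<le> (norm ?a + norm ?b)\<^sup>2"
        by (intro power_mono norm_triangle_ineq) simp
      also have "\<dots> \<le> 2 * ((norm ?a)\<^sup>2 + (norm ?b)\<^sup>2)"
        using zero_le_power2[of "norm ?a - norm ?b"] by (simp add: power2_diff power2_sum)
      also have "(norm ?b)\<^sup>2 \<le> (\<Sum>n\<in>{k\<^sup>2..<(Suc k)\<^sup>2}. ?S {k\<^sup>2..<n} \<omega>)"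
        using k by (intro member_le_sum[where f="\<lambda>n. ?S {k\<^sup>2..<n} \<omega>"]) auto
      finally have "(norm (\<Sum>i<n. \<xi> i \<omega>))\<^sup>2 \<le> 2 * (real k ^ 4 * G k \<omega>)"
        using k(3) by (simp add: split G_def)
      moreover have "real k ^ 4 \<le> (real n)\<^sup>2"
      proof -
        have "(real (k\<^sup>2))\<^sup>2 \<le> (real n)\<^sup>2" using of_nat_mono[OF k(1), where 'a=real] by (rule power_mono) simp
        then show ?thesis by (simp add: power_mult[symmetric])
      qed
      then have "real k ^ 4 * G k \<omega> \<le> (real n)\<^sup>2 * G k \<omega>" by (intro mult_right_mono G0)
      ultimately have "(norm (\<Sum>i<n. \<xi> i \<omega>))\<^sup>2 \<le> 2 * ((real n)\<^sup>2 * G k \<omega>)" by linarith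
      also have "2 * ((real n)\<^sup>2 * G k \<omega>) = 2 * G k \<omega> * (real n)\<^sup>2" by simp
      finally have "(norm (\<Sum>i<n. \<xi> i \<omega>))\<^sup>2 / (real n)\<^sup>2 \<le> 2 * G k \<omega>"
        using n by (subst pos_divide_le_eq) auto
      moreover have "(norm ((1 / real n) *\<^sub>R (\<Sum>i<n. \<xi> i \<omega>)))\<^sup>2 = (norm (\<Sum>i<n. \<xi> i \<omega>))\<^sup>2 / (real n)\<^sup>2"
        by (simp add: power_divide)
      ultimately show ?thesis unfolding k_def by linarith
    qed
    have "(\<lambda>n. (norm ((1 / real n) *\<^sub>R (\<Sum>i<n. \<xi> i \<omega>)))\<^sup>2) \<longlonglongrightarrow> 0"
    proof (rule tendsto_sandwich[OF _ _ tendsto_const])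
      show "\<forall>\<^sub>F n in sequentially. (norm ((1 / real n) *\<^sub>R (\<Sum>i<n. \<xi> i \<omega>)))\<^sup>2 \<le> 2 * G (floor_sqrt n) \<omega>"
        using eventually_gt_at_top[of 0] by eventually_elim (rule bound)
      show "(\<lambda>n. 2 * G (floor_sqrt n) \<omega>) \<longlonglongrightarrow> 0"
        by (intro tendsto_mult_right_zero filterlim_compose[OF elim fs])
    qed simp
    then have "(\<lambda>n. sqrt ((norm ((1 / real n) *\<^sub>R (\<Sum>i<n. \<xi> i \<omega>)))\<^sup>2)) \<longlonglongrightarrow> sqrt 0"
      by (rule tendsto_real_sqrt)
    then have "(\<lambda>n. norm ((1 / real n) *\<^sub>R (\<Sum>i<n. \<xi> i \<omega>))) \<longlonglongrightarrow> 0"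
      by (simp only: real_sqrt_abs real_sqrt_zero abs_norm_cancel)
    then show ?case by (rule tendsto_norm_zero_cancel)
  qed
qed

lemma SLLN_second_moment:
  fixes \<xi> :: "nat \<Rightarrow> 's \<Rightarrow> 'h::{real_inner, banach, second_countable_topology}"
  assumes M: "prob_space M" and P: "prob_space P" and S: "iid_copies M UNIV \<xi> P \<xi>0"
    and \<xi>0: "\<xi>0 \<in> borel_measurable P" and sq: "integrable P (\<lambda>\<omega>. (norm (\<xi>0 \<omega>))\<^sup>2)"
  shows "AE \<omega> in M. (\<lambda>n. (1 / real n) *\<^sub>R (\<Sum>i<n. \<xi> i \<omega>)) \<longlonglongrightarrow> (\<integral>\<omega>. \<xi>0 \<omega> \<partial>P)"
proof -
  define c where "c = (\<integral>\<omega>. \<xi>0 \<omega> \<partial>P)"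
  have Sc: "iid_copies M UNIV (\<lambda>i \<omega>. \<xi> i \<omega> - c) P (\<lambda>\<omega>. \<xi>0 \<omega> - c)"
    by (rule iid_copies_compose[OF M S \<xi>0]) simp
  have m: "(\<lambda>\<omega>. \<xi>0 \<omega> - c) \<in> borel_measurable P" using \<xi>0 by simp
  show ?thesis
    using SLLN_centered[OF M P Sc m centered_second_moment[OF P \<xi>0 sq, folded c_def]]
  proof eventually_elim
    case (elim \<omega>)
    have "(\<lambda>n. (1 / real n) *\<^sub>R (\<Sum>i<n. \<xi> i \<omega> - c) + c) \<longlonglongrightarrow> 0 + c"
      by (intro tendsto_add elim tendsto_const)
    moreover have "\<forall>\<^sub>F n in sequentially. (1 / real n) *\<^sub>R (\<Sum>i<n. \<xi> i \<omega> - c) + c = (1 / real n) *\<^sub>R (\<Sum>i<n. \<xi> i \<omega>)"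
      using eventually_gt_at_top[of 0]
      by eventually_elim (simp add: sum_subtractf scaleR_diff_right sum_constant_scaleR)
    ultimately have "(\<lambda>n. (1 / real n) *\<^sub>R (\<Sum>i<n. \<xi> i \<omega>)) \<longlonglongrightarrow> 0 + c"
      by (rule Lim_transform_eventually)
    then show ?case by (simp add: c_def)
  qed
qed

section \<open>Orthonormal systems and the spectral decomposition of a covariance operator\<close>

definition orthonormal_on :: "nat set \<Rightarrow> (nat \<Rightarrow> 'h::real_inner) \<Rightarrow> bool" where
  "orthonormal_on J \<phi> \<longleftrightarrow> (\<forall>i\<in>J. \<forall>j\<in>J. \<phi> i \<bullet> \<phi> j = (if i = j then 1 else 0))"

definition coord_proj :: "nat set \<Rightarrow> (nat \<Rightarrow> 'h::real_inner) \<Rightarrow> 'h \<Rightarrow> 'h" where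
  "coord_proj F \<phi> x = (\<Sum>j\<in>F. (\<phi> j \<bullet> x) *\<^sub>R \<phi> j)"

lemma inner_sum_orthonormal:
  assumes "orthonormal_on J \<phi>" "finite F" "F \<subseteq> J" "i \<in> J"
  shows "\<phi> i \<bullet> (\<Sum>j\<in>F. a j *\<^sub>R \<phi> j) = (if i \<in> F then a i else 0)"
proof -
  have "\<phi> i \<bullet> (\<Sum>j\<in>F. a j *\<^sub>R \<phi> j) = (\<Sum>j\<in>F. if i = j then a j else 0)"
    unfolding inner_sum_right using assms
    by (intro sum.cong refl) (auto simp: orthonormal_on_def subset_iff)
  then show ?thesis using assms by simp
qed

lemma norm_sum_orthonormal:
  assumes "orthonormal_on J \<phi>" "finite F" "F \<subseteq> J"
  shows "(norm (\<Sum>j\<in>F. a j *\<^sub>R \<phi> j))\<^sup>2 = (\<Sum>j\<in>F. (a j)\<^sup>2)"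
proof -
  have "(norm (\<Sum>j\<in>F. a j *\<^sub>R \<phi> j))\<^sup>2 = (\<Sum>i\<in>F. a i * (\<phi> i \<bullet> (\<Sum>j\<in>F. a j *\<^sub>R \<phi> j)))"
    by (simp add: power2_norm_eq_inner inner_sum_left)
  also have "\<dots> = (\<Sum>j\<in>F. (a j)\<^sup>2)"
    using assms by (intro sum.cong refl) (auto simp: inner_sum_orthonormal[OF assms] power2_eq_square subset_iff)
  finally show ?thesis .
qed

lemma linear_coord_proj: "linear (coord_proj F \<phi>)"
  unfolding coord_proj_def[abs_def]
  by (intro linear_compose_sum ballI linearI) (auto simp: inner_add_right scaleR_add_left)

lemma norm_coord_proj:
  "orthonormal_on J \<phi> \<Longrightarrow> finite F \<Longrightarrow> F \<subseteq> J \<Longrightarrow> (norm (coord_proj F \<phi> x))\<^sup>2 = (\<Sum>j\<in>F. (\<phi> j \<bullet> x)\<^sup>2)"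
  by (simp add: coord_proj_def norm_sum_orthonormal)

lemma coord_proj_Pythagoras:
  assumes "orthonormal_on J \<phi>" "finite F" "F \<subseteq> J"
  shows "(norm x)\<^sup>2 = (norm (coord_proj F \<phi> x))\<^sup>2 + (norm (x - coord_proj F \<phi> x))\<^sup>2"
proof -
  have "(x - coord_proj F \<phi> x) \<bullet> \<phi> i = 0" if "i \<in> F" for i
  proof -
    have "\<phi> i \<bullet> coord_proj F \<phi> x = \<phi> i \<bullet> x"
      using that inner_sum_orthonormal[OF assms, of i "\<lambda>j. \<phi> j \<bullet> x"] assms(3)
      by (auto simp: coord_proj_def)
    then have "\<phi> i \<bullet> (x - coord_proj F \<phi> x) = 0" by (simp add: inner_diff_right)
    then show ?thesis by (simp only: inner_commute)
  qed
  then have "(x - coord_proj F \<phi> x) \<bullet> coord_proj F \<phi> x = 0"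
    by (simp add: coord_proj_def[of F \<phi> x] inner_sum_right)
  then show ?thesis
    using norm_add_Pythagorean[of "coord_proj F \<phi> x" "x - coord_proj F \<phi> x"]
    by (simp add: orthogonal_def inner_commute)
qed

lemma Bessel_summable:
  assumes on: "orthonormal_on J \<phi>"
  shows "summable (\<lambda>j. if j \<in> J then (\<phi> j \<bullet> x)\<^sup>2 else 0)"
proof (rule bounded_imp_summable)
  fix n
  have "(\<Sum>j\<le>n. if j \<in> J then (\<phi> j \<bullet> x)\<^sup>2 else 0) = (norm (coord_proj (J \<inter> {..n}) \<phi> x))\<^sup>2"
    by (simp add: norm_coord_proj[OF on] sum.inter_restrict[symmetric] Int_commute)
  then show "(\<Sum>j\<le>n. if j \<in> J then (\<phi> j \<bullet> x)\<^sup>2 else 0) \<le> (norm x)\<^sup>2"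
    using coord_proj_Pythagoras[OF on, of "J \<inter> {..n}" x] by simp
qed simp

text \<open>
  By Bessel's inequality the partial expansions form a Cauchy sequence. The system need not be
  complete, so the limit is the projection onto the closed span and may differ from \<open>x\<close>.
\<close>

lemma coord_proj_convergent:
  fixes \<phi> :: "nat \<Rightarrow> 'h::{real_inner, banach}"
  assumes on: "orthonormal_on J \<phi>"
  obtains y where "(\<lambda>N. coord_proj (J \<inter> {..<N}) \<phi> x) \<longlonglongrightarrow> y"
proof -
  let ?p = "\<lambda>N. coord_proj (J \<inter> {..<N}) \<phi> x"
  let ?c = "\<lambda>j. if j \<in> J then (\<phi> j \<bullet> x)\<^sup>2 else 0"
  have part: "(\<Sum>j\<in>A. ?c j) = (\<Sum>j\<in>J \<inter> A. (\<phi> j \<bullet> x)\<^sup>2)" if "finite A" for A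
    using that by (simp add: sum.inter_restrict[symmetric] Int_commute)
  note sm = Bessel_summable[OF on, of x]
  have "Cauchy ?p"
  proof (rule metric_CauchyI)
    fix e :: real assume e: "0 < e"
    then obtain N where N: "\<And>m n. m \<ge> N \<Longrightarrow> norm (\<Sum>j=m..<n. ?c j) < e\<^sup>2"
      using sm unfolding summable_Cauchy by (meson zero_less_power)
    have *: "dist (?p n) (?p m) < e" if "m \<ge> N" "m \<le> n" for m n
    proof -
      have split: "J \<inter> {..<n} = (J \<inter> {..<m}) \<union> (J \<inter> {m..<n})" using that by auto
      have "?p n = ?p m + (\<Sum>j\<in>J \<inter> {m..<n}. (\<phi> j \<bullet> x) *\<^sub>R \<phi> j)"
        unfolding coord_proj_def split by (rule sum.union_disjoint) auto
      then have "(dist (?p n) (?p m))\<^sup>2 = (\<Sum>j=m..<n. ?c j)"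
        by (simp add: dist_norm part norm_sum_orthonormal[OF on])
      also have "\<dots> < e\<^sup>2" using N[OF that(1), of n] by simp
      finally show ?thesis using e power2_less_imp_less[of "dist (?p n) (?p m)" e] by simp
    qed
    show "\<exists>K. \<forall>m\<ge>K. \<forall>n\<ge>K. dist (?p m) (?p n) < e"
      using * by (metis dist_commute nle_le)
  qed
  then show thesis using that Cauchy_convergent convergent_def by metis
qed

lemma coord_proj_residual_orthogonal:
  assumes on: "orthonormal_on J \<phi>" and y: "(\<lambda>N. coord_proj (J \<inter> {..<N}) \<phi> x) \<longlonglongrightarrow> y" and i: "i \<in> J"
  shows "\<phi> i \<bullet> (x - y) = 0"
proof -
  have "(\<lambda>N. \<phi> i \<bullet> (x - coord_proj (J \<inter> {..<N}) \<phi> x)) \<longlonglongrightarrow> \<phi> i \<bullet> (x - y)"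
    by (intro tendsto_intros y)
  moreover have "\<forall>\<^sub>F N in sequentially. \<phi> i \<bullet> (x - coord_proj (J \<inter> {..<N}) \<phi> x) = 0"
    using eventually_gt_at_top[of i]
  proof eventually_elim
    case (elim N)
    then show ?case
      using inner_sum_orthonormal[OF on, of "J \<inter> {..<N}" i "\<lambda>j. \<phi> j \<bullet> x"] i
      by (simp add: inner_diff_right coord_proj_def)
  qed
  then have "(\<lambda>N. \<phi> i \<bullet> (x - coord_proj (J \<inter> {..<N}) \<phi> x)) \<longlonglongrightarrow> 0"
    by (rule tendsto_eventually)
  ultimately show ?thesis by (rule LIMSEQ_unique)
qed

lemma coord_proj_symmetric: "coord_proj F \<phi> x \<bullet> h = x \<bullet> coord_proj F \<phi> h"
  by (simp add: coord_proj_def inner_sum_left inner_sum_right mult.commute inner_commute)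

text \<open>
  Reduces a statement about all vectors to countably many, which is needed to exchange it with an
  almost sure quantifier.
\<close>

lemma eq_zero_if_orthogonal_to_dense:
  fixes x :: "'h::real_inner"
  assumes "closure D = UNIV" "\<And>d. d \<in> D \<Longrightarrow> d \<bullet> x = 0"
  shows "x = 0"
proof -
  have "closed {d. d \<bullet> x = 0}"
    by (intro closed_Collect_eq continuous_intros)
  then have "closure D \<subseteq> {d. d \<bullet> x = 0}" by (rule closure_minimal[rotated]) (use assms in auto)
  then have "x \<bullet> x = 0" using assms(1) by blast
  then show ?thesis by simp
qed

lemma norm_rank_one_le: "norm (rank_one x h) \<le> (norm x)\<^sup>2 * norm h"
proof -
  have "\<bar>x \<bullet> h\<bar> * norm x \<le> (norm x * norm h) * norm x"
    by (intro mult_right_mono Cauchy_Schwarz_ineq2) simp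
  then show ?thesis by (simp add: rank_one_def power2_eq_square mult_ac)
qed

lemma cov_op_inner:
  fixes \<zeta> :: "'p \<Rightarrow> 'h::{real_inner, banach, second_countable_topology}"
  assumes [measurable]: "\<zeta> \<in> borel_measurable P" and sq: "integrable P (\<lambda>\<omega>. (norm (\<zeta> \<omega>))\<^sup>2)"
  shows "integrable P (\<lambda>\<omega>. rank_one (\<zeta> \<omega>) h)"
    and "integrable P (\<lambda>\<omega>. (\<zeta> \<omega> \<bullet> g) * (\<zeta> \<omega> \<bullet> h))"
    and "g \<bullet> cov_op P \<zeta> h = (\<integral>\<omega>. (\<zeta> \<omega> \<bullet> g) * (\<zeta> \<omega> \<bullet> h) \<partial>P)"
proof -
  show 1: "integrable P (\<lambda>\<omega>. rank_one (\<zeta> \<omega>) h)"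
  proof (rule Bochner_Integration.integrable_bound)
    show "integrable P (\<lambda>\<omega>. norm h * (norm (\<zeta> \<omega>))\<^sup>2)" using sq by simp
    show "AE \<omega> in P. norm (rank_one (\<zeta> \<omega>) h) \<le> norm (norm h * (norm (\<zeta> \<omega>))\<^sup>2)"
      using norm_rank_one_le[of "\<zeta> _" h] by (simp add: mult.commute)
  qed (simp add: rank_one_def)
  have eq: "g \<bullet> rank_one (\<zeta> \<omega>) h = (\<zeta> \<omega> \<bullet> g) * (\<zeta> \<omega> \<bullet> h)" for \<omega>
    by (simp add: rank_one_def inner_commute)
  show "integrable P (\<lambda>\<omega>. (\<zeta> \<omega> \<bullet> g) * (\<zeta> \<omega> \<bullet> h))"
    using integrable_inner_right[of g P "\<lambda>\<omega>. rank_one (\<zeta> \<omega>) h"] 1 by (simp add: eq)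
  show "g \<bullet> cov_op P \<zeta> h = (\<integral>\<omega>. (\<zeta> \<omega> \<bullet> g) * (\<zeta> \<omega> \<bullet> h) \<partial>P)"
    unfolding cov_op_def using integral_inner_right[of g P "\<lambda>\<omega>. rank_one (\<zeta> \<omega>) h"] 1 by (simp add: eq)
qed

lemma cov_op_square:
  fixes \<zeta> :: "'p \<Rightarrow> 'h::{real_inner, banach, second_countable_topology}"
  assumes "\<zeta> \<in> borel_measurable P" "integrable P (\<lambda>\<omega>. (norm (\<zeta> \<omega>))\<^sup>2)"
  shows "integrable P (\<lambda>\<omega>. (h \<bullet> \<zeta> \<omega>)\<^sup>2)" "(\<integral>\<omega>. (h \<bullet> \<zeta> \<omega>)\<^sup>2 \<partial>P) = h \<bullet> cov_op P \<zeta> h"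
  using cov_op_inner(2,3)[OF assms, of h h] by (simp_all add: power2_eq_square inner_commute)

lemma spectral_decomposition_orthonormal:
  "spectral_decomposition A J w \<phi> \<Longrightarrow> orthonormal_on J \<phi>"
  by (simp add: spectral_decomposition_def orthonormal_on_def)

text \<open>
  The quadratic form of the operator on finite combinations of eigenvectors. On a single eigenvector
  of a covariance operator it identifies \<open>w j\<close> as the second moment in the direction \<open>\<phi> j\<close>.
\<close>

lemma spectral_decomposition_finite_sum:
  assumes spec: "spectral_decomposition A J w \<phi>" and F: "finite F" "F \<subseteq> J"
  shows "(\<Sum>j\<in>F. a j *\<^sub>R \<phi> j) \<bullet> A (\<Sum>j\<in>F. a j *\<^sub>R \<phi> j) = (\<Sum>j\<in>F. w j * (a j)\<^sup>2)"
proof -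
  let ?h = "\<Sum>j\<in>F. a j *\<^sub>R \<phi> j"
  note on = spectral_decomposition_orthonormal[OF spec]
  have "((\<lambda>j. w j *\<^sub>R rank_one (\<phi> j) ?h) has_sum A ?h) J"
    using spec by (simp add: spectral_decomposition_def)
  moreover have "((\<lambda>j. w j *\<^sub>R rank_one (\<phi> j) ?h) has_sum (\<Sum>j\<in>F. (w j * a j) *\<^sub>R \<phi> j)) J"
  proof -
    have "((\<lambda>j. (w j * a j) *\<^sub>R \<phi> j) has_sum (\<Sum>j\<in>F. (w j * a j) *\<^sub>R \<phi> j)) F"
      by (rule has_sum_finite[OF F(1)])
    moreover have "((\<lambda>j. w j *\<^sub>R rank_one (\<phi> j) ?h) has_sum s) J
       \<longleftrightarrow> ((\<lambda>j. (w j * a j) *\<^sub>R \<phi> j) has_sum s) F" for s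
      using F by (intro has_sum_cong_neutral) (auto simp: rank_one_def inner_sum_orthonormal[OF on F] subset_iff)
    ultimately show ?thesis by simp
  qed
  ultimately have A: "A ?h = (\<Sum>j\<in>F. (w j * a j) *\<^sub>R \<phi> j)" by (rule has_sum_unique)
  show ?thesis unfolding A inner_sum_left using F
    by (intro sum.cong refl) (auto simp: inner_sum_orthonormal[OF on F] power2_eq_square subset_iff)
qed

lemma spectral_decomposition_kernel:
  assumes spec: "spectral_decomposition A J w \<phi>" and "\<And>j. j \<in> J \<Longrightarrow> \<phi> j \<bullet> h = 0"
  shows "A h = 0"
proof -
  have "((\<lambda>j. w j *\<^sub>R rank_one (\<phi> j) h) has_sum A h) J"
    using spec by (simp add: spectral_decomposition_def)
  moreover have "((\<lambda>j. w j *\<^sub>R rank_one (\<phi> j) h) has_sum 0) J"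
    by (rule has_sum_0) (simp add: rank_one_def assms(2))
  ultimately show ?thesis by (rule has_sum_unique)
qed

text \<open>
  The operator vanishes on every vector orthogonal to all \<open>\<phi> j\<close>, hence the second moment of \<open>\<zeta>\<close> in such a
  direction is zero. So \<open>\<zeta>\<close> lies almost surely in the closed span of the eigenvectors, the
  residuals of its partial expansions tend to zero, and \<open>\<parallel>\<zeta>\<parallel>\<^sup>2\<close> dominates their squares.
\<close>

lemma coord_proj_tail_second_moment:
  fixes \<zeta> :: "'p \<Rightarrow> 'h::{real_inner, banach, second_countable_topology}"
  assumes [measurable]: "\<zeta> \<in> borel_measurable P" and sq: "integrable P (\<lambda>\<omega>. (norm (\<zeta> \<omega>))\<^sup>2)"
    and spec: "spectral_decomposition (cov_op P \<zeta>) J w \<phi>"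
  shows "(\<lambda>N. \<integral>\<omega>. (norm (\<zeta> \<omega> - coord_proj (J \<inter> {..<N}) \<phi> (\<zeta> \<omega>)))\<^sup>2 \<partial>P) \<longlonglongrightarrow> 0"
proof -
  note on = spectral_decomposition_orthonormal[OF spec]
  let ?p = "\<lambda>N. coord_proj (J \<inter> {..<N}) \<phi>"
  obtain D :: "'h set" where D: "countable D" "closure D = UNIV"
  proof -
    obtain D :: "'h set" where D: "countable D" "\<And>U. open U \<Longrightarrow> U \<noteq> {} \<Longrightarrow> \<exists>d\<in>D. d \<in> U"
      by (rule countable_dense_setE) blast
    have "closure D = UNIV"
      using D(2)[of "- closure D"] closure_subset[of D] by blast
    with D(1) show thesis by (rule that)
  qed
  have "\<forall>x. \<exists>y. (\<lambda>N. ?p N x) \<longlonglongrightarrow> y"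
    using coord_proj_convergent[OF on] by metis
  then obtain R where R: "\<And>x. (\<lambda>N. ?p N x) \<longlonglongrightarrow> R x" by metis
  \<comment> \<open>\<open>R\<close> is the projection onto the closed span; its symmetry moves the residual from the random vector to the deterministic test vector \<open>d\<close>.\<close>
  have sym: "d \<bullet> (x - R x) = (d - R d) \<bullet> x" for d x
  proof -
    have "(\<lambda>N. d \<bullet> (x - ?p N x)) \<longlonglongrightarrow> d \<bullet> (x - R x)"
      by (intro tendsto_intros R)
    moreover have "(\<lambda>N. (d - ?p N d) \<bullet> x) \<longlonglongrightarrow> (d - R d) \<bullet> x"
      by (intro tendsto_intros R)
    moreover have "d \<bullet> (x - ?p N x) = (d - ?p N d) \<bullet> x" for N
      by (simp add: inner_diff_left inner_diff_right coord_proj_symmetric)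
    ultimately show ?thesis using LIMSEQ_unique by simp
  qed
  have "AE \<omega> in P. \<forall>d\<in>D. d \<bullet> (\<zeta> \<omega> - R (\<zeta> \<omega>)) = 0"
  proof (subst AE_ball_countable[OF D(1)], intro ballI)
    fix d
    have "cov_op P \<zeta> (d - R d) = 0"
      by (rule spectral_decomposition_kernel[OF spec]) (rule coord_proj_residual_orthogonal[OF on R])
    then have "(\<integral>\<omega>. ((d - R d) \<bullet> \<zeta> \<omega>)\<^sup>2 \<partial>P) = 0"
      by (simp add: cov_op_square(2) sq)
    then have "AE \<omega> in P. ((d - R d) \<bullet> \<zeta> \<omega>)\<^sup>2 = 0"
      using cov_op_square(1)[of \<zeta> P "d - R d"] sq by (subst (asm) integral_nonneg_eq_0_iff_AE) auto
    then show "AE \<omega> in P. d \<bullet> (\<zeta> \<omega> - R (\<zeta> \<omega>)) = 0"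
      by (simp add: sym)
  qed
  then have ae: "AE \<omega> in P. R (\<zeta> \<omega>) = \<zeta> \<omega>"
  proof eventually_elim
    case (elim \<omega>)
    then have "\<zeta> \<omega> - R (\<zeta> \<omega>) = 0"
      by (intro eq_zero_if_orthogonal_to_dense[OF D(2)]) auto
    then show ?case by simp
  qed
  have "(\<lambda>N. \<integral>\<omega>. (norm (\<zeta> \<omega> - ?p N (\<zeta> \<omega>)))\<^sup>2 \<partial>P) \<longlonglongrightarrow> (\<integral>\<omega>. 0 \<partial>P)"
  proof (rule integral_dominated_convergence[where w="\<lambda>\<omega>. (norm (\<zeta> \<omega>))\<^sup>2"])
    show "AE \<omega> in P. (\<lambda>N. (norm (\<zeta> \<omega> - ?p N (\<zeta> \<omega>)))\<^sup>2) \<longlonglongrightarrow> 0"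
      using ae
    proof eventually_elim
      case (elim \<omega>)
      have "(\<lambda>N. (norm (\<zeta> \<omega> - ?p N (\<zeta> \<omega>)))\<^sup>2) \<longlonglongrightarrow> (norm (\<zeta> \<omega> - R (\<zeta> \<omega>)))\<^sup>2"
        by (intro tendsto_intros R)
      then show ?case by (simp add: elim)
    qed
    show "AE \<omega> in P. norm ((norm (\<zeta> \<omega> - ?p N (\<zeta> \<omega>)))\<^sup>2) \<le> (norm (\<zeta> \<omega>))\<^sup>2" for N
    proof (rule AE_I2)
      fix \<omega>
      show "norm ((norm (\<zeta> \<omega> - ?p N (\<zeta> \<omega>)))\<^sup>2) \<le> (norm (\<zeta> \<omega>))\<^sup>2"
        using coord_proj_Pythagoras[OF on, of "J \<inter> {..<N}" "\<zeta> \<omega>"] by simp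
    qed
  qed (auto simp: sq coord_proj_def)
  then show ?thesis by simp
qed

text \<open>
  The trace of the covariance operator is bounded by the second moment, by Bessel's inequality.
\<close>

lemma spectral_decomposition_summable:
  fixes \<zeta> :: "'p \<Rightarrow> 'h::{real_inner, banach, second_countable_topology}"
  assumes [measurable]: "\<zeta> \<in> borel_measurable P" and sq: "integrable P (\<lambda>\<omega>. (norm (\<zeta> \<omega>))\<^sup>2)"
    and spec: "spectral_decomposition (cov_op P \<zeta>) J w \<phi>"
  shows "summable (\<lambda>j. if j \<in> J then w j else 0)"
proof (rule bounded_imp_summable)
  note on = spectral_decomposition_orthonormal[OF spec]
  show "0 \<le> (if j \<in> J then w j else 0)" for j
    using spec by (simp add: spectral_decomposition_def)
  fix n
  let ?F = "J \<inter> {..n}"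
  have wj: "(\<integral>\<omega>. (\<phi> j \<bullet> \<zeta> \<omega>)\<^sup>2 \<partial>P) = w j" if "j \<in> J" for j
    using spectral_decomposition_finite_sum[OF spec, of "{j}" "\<lambda>_. 1"] that
    by (simp add: cov_op_square(2) sq)
  have "(\<Sum>j\<le>n. if j \<in> J then w j else 0) = (\<Sum>j\<in>?F. w j)"
    by (simp add: sum.inter_restrict[symmetric] Int_commute)
  also have "\<dots> = (\<Sum>j\<in>?F. \<integral>\<omega>. (\<phi> j \<bullet> \<zeta> \<omega>)\<^sup>2 \<partial>P)"
    by (intro sum.cong refl) (simp add: wj)
  also have "\<dots> = (\<integral>\<omega>. (\<Sum>j\<in>?F. (\<phi> j \<bullet> \<zeta> \<omega>)\<^sup>2) \<partial>P)"
    by (rule Bochner_Integration.integral_sum[symmetric]) (simp add: cov_op_square(1) sq)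
  also have "\<dots> \<le> (\<integral>\<omega>. (norm (\<zeta> \<omega>))\<^sup>2 \<partial>P)"
  proof (rule integral_mono)
    show "(\<Sum>j\<in>?F. (\<phi> j \<bullet> \<zeta> \<omega>)\<^sup>2) \<le> (norm (\<zeta> \<omega>))\<^sup>2" for \<omega>
      using coord_proj_Pythagoras[OF on, of ?F "\<zeta> \<omega>"] norm_coord_proj[OF on, of ?F "\<zeta> \<omega>"] by simp
  qed (auto simp: sq cov_op_square(1))
  finally show "(\<Sum>j\<le>n. if j \<in> J then w j else 0) \<le> (\<integral>\<omega>. (norm (\<zeta> \<omega>))\<^sup>2 \<partial>P)" .
qed

section \<open>A central limit theorem for shifted squared norms\<close>

text \<open>
  Linearisation of a sum of squares: the characteristic function of a standard Gaussian vector at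
  \<open>sqrt (2 s) a\<close> is \<open>exp (- s \<parallel>a\<parallel>\<^sup>2)\<close>. Fubini's theorem then turns the Laplace transform into an average,
  over Gaussian directions, of characteristic functions of linear forms.
\<close>

lemma Laplace_eq_Gaussian_mixture:
  fixes Y :: "nat \<Rightarrow> 's \<Rightarrow> real" and Z :: "nat \<Rightarrow> 'q \<Rightarrow> real"
  assumes L: "prob_space L" and Y: "\<And>j. j \<in> F \<Longrightarrow> Y j \<in> borel_measurable L"
    and Q: "prob_space Q" and indep: "prob_space.indep_vars Q (\<lambda>_. borel) Z UNIV"
    and Z: "\<And>j. distributed Q lborel (Z j) std_normal_density"
  shows "complex_of_real (\<integral>\<omega>. exp (- real s * (\<Sum>j\<in>F. (Y j \<omega>)\<^sup>2)) \<partial>L)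
    = (CLINT q|Q. CLINT \<omega>|L. iexp (\<Sum>j\<in>F. sqrt (2 * real s) * Z j q * Y j \<omega>))"
proof -
  interpret L: prob_space L by fact
  interpret Q: prob_space Q by fact
  interpret LQ: pair_prob_space L Q ..
  note [measurable] = Y
  have [measurable]: "Z j \<in> borel_measurable Q" for j
    using distributed_measurable[OF Z[of j]] by simp
  let ?f = "\<lambda>(\<omega>, q). iexp (\<Sum>j\<in>F. sqrt (2 * real s) * Z j q * Y j \<omega>)"
  have "integrable (L \<Otimes>\<^sub>M Q) ?f"
    by (rule LQ.P.integrable_const_bound[where B=1]) auto
  then have "(CLINT q|Q. CLINT \<omega>|L. ?f (\<omega>, q)) = (CLINT \<omega>|L. CLINT q|Q. ?f (\<omega>, q))"
    by (intro LQ.Fubini_integral) simp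
  also have "\<dots> = (CLINT \<omega>|L. complex_of_real (exp (- real s * (\<Sum>j\<in>F. (Y j \<omega>)\<^sup>2))))"
  proof (intro Bochner_Integration.integral_cong refl)
    fix \<omega>
    have "(CLINT q|Q. ?f (\<omega>, q)) = (CLINT q|Q. iexp (\<Sum>j\<in>F. (sqrt (2 * real s) * Y j \<omega>) * Z j q))"
      by (simp add: mult_ac)
    also have "\<dots> = complex_of_real (exp (- (\<Sum>j\<in>F. (sqrt (2 * real s) * Y j \<omega>)\<^sup>2) / 2))"
      by (rule Q.char_std_normal_sum[OF indep Z])
    also have "(\<Sum>j\<in>F. (sqrt (2 * real s) * Y j \<omega>)\<^sup>2) = 2 * (real s * (\<Sum>j\<in>F. (Y j \<omega>)\<^sup>2))"
      by (simp add: power_mult_distrib sum_distrib_left mult_ac)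
    finally show "(CLINT q|Q. ?f (\<omega>, q)) = complex_of_real (exp (- real s * (\<Sum>j\<in>F. (Y j \<omega>)\<^sup>2)))"
      by simp
  qed
  finally show ?thesis by simp
qed

text \<open>
  For each value of the Gaussian weights the inner expectation is the characteristic function of one
  linear form of the normalised sum, which converges by the one-dimensional central limit theorem;
  dominated convergence handles the average over the weights. Applying the mixture formula to
  \<open>sqrt (w j) Z j + \<phi> j \<bullet> k\<close> in place of the sample shows that the limit is the stated one. The variables
  \<open>Z\<close> serve both as weights and as the limiting Gaussian family.
\<close>

lemma finite_dim_Laplace_tendsto:
  fixes \<zeta> :: "nat \<Rightarrow> nat \<Rightarrow> 's \<Rightarrow> 'h::{real_inner, banach, second_countable_topology}"
  assumes M: "\<And>n. prob_space (M n)" and P: "prob_space P"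
    and S: "\<And>n. iid_copies (M n) {..<n} (\<zeta> n) P \<zeta>0"
    and \<zeta>0: "\<zeta>0 \<in> borel_measurable P"
    and sq: "integrable P (\<lambda>\<omega>. (norm (\<zeta>0 \<omega>))\<^sup>2)" and mean: "(\<integral>\<omega>. \<zeta>0 \<omega> \<partial>P) = 0"
    and spec: "spectral_decomposition (cov_op P \<zeta>0) J w \<phi>"
    and Q: "prob_space Q" and indep: "prob_space.indep_vars Q (\<lambda>_. borel) Z UNIV"
    and Z: "\<And>j. distributed Q lborel (Z j) std_normal_density"
    and F: "finite F" "F \<subseteq> J"
  shows "(\<lambda>n. \<integral>\<omega>. exp (- real s * (\<Sum>j\<in>F. (\<phi> j \<bullet> ((1 / sqrt (real n)) *\<^sub>R (\<Sum>i<n. \<zeta> n i \<omega>) + k))\<^sup>2)) \<partial>M n)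
     \<longlonglongrightarrow> (\<integral>q. exp (- real s * (\<Sum>j\<in>F. (sqrt (w j) * Z j q + \<phi> j \<bullet> k)\<^sup>2)) \<partial>Q)"
proof -
  interpret Q: prob_space Q by fact
  have [measurable]: "Z j \<in> borel_measurable Q" for j
    using distributed_measurable[OF Z[of j]] by simp
  define c where "c = sqrt (2 * real s)"
  have c2: "c\<^sup>2 = 2 * real s" by (simp add: c_def)
  define W where "W n \<omega> = (1 / sqrt (real n)) *\<^sub>R (\<Sum>i<n. \<zeta> n i \<omega>)" for n \<omega>
  have W[measurable]: "W n \<in> borel_measurable (M n)" for n
  proof -
    have [measurable]: "\<zeta> n i \<in> borel_measurable (M n)" if "i < n" for i
      using iid_copies_measurable[OF M S] that by auto
    show ?thesis unfolding W_def[abs_def] by measurable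
  qed
  define h where "h q = (\<Sum>j\<in>F. (c * Z j q) *\<^sub>R \<phi> j)" for q
  let ?lim = "\<lambda>q. complex_of_real (exp (- (\<Sum>j\<in>F. w j * (c * Z j q)\<^sup>2) / 2)) * iexp (h q \<bullet> k)"
  have pre: "complex_of_real (\<integral>\<omega>. exp (- real s * (\<Sum>j\<in>F. (\<phi> j \<bullet> (W n \<omega> + k))\<^sup>2)) \<partial>M n)
      = (CLINT q|Q. (CLINT \<omega>|M n. iexp (h q \<bullet> W n \<omega>)) * iexp (h q \<bullet> k))" for n
  proof -
    have *: "iexp (\<Sum>j\<in>F. sqrt (2 * real s) * Z j q * (\<phi> j \<bullet> (W n \<omega> + k))) = iexp (h q \<bullet> W n \<omega>) * iexp (h q \<bullet> k)" for q \<omega>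
      by (simp add: h_def c_def inner_sum_left inner_add_right distrib_left sum.distrib exp_add)
    show ?thesis
      by (subst Laplace_eq_Gaussian_mixture[OF M _ Q indep Z]) (simp_all only: *, auto)
  qed
  have "(\<lambda>n. CLINT q|Q. (CLINT \<omega>|M n. iexp (h q \<bullet> W n \<omega>)) * iexp (h q \<bullet> k)) \<longlonglongrightarrow> (CLINT q|Q. ?lim q)"
  proof (rule integral_dominated_convergence[where w="\<lambda>_. 1"])
    have [measurable]: "h \<in> borel_measurable Q" unfolding h_def[abs_def] by measurable
    show "?lim \<in> borel_measurable Q" by measurable
    show "(\<lambda>q. (CLINT \<omega>|M n. iexp (h q \<bullet> W n \<omega>)) * iexp (h q \<bullet> k)) \<in> borel_measurable Q" for n
    proof -
      interpret Mn: prob_space "M n" by (rule M)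
      show ?thesis by measurable
    qed
    show "AE q in Q. (\<lambda>n. (CLINT \<omega>|M n. iexp (h q \<bullet> W n \<omega>)) * iexp (h q \<bullet> k)) \<longlonglongrightarrow> ?lim q"
    proof (rule AE_I2)
      fix q
      have v: "(\<integral>\<omega>. (h q \<bullet> \<zeta>0 \<omega>)\<^sup>2 \<partial>P) = (\<Sum>j\<in>F. w j * (c * Z j q)\<^sup>2)"
        by (simp add: cov_op_square(2)[OF \<zeta>0 sq] h_def spectral_decomposition_finite_sum[OF spec F])
      show "(\<lambda>n. (CLINT \<omega>|M n. iexp (h q \<bullet> W n \<omega>)) * iexp (h q \<bullet> k)) \<longlonglongrightarrow> ?lim q"
        using iid_char_tendsto[OF M P S \<zeta>0 sq mean, of "h q"]
        by (intro tendsto_intros) (simp add: W_def v)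
    qed
    show "AE q in Q. norm ((CLINT \<omega>|M n. iexp (h q \<bullet> W n \<omega>)) * iexp (h q \<bullet> k)) \<le> 1" for n
    proof (rule AE_I2)
      fix q
      interpret Mn: prob_space "M n" by (rule M)
      have "norm (CLINT \<omega>|M n. iexp (h q \<bullet> W n \<omega>)) \<le> (\<integral>\<omega>. norm (iexp (h q \<bullet> W n \<omega>)) \<partial>M n)"
        by (rule integral_norm_bound)
      then show "norm ((CLINT \<omega>|M n. iexp (h q \<bullet> W n \<omega>)) * iexp (h q \<bullet> k)) \<le> 1"
        by (simp add: norm_mult Mn.prob_space)
    qed
  qed simp
  also have "(CLINT q|Q. ?lim q) = complex_of_real (\<integral>q. exp (- real s * (\<Sum>j\<in>F. (sqrt (w j) * Z j q + \<phi> j \<bullet> k)\<^sup>2)) \<partial>Q)"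
  proof -
    have "complex_of_real (\<integral>q. exp (- real s * (\<Sum>j\<in>F. (sqrt (w j) * Z j q + \<phi> j \<bullet> k)\<^sup>2)) \<partial>Q)
       = (CLINT q|Q. CLINT q'|Q. iexp (\<Sum>j\<in>F. sqrt (2 * real s) * Z j q * (sqrt (w j) * Z j q' + \<phi> j \<bullet> k)))"
      by (rule Laplace_eq_Gaussian_mixture[OF Q _ Q indep Z]) simp
    also have "\<dots> = (CLINT q|Q. ?lim q)"
    proof (intro Bochner_Integration.integral_cong refl)
      fix q
      have *: "iexp (\<Sum>j\<in>F. sqrt (2 * real s) * Z j q * (sqrt (w j) * Z j q' + \<phi> j \<bullet> k))
          = iexp (\<Sum>j\<in>F. (c * Z j q * sqrt (w j)) * Z j q') * iexp (h q \<bullet> k)" for q'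
        by (simp add: h_def c_def inner_sum_left distrib_left sum.distrib exp_add mult_ac)
      have "(CLINT q'|Q. iexp (\<Sum>j\<in>F. sqrt (2 * real s) * Z j q * (sqrt (w j) * Z j q' + \<phi> j \<bullet> k)))
          = complex_of_real (exp (- (\<Sum>j\<in>F. (c * Z j q * sqrt (w j))\<^sup>2) / 2)) * iexp (h q \<bullet> k)"
        by (simp only: * integral_mult_left_zero Q.char_std_normal_sum[OF indep Z])
      also have "(\<Sum>j\<in>F. (c * Z j q * sqrt (w j))\<^sup>2) = (\<Sum>j\<in>F. w j * (c * Z j q)\<^sup>2)"
        using spec F by (intro sum.cong refl)
          (auto simp: power_mult_distrib spectral_decomposition_def subset_iff mult_ac)
      finally show "(CLINT q'|Q. iexp (\<Sum>j\<in>F. sqrt (2 * real s) * Z j q * (sqrt (w j) * Z j q' + \<phi> j \<bullet> k))) = ?lim q" .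
    qed
    finally show ?thesis ..
  qed
  finally have "(\<lambda>n. complex_of_real (\<integral>\<omega>. exp (- real s * (\<Sum>j\<in>F. (\<phi> j \<bullet> (W n \<omega> + k))\<^sup>2)) \<partial>M n))
      \<longlonglongrightarrow> complex_of_real (\<integral>q. exp (- real s * (\<Sum>j\<in>F. (sqrt (w j) * Z j q + \<phi> j \<bullet> k)\<^sup>2)) \<partial>Q)"
    unfolding pre .
  then show ?thesis unfolding W_def tendsto_of_real_iff .
qed

text \<open>
  Makes explicit the value \<open>0\<close> that an unordered sum takes where it does not converge. The limit
  variable is defined at every point by such sums, and its law depends on its measurability also on
  the null set where they diverge.
\<close>

lemma infsum_eq_suminf_indicator:
  fixes f :: "nat \<Rightarrow> real"
  shows "(\<Sum>\<^sub>\<infinity>j\<in>J. f j) = (if summable (\<lambda>j. \<bar>if j \<in> J then f j else 0\<bar>)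
      then (\<Sum>j. if j \<in> J then f j else 0) else 0)"
proof -
  let ?g = "\<lambda>j. if j \<in> J then f j else 0"
  have eq: "(f has_sum s) J \<longleftrightarrow> (?g has_sum s) UNIV" for s
    by (rule has_sum_cong_neutral) auto
  show ?thesis
  proof (cases "summable (\<lambda>j. \<bar>?g j\<bar>)")
    case True
    then have "(?g has_sum (\<Sum>j. ?g j)) UNIV"
      by (intro norm_summable_imp_has_sum) (auto intro: summable_sums summable_rabs_cancel)
    then show ?thesis using True eq infsumI by auto
  next
    case False
    have "\<not> f summable_on J"
    proof
      assume "f summable_on J"
      then have "?g summable_on UNIV" by (simp add: summable_on_def eq)
      then have "(\<lambda>j. norm (?g j)) summable_on UNIV" by (rule summable_on_iff_abs_summable_on_real[THEN iffD1])
      then have "summable (\<lambda>j. norm (?g j))" by (rule summable_on_imp_summable)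
      then show False using False by simp
    qed
    then have "infsum f J = 0" by (rule infsum_not_exists)
    then show ?thesis using False by simp
  qed
qed

lemma infsum_tendsto_partial_sums:
  fixes f :: "nat \<Rightarrow> real"
  assumes "summable (\<lambda>j. \<bar>if j \<in> J then f j else 0\<bar>)"
  shows "(\<lambda>N. \<Sum>j\<in>J \<inter> {..<N}. f j) \<longlonglongrightarrow> (\<Sum>\<^sub>\<infinity>j\<in>J. f j)"
proof -
  have "(\<lambda>N. \<Sum>j<N. if j \<in> J then f j else 0) \<longlonglongrightarrow> (\<Sum>\<^sub>\<infinity>j\<in>J. f j)"
    using summable_LIMSEQ[OF summable_rabs_cancel[OF assms]] assms by (simp add: infsum_eq_suminf_indicator)
  then show ?thesis by (simp add: sum.inter_restrict[symmetric] Int_commute)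
qed

text \<open>
  Summability of a nonnegative sequence is expressed by boundedness of the partial sums by a natural
  number, which involves only countably many measurable conditions.
\<close>

lemma infsum_nat_measurable:
  fixes f :: "nat \<Rightarrow> 'q \<Rightarrow> real"
  assumes [measurable]: "\<And>j. f j \<in> borel_measurable Q"
  shows "(\<lambda>q. \<Sum>\<^sub>\<infinity>j\<in>J. f j q) \<in> borel_measurable Q"
proof -
  have "summable a \<longleftrightarrow> (\<exists>B::nat. \<forall>n. (\<Sum>k\<le>n. a k) \<le> real B)" if a: "\<And>k. 0 \<le> a k" for a :: "nat \<Rightarrow> real"
  proof
    assume "summable a"
    then have "(\<Sum>k\<le>n. a k) \<le> suminf a" for n by (intro sum_le_suminf) (auto simp: a)
    moreover obtain B :: nat where "suminf a \<le> real B" using real_arch_simple by blast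
    ultimately show "\<exists>B::nat. \<forall>n. (\<Sum>k\<le>n. a k) \<le> real B" by (meson order_trans)
  qed (auto intro: bounded_imp_summable a)
  then have "(\<lambda>q. \<Sum>\<^sub>\<infinity>j\<in>J. f j q) = (\<lambda>q. if \<exists>B::nat. \<forall>n. (\<Sum>k\<le>n. \<bar>if k \<in> J then f k q else 0\<bar>) \<le> real B
      then (\<Sum>j. if j \<in> J then f j q else 0) else 0)"
    unfolding infsum_eq_suminf_indicator by simp
  also have "\<dots> \<in> borel_measurable Q" by measurable
  finally show ?thesis .
qed

lemma Gaussian_weighted_squares_summable:
  assumes Q: "prob_space Q" and Z: "\<And>j. distributed Q lborel (Z j) std_normal_density"
    and w0: "\<forall>j\<in>J. 0 \<le> w j" and w: "summable (\<lambda>j. if j \<in> J then w j else 0)"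
  shows "AE q in Q. summable (\<lambda>j. if j \<in> J then w j * (Z j q)\<^sup>2 else 0)"
proof -
  interpret Q: prob_space Q by fact
  have [measurable]: "Z j \<in> borel_measurable Q" for j
    using distributed_measurable[OF Z[of j]] by simp
  have d: "distr Q borel (Z j) = std_normal_distribution" for j
    using distributed_distr_eq_density[OF Z[of j]] by (simp cong: distr_cong)
  have i: "integrable Q (\<lambda>q. (Z j q)\<^sup>2)" for j
    using integrable_std_normal_distribution_moment[of 2] unfolding d[of j, symmetric]
    by (subst (asm) integrable_distr_eq) auto
  have m: "(\<integral>q. (Z j q)\<^sup>2 \<partial>Q) = 1" for j
  proof -
    have "(\<integral>q. (Z j q)\<^sup>2 \<partial>Q) = (\<integral>x. x\<^sup>2 \<partial>std_normal_distribution)"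
      unfolding d[of j, symmetric] by (subst integral_distr) auto
    then show ?thesis using std_normal_distribution_even_moments(1)[of 1] by simp
  qed
  have "(\<integral>\<^sup>+q. ennreal (if j \<in> J then w j * (Z j q)\<^sup>2 else 0) \<partial>Q) = ennreal (if j \<in> J then w j else 0)" for j
    using i[of j] m[of j] w0 by (auto simp: nn_integral_eq_integral)
  then have "(\<integral>\<^sup>+q. (\<Sum>j. ennreal (if j \<in> J then w j * (Z j q)\<^sup>2 else 0)) \<partial>Q)
      = (\<Sum>j. ennreal (if j \<in> J then w j else 0))"
    by (subst nn_integral_suminf) auto
  also have "\<dots> = ennreal (\<Sum>j. if j \<in> J then w j else 0)"
    using w w0 by (intro suminf_ennreal2) auto
  finally have "AE q in Q. (\<Sum>j. ennreal (if j \<in> J then w j * (Z j q)\<^sup>2 else 0)) \<noteq> \<infinity>"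
    by (intro nn_integral_noteq_infinite) auto
  then show ?thesis
    by eventually_elim (rule summable_suminf_not_top, use w0 in auto)
qed

text \<open>
  The random variable \<open>\<parallel>G + k\<parallel>\<^sup>2\<close> for \<open>G = \<Sum> sqrt (w j) Z\<^sub>j \<phi> j\<close>, multiplied out so that no vector
  valued Gaussian series has to be formed.
\<close>

definition Gaussian_quadratic ::
  "nat set \<Rightarrow> (nat \<Rightarrow> real) \<Rightarrow> (nat \<Rightarrow> 'h::real_inner) \<Rightarrow> 'h \<Rightarrow> (nat \<Rightarrow> 'q \<Rightarrow> real) \<Rightarrow> 'q \<Rightarrow> real" where
  "Gaussian_quadratic J w \<phi> k Z q = (\<Sum>\<^sub>\<infinity>j\<in>J. w j * (Z j q)\<^sup>2)
     + 2 * (\<Sum>\<^sub>\<infinity>j\<in>J. sqrt (w j) * Z j q * (\<phi> j \<bullet> k)) + (norm k)\<^sup>2"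

lemma Gaussian_quadratic_measurable:
  assumes [measurable]: "\<And>j. Z j \<in> borel_measurable Q"
  shows "Gaussian_quadratic J w \<phi> k Z \<in> borel_measurable Q"
proof -
  note [measurable] = infsum_nat_measurable[of "\<lambda>j q. w j * (Z j q)\<^sup>2" Q J]
    infsum_nat_measurable[of "\<lambda>j q. sqrt (w j) * Z j q * (\<phi> j \<bullet> k)" Q J]
  show ?thesis unfolding Gaussian_quadratic_def[abs_def] by measurable
qed

text \<open>
  After completing the squares, the first \<open>N\<close> coordinates of \<open>G + k\<close> together with the remainder of
  \<open>k\<close> alone give exactly the \<open>N\<close>-th partial sums of the two series plus \<open>\<parallel>k\<parallel>\<^sup>2\<close>. The mixed series
  converges absolutely because \<open>2 |a b| \<le> a\<^sup>2 + b\<^sup>2\<close>.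
\<close>

lemma Gaussian_quadratic_partial_sums:
  assumes Q: "prob_space Q" and Z: "\<And>j. distributed Q lborel (Z j) std_normal_density"
    and w0: "\<forall>j\<in>J. 0 \<le> w j" and w: "summable (\<lambda>j. if j \<in> J then w j else 0)"
    and on: "orthonormal_on J \<phi>"
  shows "AE q in Q. (\<lambda>N. (\<Sum>j\<in>J \<inter> {..<N}. (sqrt (w j) * Z j q + \<phi> j \<bullet> k)\<^sup>2)
      + (norm (k - coord_proj (J \<inter> {..<N}) \<phi> k))\<^sup>2) \<longlonglongrightarrow> Gaussian_quadratic J w \<phi> k Z q"
  using Gaussian_weighted_squares_summable[where Z=Z, OF Q Z w0 w]
proof eventually_elim
  case (elim q)
  let ?a = "\<lambda>j. w j * (Z j q)\<^sup>2" and ?b = "\<lambda>j. sqrt (w j) * Z j q * (\<phi> j \<bullet> k)"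
  have a: "summable (\<lambda>j. \<bar>if j \<in> J then ?a j else 0\<bar>)"
    using elim by (rule summable_cong[THEN iffD1, rotated]) (auto simp: w0 intro!: always_eventually)
  have b: "summable (\<lambda>j. \<bar>if j \<in> J then ?b j else 0\<bar>)"
  proof (rule summable_comparison_test')
    show "summable (\<lambda>j. (if j \<in> J then ?a j else 0) + (if j \<in> J then (\<phi> j \<bullet> k)\<^sup>2 else 0))"
      by (intro summable_add elim Bessel_summable[OF on])
    fix j :: nat
    show "norm \<bar>if j \<in> J then ?b j else 0\<bar> \<le> (if j \<in> J then ?a j else 0) + (if j \<in> J then (\<phi> j \<bullet> k)\<^sup>2 else 0)"
    proof (cases "j \<in> J")
      case True
      have "0 \<le> (\<bar>sqrt (w j) * Z j q\<bar> - \<bar>\<phi> j \<bullet> k\<bar>)\<^sup>2" by simp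
      then have "2 * (\<bar>sqrt (w j) * Z j q\<bar> * \<bar>\<phi> j \<bullet> k\<bar>) \<le> (sqrt (w j) * Z j q)\<^sup>2 + (\<phi> j \<bullet> k)\<^sup>2"
        unfolding power2_diff power2_abs by linarith
      moreover have "(sqrt (w j) * Z j q)\<^sup>2 = ?a j" using w0 True by (simp add: power_mult_distrib)
      moreover have "0 \<le> \<bar>sqrt (w j) * Z j q\<bar> * \<bar>\<phi> j \<bullet> k\<bar>" by simp
      ultimately have "\<bar>sqrt (w j) * Z j q\<bar> * \<bar>\<phi> j \<bullet> k\<bar> \<le> ?a j + (\<phi> j \<bullet> k)\<^sup>2" by linarith
      then show ?thesis using True by (simp add: abs_mult)
    qed simp
  qed
  have "(\<lambda>N. (\<Sum>j\<in>J \<inter> {..<N}. ?a j) + 2 * (\<Sum>j\<in>J \<inter> {..<N}. ?b j) + (norm k)\<^sup>2)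
      \<longlonglongrightarrow> Gaussian_quadratic J w \<phi> k Z q"
    unfolding Gaussian_quadratic_def by (intro tendsto_intros infsum_tendsto_partial_sums a b)
  moreover have "(\<Sum>j\<in>J \<inter> {..<N}. ?a j) + 2 * (\<Sum>j\<in>J \<inter> {..<N}. ?b j) + (norm k)\<^sup>2
      = (\<Sum>j\<in>J \<inter> {..<N}. (sqrt (w j) * Z j q + \<phi> j \<bullet> k)\<^sup>2)
      + (norm (k - coord_proj (J \<inter> {..<N}) \<phi> k))\<^sup>2" for N
  proof -
    have "(\<Sum>j\<in>J \<inter> {..<N}. (sqrt (w j) * Z j q + \<phi> j \<bullet> k)\<^sup>2)
       = (\<Sum>j\<in>J \<inter> {..<N}. ?a j + 2 * ?b j + (\<phi> j \<bullet> k)\<^sup>2)"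
      by (intro sum.cong refl) (auto simp: power2_sum power_mult_distrib w0)
    then show ?thesis
      using coord_proj_Pythagoras[OF on, of "J \<inter> {..<N}" k] norm_coord_proj[OF on, of "J \<inter> {..<N}" k]
      by (simp add: sum.distrib sum_distrib_left)
  qed
  ultimately show ?case by simp
qed

lemma Gaussian_quadratic_nonneg:
  assumes "prob_space Q" "\<And>j. distributed Q lborel (Z j) std_normal_density"
    "\<forall>j\<in>J. 0 \<le> w j" "summable (\<lambda>j. if j \<in> J then w j else 0)" "orthonormal_on J \<phi>"
  shows "AE q in Q. 0 \<le> Gaussian_quadratic J w \<phi> k Z q"
  using Gaussian_quadratic_partial_sums[where Z=Z and k=k, OF assms]
proof eventually_elim
  case (elim q)
  then show ?case by (rule LIMSEQ_le_const) (auto intro!: exI[of _ 0] add_nonneg_nonneg sum_nonneg)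
qed

text \<open>
  In \<open>\<parallel>W\<^sub>n + k\<parallel>\<^sup>2\<close> the coordinates beyond \<open>N\<close> contribute \<open>\<parallel>R W\<^sub>n + R k\<parallel>\<^sup>2\<close>, where \<open>R\<close> removes the first \<open>N\<close>
  coordinates. Replacing this by the constant \<open>\<parallel>R k\<parallel>\<^sup>2\<close> costs at most
  \<open>s (\<tau> + 2 \<parallel>k\<parallel> sqrt \<tau>)\<close>, where \<open>\<tau>\<close> is the second moment of \<open>R \<zeta>\<close>, uniformly in \<open>n\<close>; the remaining finite
  sum is covered by the finite-dimensional case. The vector \<open>k\<close> need not lie in the closed span of
  the eigenvectors, which is why \<open>R k\<close> is kept instead of being neglected.
\<close>

lemma Hilbert_CLT_Laplace:
  fixes \<zeta> :: "nat \<Rightarrow> nat \<Rightarrow> 's \<Rightarrow> 'h::{real_inner, banach, second_countable_topology}"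
  assumes M: "\<And>n. prob_space (M n)" and P: "prob_space P"
    and S: "\<And>n. iid_copies (M n) {..<n} (\<zeta> n) P \<zeta>0"
    and \<zeta>0: "\<zeta>0 \<in> borel_measurable P"
    and sq: "integrable P (\<lambda>\<omega>. (norm (\<zeta>0 \<omega>))\<^sup>2)" and mean: "(\<integral>\<omega>. \<zeta>0 \<omega> \<partial>P) = 0"
    and spec: "spectral_decomposition (cov_op P \<zeta>0) J w \<phi>"
    and Q: "prob_space Q" and indep: "prob_space.indep_vars Q (\<lambda>_. borel) Z UNIV"
    and Z: "\<And>j. distributed Q lborel (Z j) std_normal_density"
  shows "(\<lambda>n. \<integral>\<omega>. exp (- real s * (norm ((1 / sqrt (real n)) *\<^sub>R (\<Sum>i<n. \<zeta> n i \<omega>) + k))\<^sup>2) \<partial>M n)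
     \<longlonglongrightarrow> (\<integral>q. exp (- real s * Gaussian_quadratic J w \<phi> k Z q) \<partial>Q)"
proof -
  interpret P: prob_space P by fact
  interpret Q: prob_space Q by fact
  note [measurable] = \<zeta>0
  have Zm[measurable]: "Z j \<in> borel_measurable Q" for j
    using distributed_measurable[OF Z[of j]] by simp
  note on = spectral_decomposition_orthonormal[OF spec]
  have w0: "\<forall>j\<in>J. 0 \<le> w j" using spec by (simp add: spectral_decomposition_def)
  note w = spectral_decomposition_summable[OF \<zeta>0 sq spec]
  define W where "W n \<omega> = (1 / sqrt (real n)) *\<^sub>R (\<Sum>i<n. \<zeta> n i \<omega>)" for n \<omega>
  have W[measurable]: "W n \<in> borel_measurable (M n)" for n
  proof -
    have [measurable]: "\<zeta> n i \<in> borel_measurable (M n)" if "i < n" for i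
      using iid_copies_measurable[OF M S] that by auto
    show ?thesis unfolding W_def[abs_def] by measurable
  qed
  define F where "F N = J \<inter> {..<N}" for N
  have F: "finite (F N)" "F N \<subseteq> J" for N by (auto simp: F_def)
  define R where "R N x = x - coord_proj (F N) \<phi> x" for N x
  have R_lin: "linear (R N)" for N
    unfolding R_def[abs_def] by (intro linear_compose_sub linear_coord_proj linear_ident)
  have Pyth: "(norm x)\<^sup>2 = (\<Sum>j\<in>F N. (\<phi> j \<bullet> x)\<^sup>2) + (norm (R N x))\<^sup>2" for N x
    using coord_proj_Pythagoras[OF on F[of N], of x] norm_coord_proj[OF on F[of N], of x] by (simp add: R_def)
  have Rm[measurable]: "R N \<in> borel_measurable borel" for N
    unfolding R_def[abs_def] coord_proj_def by measurable
  define \<tau> where "\<tau> N = (\<integral>\<omega>. (norm (R N (\<zeta>0 \<omega>)))\<^sup>2 \<partial>P)" for N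
  have \<tau>: "\<tau> \<longlonglongrightarrow> 0"
    using coord_proj_tail_second_moment[OF \<zeta>0 sq spec] by (simp add: \<tau>_def[abs_def] R_def F_def)
  have \<tau>0: "0 \<le> \<tau> N" for N by (simp add: \<tau>_def)
  have R_le: "(norm (R N x))\<^sup>2 \<le> (norm x)\<^sup>2" for N x
    using Pyth[of x N] by (simp add: sum_nonneg)
  have RW: "integrable (M n) (\<lambda>\<omega>. (norm (R N (W n \<omega>)))\<^sup>2)"
    "(\<integral>\<omega>. (norm (R N (W n \<omega>)))\<^sup>2 \<partial>M n) \<le> \<tau> N" for n N
  proof -
    have SR: "iid_copies (M n) {..<n} (\<lambda>i \<omega>. R N (\<zeta> n i \<omega>)) P (\<lambda>\<omega>. R N (\<zeta>0 \<omega>))"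
      by (rule iid_copies_compose[OF M S \<zeta>0 Rm])
    have sqR: "integrable P (\<lambda>\<omega>. (norm (R N (\<zeta>0 \<omega>)))\<^sup>2)"
      by (rule Bochner_Integration.integrable_bound[OF sq]) (auto simp: R_le)
    have int: "integrable P \<zeta>0" by (rule integrable_of_norm_square[OF P \<zeta>0 sq])
    have meanR: "(\<integral>\<omega>. R N (\<zeta>0 \<omega>) \<partial>P) = 0"
    proof -
      have "(\<integral>\<omega>. R N (\<zeta>0 \<omega>) \<partial>P) = R N (\<integral>\<omega>. \<zeta>0 \<omega> \<partial>P)"
        unfolding R_def coord_proj_def using int by simp
      then show ?thesis by (simp add: mean linear_0[OF R_lin])
    qed
    have eq: "(norm (R N (W n \<omega>)))\<^sup>2 = 1 / real n * (norm (\<Sum>i<n. R N (\<zeta> n i \<omega>)))\<^sup>2" for \<omega>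
      by (simp add: W_def linear_scale[OF R_lin] linear_sum[OF R_lin] power_mult_distrib power_divide)
    note mom = iid_copies_second_moment_sum[OF M P SR _ sqR meanR finite_lessThan subset_refl]
    show "integrable (M n) (\<lambda>\<omega>. (norm (R N (W n \<omega>)))\<^sup>2)"
      unfolding eq by (intro integrable_mult_right mom(1)) simp
    have "(\<integral>\<omega>. (norm (R N (W n \<omega>)))\<^sup>2 \<partial>M n) = 1 / real n * (real n * \<tau> N)"
      unfolding eq integral_mult_right_zero by (subst mom(2)) (simp_all add: \<tau>_def)
    then show "(\<integral>\<omega>. (norm (R N (W n \<omega>)))\<^sup>2 \<partial>M n) \<le> \<tau> N"
      by (cases "n = 0") (simp_all add: \<tau>0)
  qed
  let ?A = "\<lambda>n. \<integral>\<omega>. exp (- real s * (norm (W n \<omega> + k))\<^sup>2) \<partial>M n"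
  let ?A' = "\<lambda>N n. \<integral>\<omega>. exp (- real s * ((\<Sum>j\<in>F N. (\<phi> j \<bullet> (W n \<omega> + k))\<^sup>2) + (norm (R N k))\<^sup>2)) \<partial>M n"
  let ?B = "\<lambda>N. \<integral>q. exp (- real s * ((\<Sum>j\<in>F N. (sqrt (w j) * Z j q + \<phi> j \<bullet> k)\<^sup>2) + (norm (R N k))\<^sup>2)) \<partial>Q"
  have "?A \<longlonglongrightarrow> (\<integral>q. exp (- real s * Gaussian_quadratic J w \<phi> k Z q) \<partial>Q)"
  proof (rule tendsto_of_uniform_approximation)
    fix N n
    interpret Mn: prob_space "M n" by (rule M)
    let ?f = "\<lambda>\<omega>. exp (- real s * (norm (W n \<omega> + k))\<^sup>2)"
    let ?g = "\<lambda>\<omega>. exp (- real s * ((\<Sum>j\<in>F N. (\<phi> j \<bullet> (W n \<omega> + k))\<^sup>2) + (norm (R N k))\<^sup>2))"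
    let ?r = "\<lambda>\<omega>. norm (R N (W n \<omega>))"
    have fi: "integrable (M n) ?f" and gi: "integrable (M n) ?g"
      by (rule Mn.integrable_const_bound[where B=1]; auto intro!: mult_nonneg_nonneg add_nonneg_nonneg sum_nonneg)+
    have ri: "integrable (M n) ?r"
      by (rule Mn.square_integrable_imp_integrable) (auto intro: RW(1))
    have "(Mn.expectation ?r)\<^sup>2 \<le> \<tau> N"
      using Mn.variance_positive[of ?r] Mn.variance_eq[OF ri RW(1)] RW(2)[of n N] by linarith
    then have r_le: "Mn.expectation ?r \<le> sqrt (\<tau> N)"
      by (rule real_le_rsqrt)
    have pt: "\<bar>?f \<omega> - ?g \<omega>\<bar> \<le> real s * ((?r \<omega>)\<^sup>2 + 2 * norm k * ?r \<omega>)" for \<omega>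
    proof -
      let ?a = "R N (W n \<omega>)" and ?b = "R N k"
      let ?d = "(norm (W n \<omega> + k))\<^sup>2 - ((\<Sum>j\<in>F N. (\<phi> j \<bullet> (W n \<omega> + k))\<^sup>2) + (norm ?b)\<^sup>2)"
      have "?d = (norm (?a + ?b))\<^sup>2 - (norm ?b)\<^sup>2"
        unfolding Pyth[of "W n \<omega> + k" N] by (simp add: linear_add[OF R_lin])
      also have "\<dots> = (norm ?a)\<^sup>2 + 2 * (?a \<bullet> ?b)"
        by (simp add: power2_norm_eq_inner inner_add_left inner_add_right inner_commute)
      finally have d: "?d = (norm ?a)\<^sup>2 + 2 * (?a \<bullet> ?b)" .
      have "norm ?a * norm ?b \<le> norm ?a * norm k"
        using R_le[of N k] by (intro mult_left_mono power2_le_imp_le[of "norm ?b"]) auto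
      moreover have "norm ?a * norm k = norm k * norm ?a" by (rule mult.commute)
      ultimately have "\<bar>?d\<bar> \<le> (norm ?a)\<^sup>2 + 2 * norm k * norm ?a"
        using Cauchy_Schwarz_ineq2[of ?a ?b] zero_le_power2[of "norm ?a"]
        unfolding d abs_le_iff by linarith
      then have "real s * \<bar>?d\<bar> \<le> real s * ((norm ?a)\<^sup>2 + 2 * norm k * norm ?a)"
        by (rule mult_left_mono) simp
      moreover have "\<bar>?f \<omega> - ?g \<omega>\<bar> \<le> real s * \<bar>?d\<bar>"
        by (rule exp_neg_Lipschitz) (auto intro!: add_nonneg_nonneg sum_nonneg)
      ultimately show ?thesis by linarith
    qed
    have "\<bar>?A n - ?A' N n\<bar> = \<bar>Mn.expectation (\<lambda>\<omega>. ?f \<omega> - ?g \<omega>)\<bar>"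
      using fi gi by simp
    also have "\<dots> \<le> Mn.expectation (\<lambda>\<omega>. \<bar>?f \<omega> - ?g \<omega>\<bar>)"
      by (rule integral_abs_bound)
    also have "\<dots> \<le> Mn.expectation (\<lambda>\<omega>. real s * ((?r \<omega>)\<^sup>2 + 2 * norm k * ?r \<omega>))"
      using fi gi ri RW(1) pt by (intro integral_mono) auto
    also have "\<dots> = real s * (Mn.expectation (\<lambda>\<omega>. (?r \<omega>)\<^sup>2) + 2 * norm k * Mn.expectation ?r)"
      using ri RW(1) by simp
    also have "\<dots> \<le> real s * (\<tau> N + 2 * norm k * sqrt (\<tau> N))"
      by (intro mult_left_mono add_mono RW(2) r_le) auto
    finally show "\<bar>?A n - ?A' N n\<bar> \<le> real s * (\<tau> N + 2 * norm k * sqrt (\<tau> N))" .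
  next
    have "(\<lambda>N. real s * (\<tau> N + 2 * norm k * sqrt (\<tau> N))) \<longlonglongrightarrow> real s * (0 + 2 * norm k * sqrt 0)"
      by (intro tendsto_intros \<tau>)
    then show "(\<lambda>N. real s * (\<tau> N + 2 * norm k * sqrt (\<tau> N))) \<longlonglongrightarrow> 0" by simp
  next
    fix N
    have "(\<lambda>n. (\<integral>\<omega>. exp (- real s * (\<Sum>j\<in>F N. (\<phi> j \<bullet> (W n \<omega> + k))\<^sup>2)) \<partial>M n) * exp (- real s * (norm (R N k))\<^sup>2))
      \<longlonglongrightarrow> (\<integral>q. exp (- real s * (\<Sum>j\<in>F N. (sqrt (w j) * Z j q + \<phi> j \<bullet> k)\<^sup>2)) \<partial>Q) * exp (- real s * (norm (R N k))\<^sup>2)"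
      unfolding W_def by (intro tendsto_mult_right finite_dim_Laplace_tendsto[OF M P S \<zeta>0 sq mean spec Q indep Z F])
    then show "?A' N \<longlonglongrightarrow> ?B N"
      by (simp only: distrib_left exp_add integral_mult_left_zero)
  next
    show "?B \<longlonglongrightarrow> (\<integral>q. exp (- real s * Gaussian_quadratic J w \<phi> k Z q) \<partial>Q)"
    proof (rule integral_dominated_convergence[where w="\<lambda>_. 1"])
      show "(\<lambda>q. exp (- real s * Gaussian_quadratic J w \<phi> k Z q)) \<in> borel_measurable Q"
        using Gaussian_quadratic_measurable[OF Zm, where J=J and w=w and \<phi>=\<phi> and k=k] by measurable
      show "AE q in Q. (\<lambda>N. exp (- real s * ((\<Sum>j\<in>F N. (sqrt (w j) * Z j q + \<phi> j \<bullet> k)\<^sup>2) + (norm (R N k))\<^sup>2)))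
          \<longlonglongrightarrow> exp (- real s * Gaussian_quadratic J w \<phi> k Z q)"
        using Gaussian_quadratic_partial_sums[where Z=Z and k=k, OF Q Z w0 w on]
      proof eventually_elim
        case (elim q)
        then show ?case unfolding F_def R_def by (intro tendsto_intros)
      qed
    qed (auto intro!: AE_I2 mult_nonneg_nonneg add_nonneg_nonneg sum_nonneg)
  qed
  then show ?thesis by (simp add: W_def)
qed

section \<open>The partial least squares fit as an orthogonal projection\<close>

text \<open>
  Gram-Schmidt orthogonalisation as a recursion in the vectors. It uses only inner products, sums and
  division, so its measurability in all arguments is immediate. If \<open>v m\<close> depends on its predecessors,
  then \<open>u = 0\<close> and the convention \<open>a / 0 = 0\<close> yields the correct projection.
\<close>

fun span_proj :: "(nat \<Rightarrow> 'h::real_inner) \<Rightarrow> nat \<Rightarrow> 'h \<Rightarrow> 'h" where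
  "span_proj v 0 x = 0"
| "span_proj v (Suc m) x = span_proj v m x +
     (let u = v m - span_proj v m (v m) in ((x \<bullet> u) / (u \<bullet> u)) *\<^sub>R u)"

lemma span_proj_in_span: "span_proj v m x \<in> span (v ` {..<m})"
proof (induction m arbitrary: x)
  case (Suc m)
  have "span (v ` {..<m}) \<subseteq> span (v ` {..<Suc m})"
    by (intro span_mono) auto
  moreover have "v m \<in> span (v ` {..<Suc m})"
    by (intro span_base) auto
  ultimately have "span_proj v m x \<in> span (v ` {..<Suc m})" for x
    using Suc.IH by blast
  with \<open>v m \<in> _\<close> show ?case
    unfolding span_proj.simps Let_def by (intro span_add span_scale span_diff)
qed (simp add: span_zero)

lemma span_proj_orthogonal: "i < m \<Longrightarrow> (x - span_proj v m x) \<bullet> v i = 0"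
proof (induction m arbitrary: i x)
  case (Suc m)
  define u where "u = v m - span_proj v m (v m)"
  have orth: "(x - span_proj v m x) \<bullet> y = 0" if "y \<in> span (v ` {..<m})" for x y
    using that
    by (induction rule: span_induct_alt) (auto simp: inner_add_right Suc.IH)
  have u_orth: "u \<bullet> y = 0" if "y \<in> span (v ` {..<m})" for y
    unfolding u_def by (rule orth[OF that])
  have step: "x - span_proj v (Suc m) x = (x - span_proj v m x) - ((x \<bullet> u) / (u \<bullet> u)) *\<^sub>R u"
    by (simp add: u_def Let_def)
  show ?case
  proof (cases "i < m")
    case True
    then have "v i \<in> span (v ` {..<m})" by (intro span_base) auto
    then show ?thesis
      using orth[of "v i" x] u_orth[of "v i"] unfolding step by (simp add: inner_diff_left)
  next
    case False
    then have i: "i = m" using Suc.prems by simp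
    define w where "w = span_proj v m (v m)"
    have w: "w \<in> span (v ` {..<m})" unfolding w_def by (rule span_proj_in_span)
    have vm: "z \<bullet> v m = z \<bullet> u + z \<bullet> w" for z
      by (simp add: u_def w_def inner_diff_right)
    have a: "u \<bullet> v m = u \<bullet> u"
      by (simp add: vm u_orth[OF w])
    have "(x - span_proj v m x) \<bullet> v m = (x - span_proj v m x) \<bullet> u"
      by (simp only: vm orth[OF w] add_0_right)
    also have "\<dots> = x \<bullet> u"
      using u_orth[OF span_proj_in_span[of v m x]] inner_commute[of u "span_proj v m x"]
      unfolding inner_diff_left by linarith
    finally show ?thesis
      unfolding step i by (simp add: inner_diff_left a)
  qed
qed simp

lemma span_proj_orthogonal_span:
  assumes "y \<in> span (v ` {..<m})"
  shows "(x - span_proj v m x) \<bullet> y = 0"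
  using assms
proof (induction rule: span_induct_alt)
  case (step c z y)
  then obtain i where "i < m" "z = v i" by auto
  then show ?case using step span_proj_orthogonal[of i m x v] by (simp add: inner_add_right)
qed simp

lemma span_proj_measurable:
  fixes v :: "nat \<Rightarrow> 's \<Rightarrow> 'h::{real_inner, second_countable_topology}"
  assumes "\<And>i. i < m \<Longrightarrow> v i \<in> borel_measurable M" and "f \<in> borel_measurable M"
  shows "(\<lambda>\<omega>. span_proj (\<lambda>i. v i \<omega>) m (f \<omega>)) \<in> borel_measurable M"
  using assms
proof (induction m arbitrary: f)
  case (Suc m)
  note [measurable] = Suc.prems(2) Suc.prems(1)[OF lessI]
  have [measurable]: "(\<lambda>\<omega>. span_proj (\<lambda>i. v i \<omega>) m (f \<omega>)) \<in> borel_measurable M"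
    "(\<lambda>\<omega>. span_proj (\<lambda>i. v i \<omega>) m (v m \<omega>)) \<in> borel_measurable M"
    using Suc by auto
  show ?case by (simp add: Let_def)
qed simp

lemma norm_diff_orthogonal_residual:
  fixes x p q :: "'h::real_inner"
  assumes "subspace S" "p \<in> S" "q \<in> S" and orth: "\<And>y. y \<in> S \<Longrightarrow> (x - p) \<bullet> y = 0"
  shows "(norm (x - q))\<^sup>2 = (norm (x - p))\<^sup>2 + (norm (p - q))\<^sup>2"
proof -
  have "(x - p) \<bullet> (p - q) = 0"
    using assms by (intro orth subspace_diff)
  then show ?thesis
    using norm_add_Pythagorean[of "x - p" "p - q"] by (simp add: orthogonal_def)
qed

lemma linear_rank_one: "linear (rank_one x)"
  by (rule linearI) (auto simp: rank_one_def inner_add_right scaleR_add_left)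

lemma linear_K_hat: "linear (K_hat n x)"
proof -
  have "linear (\<lambda>h. \<Sum>i<n. rank_one (x i) h)"
    by (intro linear_compose_sum ballI linear_rank_one)
  then show ?thesis
    unfolding K_hat_def[abs_def] by (rule linear_compose_scale_right)
qed

lemma K_hat_image_krylov:
  "K_hat n x ` krylov (K_hat n x) r m = span ((\<lambda>j. (K_hat n x ^^ Suc j) r) ` {..<m})"
  unfolding krylov_def
  by (subst linear_span_image[OF linear_K_hat, symmetric]) (simp add: image_image)

text \<open>
  The least squares problem over the Krylov space is the projection problem onto its image under
  \<open>K_hat\<close>. The projection provides a minimiser, and any minimiser has the same image by
  Pythagoras' theorem; the choice made by \<open>arg_min\<close> is therefore irrelevant and the fit is
  measurable.
\<close>

lemma K_hat_pls:
  "K_hat n x (pls n x y m)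
     = span_proj (\<lambda>j. (K_hat n x ^^ Suc j) (r_hat n x y)) m (r_hat n x y)"
proof -
  let ?r = "r_hat n x y" and ?K = "K_hat n x"
  let ?S = "?K ` krylov ?K ?r m"
  define p where "p = span_proj (\<lambda>j. (?K ^^ Suc j) ?r) m ?r"
  have sub: "subspace ?S" unfolding K_hat_image_krylov by (rule subspace_span)
  have pS: "p \<in> ?S" unfolding K_hat_image_krylov p_def by (rule span_proj_in_span)
  have orth: "(?r - p) \<bullet> s = 0" if "s \<in> ?S" for s
    using that unfolding K_hat_image_krylov p_def by (rule span_proj_orthogonal_span)
  have dist: "(norm (?r - s))\<^sup>2 = (norm (?r - p))\<^sup>2 + (norm (p - s))\<^sup>2" if "s \<in> ?S" for s
    using norm_diff_orthogonal_residual[OF sub pS that] orth by blast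
  obtain h0 where h0: "h0 \<in> krylov ?K ?r m" "p = ?K h0" using pS by blast
  let ?f = "\<lambda>h. (norm (?r - ?K h))\<^sup>2" and ?P = "\<lambda>h. h \<in> krylov ?K ?r m"
  have "is_arg_min ?f ?P h0"
    unfolding is_arg_min_linorder
  proof (intro conjI allI impI)
    fix h assume "h \<in> krylov ?K ?r m"
    then have "?K h \<in> ?S" by blast
    from dist[OF this] show "?f h0 \<le> ?f h" unfolding h0(2)[symmetric] by simp
  qed (rule h0)
  then have min: "is_arg_min ?f ?P (pls n x y m)"
    unfolding pls_def arg_min_def by (rule someI)
  then have "?f (pls n x y m) \<le> ?f h0" and S: "?K (pls n x y m) \<in> ?S"
    using h0 by (auto simp: is_arg_min_linorder)
  then have "(norm (p - ?K (pls n x y m)))\<^sup>2 \<le> 0"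
    using dist[OF S] h0 by simp
  then show ?thesis by (simp add: p_def)
qed

text \<open>
  Any explicit polynomial in \<open>K_hat\<close> applied to \<open>r_hat\<close> is a competitor; this is the only way in which
  the minimality of the estimator enters the proof of consistency.
\<close>

lemma pls_residual_le:
  assumes "s \<in> span ((\<lambda>j. (K_hat n x ^^ Suc j) (r_hat n x y)) ` {..<m})"
  shows "pls_residual n x y m \<le> norm (r_hat n x y - s)"
proof -
  let ?v = "\<lambda>j. (K_hat n x ^^ Suc j) (r_hat n x y)"
  have "(norm (r_hat n x y - s))\<^sup>2 = (norm (r_hat n x y - span_proj ?v m (r_hat n x y)))\<^sup>2
      + (norm (span_proj ?v m (r_hat n x y) - s))\<^sup>2"
  proof (rule norm_diff_orthogonal_residual[OF subspace_span span_proj_in_span assms])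
    fix z assume "z \<in> span (?v ` {..<m})"
    then show "(r_hat n x y - span_proj ?v m (r_hat n x y)) \<bullet> z = 0"
      by (rule span_proj_orthogonal_span)
  qed
  then have "(pls_residual n x y m)\<^sup>2 \<le> (norm (r_hat n x y - s))\<^sup>2"
    unfolding pls_residual_def K_hat_pls
    using zero_le_power2[of "norm (span_proj ?v m (r_hat n x y) - s)"] by linarith
  then show ?thesis by (rule power2_le_imp_le) simp
qed

lemma K_hat_measurable:
  fixes x :: "nat \<Rightarrow> 's \<Rightarrow> 'h::{real_inner, second_countable_topology}"
  assumes [measurable]: "\<And>i. i < n \<Longrightarrow> x i \<in> borel_measurable M" "f \<in> borel_measurable M"
  shows "(\<lambda>\<omega>. K_hat n (\<lambda>i. x i \<omega>) (f \<omega>)) \<in> borel_measurable M"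
  unfolding K_hat_def rank_one_def by measurable

lemma r_hat_measurable:
  fixes x :: "nat \<Rightarrow> 's \<Rightarrow> 'h::{real_inner, second_countable_topology}"
  assumes [measurable]: "\<And>i. i < n \<Longrightarrow> x i \<in> borel_measurable M" "\<And>i. i < n \<Longrightarrow> y i \<in> borel_measurable M"
  shows "(\<lambda>\<omega>. r_hat n (\<lambda>i. x i \<omega>) (\<lambda>i. y i \<omega>)) \<in> borel_measurable M"
  unfolding r_hat_def by measurable

lemma K_hat_pls_measurable:
  fixes x :: "nat \<Rightarrow> 's \<Rightarrow> 'h::{real_inner, second_countable_topology}"
  assumes x: "\<And>i. i < n \<Longrightarrow> x i \<in> borel_measurable M" and y: "\<And>i. i < n \<Longrightarrow> y i \<in> borel_measurable M"
  shows "(\<lambda>\<omega>. K_hat n (\<lambda>i. x i \<omega>) (pls n (\<lambda>i. x i \<omega>) (\<lambda>i. y i \<omega>) m)) \<in> borel_measurable M"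
proof -
  have "(\<lambda>\<omega>. (K_hat n (\<lambda>i. x i \<omega>) ^^ j) (r_hat n (\<lambda>i. x i \<omega>) (\<lambda>i. y i \<omega>))) \<in> borel_measurable M" for j
  proof (induction j)
    case 0
    show ?case using r_hat_measurable[of n x M y, OF x y] by simp
  next
    case (Suc j)
    show ?case using K_hat_measurable[of n x M, OF x Suc] by simp
  qed
  then show ?thesis
    unfolding K_hat_pls by (intro span_proj_measurable r_hat_measurable) (use x y in \<open>simp_all del: funpow.simps\<close>)
qed

lemma pls_residual_measurable:
  fixes x :: "nat \<Rightarrow> 's \<Rightarrow> 'h::{real_inner, second_countable_topology}"
  assumes x: "\<And>i. i < n \<Longrightarrow> x i \<in> borel_measurable M" and y: "\<And>i. i < n \<Longrightarrow> y i \<in> borel_measurable M"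
  shows "(\<lambda>\<omega>. pls_residual n (\<lambda>i. x i \<omega>) (\<lambda>i. y i \<omega>) m) \<in> borel_measurable M"
proof -
  note [measurable] = r_hat_measurable[of n x M y, OF x y] K_hat_pls_measurable[of n x M y, OF x y]
  show ?thesis unfolding pls_residual_def by measurable
qed

lemma test_stat_eq:
  "test_stat n x y m b = real n * (norm (K_hat n x (pls n x y m) - K_hat n x b))\<^sup>2"
  by (simp add: test_stat_def linear_diff[OF linear_K_hat])

section \<open>Convergence in distribution of the test statistic\<close>

lemma rank_one_second_moment:
  fixes X :: "'p \<Rightarrow> 'h::{real_inner, banach, second_countable_topology}"
  assumes [measurable]: "X \<in> borel_measurable P" and X4: "integrable P (\<lambda>\<omega>. norm (X \<omega>) ^ 4)"
  shows "integrable P (\<lambda>\<omega>. (norm (rank_one (X \<omega>) h))\<^sup>2)"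
proof (rule Bochner_Integration.integrable_bound)
  show "integrable P (\<lambda>\<omega>. (norm h)\<^sup>2 * norm (X \<omega>) ^ 4)" using X4 by simp
  show "AE \<omega> in P. norm ((norm (rank_one (X \<omega>) h))\<^sup>2) \<le> norm ((norm h)\<^sup>2 * norm (X \<omega>) ^ 4)"
  proof (rule AE_I2)
    fix \<omega>
    have "(norm (rank_one (X \<omega>) h))\<^sup>2 \<le> ((norm (X \<omega>))\<^sup>2 * norm h)\<^sup>2"
      by (intro power_mono norm_rank_one_le) simp
    then show "norm ((norm (rank_one (X \<omega>) h))\<^sup>2) \<le> norm ((norm h)\<^sup>2 * norm (X \<omega>) ^ 4)"
      by (simp add: power_mult_distrib power2_eq_square power4_eq_xxxx mult_ac)
  qed
qed (simp add: rank_one_def)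

text \<open>
  Conditioning on \<open>X\<close>, the second moment of \<open>\<epsilon> X\<close> is at most \<open>\<sigma>\<^sup>2\<close> times that of \<open>X\<close>.
\<close>

lemma error_second_moment:
  fixes X :: "'p \<Rightarrow> 'h::{real_inner, banach, second_countable_topology}"
  assumes P: "prob_space P"
    and X[measurable]: "X \<in> borel_measurable P" and [measurable]: "\<epsilon> \<in> borel_measurable P"
    and X4: "integrable P (\<lambda>\<omega>. norm (X \<omega>) ^ 4)"
    and cond: "AE \<omega> in P. nn_cond_exp P (vimage_algebra (space P) X borel)
           (\<lambda>\<omega>. ennreal ((\<epsilon> \<omega>)\<^sup>2)) \<omega> \<le> ennreal (\<sigma>\<^sup>2)"
  shows "integrable P (\<lambda>\<omega>. (norm (\<epsilon> \<omega> *\<^sub>R X \<omega>))\<^sup>2)"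
proof (rule integrableI_bounded)
  interpret prob_space P by fact
  let ?F = "vimage_algebra (space P) X borel"
  have "subalgebra P ?F"
    using X by (auto simp: subalgebra_def sets_vimage_algebra2 measurable_def)
  then interpret finite_measure_subalgebra P ?F by unfold_locales
  have [measurable]: "X \<in> borel_measurable ?F" by (rule measurable_vimage_algebra1) auto
  have X2: "integrable P (\<lambda>\<omega>. (norm (X \<omega>))\<^sup>2)"
    by (rule square_integrable_imp_integrable) (use X4 in \<open>auto simp: power_mult[symmetric]\<close>)
  have "(\<integral>\<^sup>+\<omega>. ennreal (norm ((norm (\<epsilon> \<omega> *\<^sub>R X \<omega>))\<^sup>2)) \<partial>P)
      = (\<integral>\<^sup>+\<omega>. ennreal ((norm (X \<omega>))\<^sup>2) * ennreal ((\<epsilon> \<omega>)\<^sup>2) \<partial>P)"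
    by (simp add: power_mult_distrib ennreal_mult mult.commute)
  also have "\<dots> = (\<integral>\<^sup>+\<omega>. ennreal ((norm (X \<omega>))\<^sup>2) * nn_cond_exp P ?F (\<lambda>\<omega>. ennreal ((\<epsilon> \<omega>)\<^sup>2)) \<omega> \<partial>P)"
    by (rule nn_cond_exp_intg[symmetric]) auto
  also have "\<dots> \<le> (\<integral>\<^sup>+\<omega>. ennreal ((norm (X \<omega>))\<^sup>2) * ennreal (\<sigma>\<^sup>2) \<partial>P)"
  proof (rule nn_integral_mono_AE)
    show "AE \<omega> in P. ennreal ((norm (X \<omega>))\<^sup>2) * nn_cond_exp P ?F (\<lambda>\<omega>. ennreal ((\<epsilon> \<omega>)\<^sup>2)) \<omega>
        \<le> ennreal ((norm (X \<omega>))\<^sup>2) * ennreal (\<sigma>\<^sup>2)"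
      using cond by eventually_elim (rule mult_left_mono, auto)
  qed
  also have "\<dots> = (\<integral>\<^sup>+\<omega>. ennreal ((norm (X \<omega>))\<^sup>2 * \<sigma>\<^sup>2) \<partial>P)"
    by (simp add: ennreal_mult)
  also have "\<dots> < \<infinity>"
    using X2 by (subst nn_integral_eq_integral) auto
  finally show "(\<integral>\<^sup>+\<omega>. ennreal (norm ((norm (\<epsilon> \<omega> *\<^sub>R X \<omega>))\<^sup>2)) \<partial>P) < \<infinity>" .
qed simp

lemma var_op_eq_cov_op: "var_op P X \<epsilon> = cov_op P (\<lambda>\<omega>. \<epsilon> \<omega> *\<^sub>R X \<omega>)"
  by (rule ext) (simp add: var_op_def cov_op_def rank_one_def power2_eq_square mult_ac)

text \<open>
  Write \<open>sqrt n (K_hat pls - K_hat b)\<close> as \<open>U n + e1 n - e2 n\<close>. Here \<open>U n\<close> is the normalised sum of the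
  \<open>\<epsilon>\<^sub>i X\<^sub>i\<close> shifted by \<open>k = K \<Delta>\<close>; \<open>e1 n\<close> is the error of \<open>K_hat \<Delta>\<close>, negligible by the weak law of large
  numbers; \<open>e2 n\<close> is the rescaled residual vector, negligible by hypothesis.
\<close>

lemma test_stat_weak_conv:
  fixes P :: "'p measure"
    and X :: "'p \<Rightarrow> 'h::{real_inner, banach, second_countable_topology}"
    and M :: "nat \<Rightarrow> 's measure"
  assumes P: "prob_space P"
    and X: "X \<in> borel_measurable P" and \<epsilon>: "\<epsilon> \<in> borel_measurable P"
    and mean: "(\<integral>\<omega>. \<epsilon> \<omega> *\<^sub>R X \<omega> \<partial>P) = 0"
    and X4: "integrable P (\<lambda>\<omega>. norm (X \<omega>) ^ 4)"
    and sq: "integrable P (\<lambda>\<omega>. (norm (\<epsilon> \<omega> *\<^sub>R X \<omega>))\<^sup>2)"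
    and spec: "spectral_decomposition (var_op P X \<epsilon>) J w \<phi>"
    and Q: "prob_space Q" and indep: "prob_space.indep_vars Q (\<lambda>_. borel) Z UNIV"
    and Z: "\<And>j. distributed Q lborel (Z j) std_normal_density"
    and M: "\<And>n. prob_space (M n)"
    and S: "\<And>n. iid_copies (M n) {..<n} (\<lambda>i \<omega>. (Xs n i \<omega>, Es n i \<omega>)) P (\<lambda>\<omega>. (X \<omega>, \<epsilon> \<omega>))"
    and Ys: "\<And>n i \<omega>. i < n \<Longrightarrow> Ys n i \<omega> = (b + (1 / sqrt (real n)) *\<^sub>R \<Delta>) \<bullet> Xs n i \<omega> + Es n i \<omega>"
    and res: "small_oP M (\<lambda>n \<omega>. pls_residual n (\<lambda>i. Xs n i \<omega>) (\<lambda>i. Ys n i \<omega>) (m n))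
          (\<lambda>n. 1 / sqrt (real n))"
  shows "weak_conv_m
      (\<lambda>n. distr (M n) borel (\<lambda>\<omega>. test_stat n (\<lambda>i. Xs n i \<omega>) (\<lambda>i. Ys n i \<omega>) (m n) b))
      (distr Q borel (Gaussian_quadratic J w \<phi> (cov_op P X \<Delta>) Z))"
proof -
  note [measurable] = X \<epsilon>
  have Zm[measurable]: "Z j \<in> borel_measurable Q" for j
    using distributed_measurable[OF Z[of j]] by simp
  have XE: "(\<lambda>\<omega>. (X \<omega>, \<epsilon> \<omega>)) \<in> borel_measurable P"
    by (rule borel_measurable_Pair) measurable
  have scale_borel: "(\<lambda>z::'h \<times> real. snd z *\<^sub>R fst z) \<in> borel_measurable borel"
    by (intro borel_measurable_continuous_onI continuous_intros)
  have fst_borel: "(\<lambda>z::'h \<times> real. fst z) \<in> borel_measurable borel"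
    and snd_borel: "(\<lambda>z::'h \<times> real. snd z) \<in> borel_measurable borel"
    by (intro borel_measurable_continuous_onI continuous_intros)+
  have rank_borel: "(\<lambda>z::'h \<times> real. rank_one (fst z) \<Delta>) \<in> borel_measurable borel"
    unfolding rank_one_def by (intro borel_measurable_continuous_onI continuous_intros)
  have Xsm: "Xs n i \<in> borel_measurable (M n)" and Esm: "Es n i \<in> borel_measurable (M n)" if "i < n" for n i
    using measurable_compose[OF iid_copies_measurable[OF M S[of n], of i] fst_borel]
      measurable_compose[OF iid_copies_measurable[OF M S[of n], of i] snd_borel] that by auto
  have Ysm: "Ys n i \<in> borel_measurable (M n)" if "i < n" for n i
  proof -
    note [measurable] = Xsm[OF that] Esm[OF that]
    have "Ys n i = (\<lambda>\<omega>. (b + (1 / sqrt (real n)) *\<^sub>R \<Delta>) \<bullet> Xs n i \<omega> + Es n i \<omega>)"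
      using Ys[OF that] by auto
    also have "\<dots> \<in> borel_measurable (M n)" by measurable
    finally show ?thesis .
  qed
  have S\<zeta>: "iid_copies (M n) {..<n} (\<lambda>i \<omega>. Es n i \<omega> *\<^sub>R Xs n i \<omega>) P (\<lambda>\<omega>. \<epsilon> \<omega> *\<^sub>R X \<omega>)" for n
    using iid_copies_compose[OF M S XE scale_borel] by simp
  have SK: "iid_copies (M n) {..<n} (\<lambda>i \<omega>. rank_one (Xs n i \<omega>) \<Delta>) P (\<lambda>\<omega>. rank_one (X \<omega>) \<Delta>)" for n
    using iid_copies_compose[OF M S XE rank_borel] by simp
  have \<zeta>m: "(\<lambda>\<omega>. \<epsilon> \<omega> *\<^sub>R X \<omega>) \<in> borel_measurable P" by measurable
  have rm: "(\<lambda>\<omega>. rank_one (X \<omega>) \<Delta>) \<in> borel_measurable P" unfolding rank_one_def by measurable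
  note spec' = spec[unfolded var_op_eq_cov_op]
  note on = spectral_decomposition_orthonormal[OF spec']
  have w0: "\<forall>j\<in>J. 0 \<le> w j" using spec by (simp add: spectral_decomposition_def)
  note w = spectral_decomposition_summable[OF \<zeta>m sq spec']
  define k where "k = cov_op P X \<Delta>"
  let ?K = "\<lambda>n \<omega>. K_hat n (\<lambda>i. Xs n i \<omega>)" and ?r = "\<lambda>n \<omega>. r_hat n (\<lambda>i. Xs n i \<omega>) (\<lambda>i. Ys n i \<omega>)"
  let ?\<beta> = "\<lambda>n \<omega>. pls n (\<lambda>i. Xs n i \<omega>) (\<lambda>i. Ys n i \<omega>) (m n)"
  let ?T = "\<lambda>n \<omega>. test_stat n (\<lambda>i. Xs n i \<omega>) (\<lambda>i. Ys n i \<omega>) (m n) b"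
  define U where "U n \<omega> = (1 / sqrt (real n)) *\<^sub>R (\<Sum>i<n. Es n i \<omega> *\<^sub>R Xs n i \<omega>) + k" for n \<omega>
  define e1 where "e1 n \<omega> = ?K n \<omega> \<Delta> - k" for n \<omega>
  define e2 where "e2 n \<omega> = sqrt (real n) *\<^sub>R (?r n \<omega> - ?K n \<omega> (?\<beta> n \<omega>))" for n \<omega>
  have T_eq: "?T n \<omega> = (norm (U n \<omega> + (e1 n \<omega> - e2 n \<omega>)))\<^sup>2" for n \<omega>
  proof (cases "n = 0")
    case True
    then show ?thesis by (simp add: test_stat_def U_def e1_def e2_def K_hat_def)
  next
    case False
    have "(\<Sum>i<n. Ys n i \<omega> *\<^sub>R Xs n i \<omega>)
        = (\<Sum>i<n. rank_one (Xs n i \<omega>) b + (1 / sqrt (real n)) *\<^sub>R rank_one (Xs n i \<omega>) \<Delta> + Es n i \<omega> *\<^sub>R Xs n i \<omega>)"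
      by (intro sum.cong refl) (simp add: Ys rank_one_def inner_add_left inner_add_right inner_commute scaleR_add_left)
    then have "?r n \<omega> - ?K n \<omega> b = (1 / real n) *\<^sub>R ((1 / sqrt (real n)) *\<^sub>R (\<Sum>i<n. rank_one (Xs n i \<omega>) \<Delta>)
        + (\<Sum>i<n. Es n i \<omega> *\<^sub>R Xs n i \<omega>))"
      by (simp add: r_hat_def K_hat_def sum.distrib scaleR_sum_right[symmetric] scaleR_add_right)
    then have "sqrt (real n) *\<^sub>R (?r n \<omega> - ?K n \<omega> b)
        = ?K n \<omega> \<Delta> + (1 / sqrt (real n)) *\<^sub>R (\<Sum>i<n. Es n i \<omega> *\<^sub>R Xs n i \<omega>)"
      using False by (simp add: K_hat_def scaleR_add_right real_div_sqrt field_simps)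
    then have "U n \<omega> + (e1 n \<omega> - e2 n \<omega>) = sqrt (real n) *\<^sub>R (?K n \<omega> (?\<beta> n \<omega>) - ?K n \<omega> b)"
      by (simp add: U_def e1_def e2_def scaleR_diff_right algebra_simps)
    then show ?thesis
      by (simp add: test_stat_eq power_mult_distrib)
  qed
  have Um[measurable]: "U n \<in> borel_measurable (M n)" for n
  proof -
    note [measurable] = Xsm[of _ n] Esm[of _ n]
    show ?thesis unfolding U_def[abs_def] by measurable
  qed
  have e1m[measurable]: "e1 n \<in> borel_measurable (M n)" for n
    using K_hat_measurable[of n "Xs n" "M n" "\<lambda>_. \<Delta>", OF Xsm measurable_const]
    unfolding e1_def[abs_def] by measurable
  have e2m[measurable]: "e2 n \<in> borel_measurable (M n)" for n
    using r_hat_measurable[of n "Xs n" "M n" "Ys n", OF Xsm Ysm]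
      K_hat_pls_measurable[of n "Xs n" "M n" "Ys n", OF Xsm Ysm]
    unfolding e2_def[abs_def] by measurable
  have e1_small: "(\<lambda>n. measure (M n) {\<omega> \<in> space (M n). \<delta> < norm (e1 n \<omega>)}) \<longlonglongrightarrow> 0" if "0 < \<delta>" for \<delta>
    using iid_mean_tendsto_in_probability[OF M P SK rm rank_one_second_moment[OF X X4] that]
    by (simp add: e1_def K_hat_def k_def cov_op_def)
  have e2_small: "(\<lambda>n. measure (M n) {\<omega> \<in> space (M n). \<delta> < norm (e2 n \<omega>)}) \<longlonglongrightarrow> 0" if "0 < \<delta>" for \<delta>
    using res that by (simp add: small_oP_def e2_def pls_residual_def mult.commute abs_mult)
  have small: "(\<lambda>n. measure (M n) {\<omega> \<in> space (M n). \<delta> < norm (e1 n \<omega> - e2 n \<omega>)}) \<longlonglongrightarrow> 0" if \<delta>: "0 < \<delta>" for \<delta>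
  proof (rule tendsto_sandwich[OF _ _ tendsto_const])
    let ?A = "\<lambda>n. {\<omega> \<in> space (M n). \<delta> / 2 < norm (e1 n \<omega>)}" and ?B = "\<lambda>n. {\<omega> \<in> space (M n). \<delta> / 2 < norm (e2 n \<omega>)}"
    have "measure (M n) {\<omega> \<in> space (M n). \<delta> < norm (e1 n \<omega> - e2 n \<omega>)} \<le> measure (M n) (?A n) + measure (M n) (?B n)" for n
    proof -
      interpret Mn: prob_space "M n" by (rule M)
      have "measure (M n) {\<omega> \<in> space (M n). \<delta> < norm (e1 n \<omega> - e2 n \<omega>)} \<le> measure (M n) (?A n \<union> ?B n)"
      proof (rule Mn.finite_measure_mono)
        show "{\<omega> \<in> space (M n). \<delta> < norm (e1 n \<omega> - e2 n \<omega>)} \<subseteq> ?A n \<union> ?B n"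
        proof safe
          fix \<omega> assume "\<delta> < norm (e1 n \<omega> - e2 n \<omega>)" "\<not> \<delta> / 2 < norm (e2 n \<omega>)"
          then show "\<delta> / 2 < norm (e1 n \<omega>)"
            using norm_triangle_ineq4[of "e1 n \<omega>" "e2 n \<omega>"] by linarith
        qed
      qed measurable
      also have "\<dots> \<le> measure (M n) (?A n) + measure (M n) (?B n)"
        by (rule measure_Un_le) measurable
      finally show ?thesis .
    qed
    then show "\<forall>\<^sub>F n in sequentially. measure (M n) {\<omega> \<in> space (M n). \<delta> < norm (e1 n \<omega> - e2 n \<omega>)} \<le> measure (M n) (?A n) + measure (M n) (?B n)"
      by simp
    show "(\<lambda>n. measure (M n) (?A n) + measure (M n) (?B n)) \<longlonglongrightarrow> 0"
      using tendsto_add[OF e1_small[of "\<delta> / 2"] e2_small[of "\<delta> / 2"]] \<delta> by simp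
  qed simp
  show ?thesis
    unfolding k_def[symmetric]
  proof (rule weak_conv_m_of_Laplace[OF M _ _ Q])
    show "?T n \<in> borel_measurable (M n)" for n
      unfolding T_eq[abs_def] by measurable
    show "0 \<le> ?T n \<omega>" for n \<omega> unfolding T_eq by simp
    show "Gaussian_quadratic J w \<phi> k Z \<in> borel_measurable Q"
      by (rule Gaussian_quadratic_measurable) simp
    show "AE q in Q. 0 \<le> Gaussian_quadratic J w \<phi> k Z q"
      by (rule Gaussian_quadratic_nonneg[OF Q Z w0 w on])
    show "(\<lambda>n. \<integral>\<omega>. exp (- real s * ?T n \<omega>) \<partial>M n) \<longlonglongrightarrow> (\<integral>q. exp (- real s * Gaussian_quadratic J w \<phi> k Z q) \<partial>Q)" for s
      unfolding T_eq
    proof (rule Laplace_Slutsky[OF M Um _ small])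
      show "(\<lambda>n. \<integral>\<omega>. exp (- real s * (norm (U n \<omega>))\<^sup>2) \<partial>M n) \<longlonglongrightarrow> (\<integral>q. exp (- real s * Gaussian_quadratic J w \<phi> k Z q) \<partial>Q)"
        unfolding U_def by (rule Hilbert_CLT_Laplace[OF M P S\<zeta> \<zeta>m sq mean spec' Q indep Z])
    qed measurable
  qed
qed

section \<open>Krylov spaces of a positive operator\<close>

lemma in_span_image_lessThan:
  "s \<in> span (v ` {..<m}) \<longleftrightarrow> (\<exists>c. s = (\<Sum>j<m. c j *\<^sub>R v j))" for m :: nat
proof
  show "\<exists>c. s = (\<Sum>j<m. c j *\<^sub>R v j)" if "s \<in> span (v ` {..<m})"
    using that
  proof (induction m arbitrary: s)
    case (Suc m)
    then obtain k where "s - k *\<^sub>R v m \<in> span (v ` {..<m})"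
      by (auto simp: lessThan_Suc span_breakdown_eq)
    then obtain c where "s - k *\<^sub>R v m = (\<Sum>j<m. c j *\<^sub>R v j)" using Suc.IH by blast
    then have "s = (\<Sum>j<Suc m. (c(m := k)) j *\<^sub>R v j)" by (simp add: algebra_simps)
    then show ?case by blast
  qed simp
  show "s \<in> span (v ` {..<m})" if ex: "\<exists>c. s = (\<Sum>j<m. c j *\<^sub>R v j)"
  proof -
    obtain c where "s = (\<Sum>j<m. c j *\<^sub>R v j)" using ex by blast
    moreover have "(\<Sum>j<m. c j *\<^sub>R v j) \<in> span (v ` {..<m})"
      by (intro span_sum span_scale span_base) auto
    ultimately show ?thesis by simp
  qed
qed

text \<open>
  Bolzano-Weierstrass in finitely many coordinates, for coefficient sequences indexed by natural
  numbers so that the number of coordinates can be a variable.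
\<close>

lemma bounded_coefficients_convergent_subsequence:
  fixes a :: "nat \<Rightarrow> nat \<Rightarrow> real"
  assumes "\<And>k j. j < m \<Longrightarrow> \<bar>a k j\<bar> \<le> B"
  shows "\<exists>r d. strict_mono (r :: nat \<Rightarrow> nat) \<and> (\<forall>j<m. (\<lambda>k. a (r k) j) \<longlonglongrightarrow> d j)"
  using assms
proof (induction m)
  case 0
  show ?case by (intro exI[of _ id]) (auto simp: strict_mono_def)
next
  case (Suc m)
  then obtain r d where r: "strict_mono (r :: nat \<Rightarrow> nat)" "\<And>j. j < m \<Longrightarrow> (\<lambda>k. a (r k) j) \<longlonglongrightarrow> d j"
    by (meson less_SucI)
  have "bounded (range (\<lambda>k. a (r k) m))"
    using Suc.prems[of m] by (auto simp: bounded_iff)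
  then obtain l r' where r': "strict_mono (r' :: nat \<Rightarrow> nat)" "((\<lambda>k. a (r k) m) \<circ> r') \<longlonglongrightarrow> l"
    using bounded_imp_convergent_subsequence by blast
  have "(\<lambda>k. a ((r \<circ> r') k) j) \<longlonglongrightarrow> (d(m := l)) j" if "j < Suc m" for j
  proof (cases "j = m")
    case False
    then have "(\<lambda>k. a (r k) j) \<longlonglongrightarrow> d j" using r(2) that by simp
    from LIMSEQ_subseq_LIMSEQ[OF this r'(1)] show ?thesis using False by (simp add: comp_def)
  qed (use r'(2) in \<open>simp add: comp_def\<close>)
  moreover have "strict_mono (r \<circ> r')" using r(1) r'(1) by (rule strict_mono_o)
  ultimately show ?case by blast
qed

text \<open>
  The coefficients of the approximations \<open>s k\<close> may be unbounded. Dividing the relation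
  \<open>V k 0 - s k \<approx> 0\<close> by the sum of the absolute values of its coefficients gives coefficients on the unit
  sphere of the \<open>l\<^sup>1\<close> norm and only improves the error, since the coefficient of \<open>V k 0\<close> is \<open>1\<close>. A limit
  point of the normalised coefficients is a nontrivial relation, though possibly one in which \<open>v 0\<close>
  no longer occurs.
\<close>

lemma dependent_limit:
  fixes V :: "nat \<Rightarrow> nat \<Rightarrow> 'h::real_normed_vector"
  assumes V: "\<And>j. (\<lambda>k. V k j) \<longlonglongrightarrow> v j"
    and s: "\<And>k. s k \<in> span ((\<lambda>j. V k (Suc j)) ` {..<m})"
    and lim: "(\<lambda>k. norm (V k 0 - s k)) \<longlonglongrightarrow> 0"
  shows "\<exists>d. (\<exists>j\<le>m. d j \<noteq> 0) \<and> (\<Sum>j\<le>m. d j *\<^sub>R v j) = 0"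
proof -
  have "\<forall>k. \<exists>c. s k = (\<Sum>j<m. c j *\<^sub>R V k (Suc j))"
    using s by (simp add: in_span_image_lessThan)
  then obtain c where c: "\<And>k. s k = (\<Sum>j<m. c k j *\<^sub>R V k (Suc j))" by metis
  define N where "N k = 1 + (\<Sum>j<m. \<bar>c k j\<bar>)" for k
  have N: "1 \<le> N k" for k by (simp add: N_def sum_nonneg)
  define a where "a k j = (case j of 0 \<Rightarrow> 1 | Suc i \<Rightarrow> - c k i) / N k" for k j
  have a_sum: "(\<Sum>j\<le>m. \<bar>a k j\<bar>) = 1" for k
  proof -
    have "(\<Sum>j\<le>m. \<bar>a k j\<bar>) = 1 / N k + (\<Sum>j<m. \<bar>c k j\<bar> / N k)"
      using N[of k] by (simp add: sum.atMost_shift a_def)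
    also have "\<dots> = N k / N k" unfolding sum_divide_distrib[symmetric] add_divide_distrib[symmetric] N_def ..
    finally show ?thesis using N[of k] by simp
  qed
  have a_bound: "\<bar>a k j\<bar> \<le> 1" if "j < Suc m" for k j
    using member_le_sum[of j "{..m}" "\<lambda>j. \<bar>a k j\<bar>"] that by (simp add: a_sum)
  obtain r d where r: "strict_mono (r :: nat \<Rightarrow> nat)" "\<And>j. j < Suc m \<Longrightarrow> (\<lambda>k. a (r k) j) \<longlonglongrightarrow> d j"
    using bounded_coefficients_convergent_subsequence[of "Suc m" a 1] a_bound by blast
  have d: "(\<lambda>k. a (r k) j) \<longlonglongrightarrow> d j" if "j \<in> {..m}" for j using r(2) that by simp
  have V': "(\<lambda>k. V (r k) j) \<longlonglongrightarrow> v j" for j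
    using LIMSEQ_subseq_LIMSEQ[OF V r(1)] by (simp add: comp_def)
  have "(\<lambda>k. \<Sum>j\<le>m. \<bar>a (r k) j\<bar>) \<longlonglongrightarrow> (\<Sum>j\<le>m. \<bar>d j\<bar>)"
    by (intro tendsto_sum tendsto_rabs d)
  then have "(\<Sum>j\<le>m. \<bar>d j\<bar>) = 1"
    by (simp add: a_sum LIMSEQ_const_iff)
  then have nontriv: "\<exists>j\<le>m. d j \<noteq> 0"
    by (metis (no_types, lifting) abs_zero atMost_iff sum.neutral zero_neq_one)
  have comb: "(\<Sum>j\<le>m. a k j *\<^sub>R V k j) = (1 / N k) *\<^sub>R (V k 0 - s k)" for k
    by (simp add: sum.atMost_shift a_def c scaleR_diff_right scaleR_sum_right sum_negf)
  have "(\<lambda>k. norm (\<Sum>j\<le>m. a k j *\<^sub>R V k j)) \<longlonglongrightarrow> 0"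
  proof (rule tendsto_sandwich[OF _ _ tendsto_const lim])
    show "\<forall>\<^sub>F k in sequentially. norm (\<Sum>j\<le>m. a k j *\<^sub>R V k j) \<le> norm (V k 0 - s k)"
    proof (rule always_eventually, rule allI)
      fix k
      have "norm (V k 0 - s k) / N k \<le> norm (V k 0 - s k) / 1"
        using N[of k] by (intro divide_left_mono) auto
      then show "norm (\<Sum>j\<le>m. a k j *\<^sub>R V k j) \<le> norm (V k 0 - s k)"
        using N[of k] by (simp add: comb)
    qed
  qed simp
  then have "(\<lambda>k. \<Sum>j\<le>m. a k j *\<^sub>R V k j) \<longlonglongrightarrow> 0" by (rule tendsto_norm_zero_cancel)
  from LIMSEQ_subseq_LIMSEQ[OF this r(1)]
  have "(\<lambda>k. \<Sum>j\<le>m. a (r k) j *\<^sub>R V (r k) j) \<longlonglongrightarrow> 0" by (simp add: comp_def)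
  moreover have "(\<lambda>k. \<Sum>j\<le>m. a (r k) j *\<^sub>R V (r k) j) \<longlonglongrightarrow> (\<Sum>j\<le>m. d j *\<^sub>R v j)"
    by (intro tendsto_sum tendsto_scaleR d V')
  ultimately have "(\<Sum>j\<le>m. d j *\<^sub>R v j) = 0" by (rule LIMSEQ_unique[rotated])
  with nontriv show ?thesis by blast
qed

text \<open>
  Leading zero coefficients of the relation are removed by cancelling powers of the injective operator;
  then the relation can be solved for \<open>r\<close>.
\<close>

lemma in_shifted_krylov_of_relation:
  fixes K :: "'h::real_vector \<Rightarrow> 'h"
  assumes K: "linear K" and inj: "\<And>u. K u = 0 \<Longrightarrow> u = 0"
    and rel: "(\<Sum>j\<le>m. d j *\<^sub>R (K ^^ j) r) = 0" and nz: "\<exists>j\<le>m. d j \<noteq> 0"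
  shows "r \<in> span ((\<lambda>j. (K ^^ Suc j) r) ` {..<m})"
  using rel nz
proof (induction m arbitrary: d)
  case 0
  then show ?case by (simp add: span_zero)
next
  case (Suc m)
  show ?case
  proof (cases "d 0 = 0")
    case True
    have "K (\<Sum>j\<le>m. d (Suc j) *\<^sub>R (K ^^ j) r) = (\<Sum>j\<le>m. d (Suc j) *\<^sub>R (K ^^ Suc j) r)"
      by (simp add: linear_sum[OF K] linear_scale[OF K])
    also have "\<dots> = 0"
      using Suc.prems(1) True unfolding sum.atMost_Suc_shift by (simp del: funpow.simps)
    finally have "(\<Sum>j\<le>m. d (Suc j) *\<^sub>R (K ^^ j) r) = 0" by (rule inj)
    moreover obtain j where "j \<le> Suc m" "d j \<noteq> 0" using Suc.prems(2) by blast
    with True have "\<exists>j\<le>m. d (Suc j) \<noteq> 0" by (cases j) auto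
    ultimately have "r \<in> span ((\<lambda>j. (K ^^ Suc j) r) ` {..<m})" by (rule Suc.IH)
    also have "\<dots> \<subseteq> span ((\<lambda>j. (K ^^ Suc j) r) ` {..<Suc m})" by (intro span_mono image_mono) auto
    finally show ?thesis .
  next
    case False
    let ?s = "\<Sum>j\<le>m. d (Suc j) *\<^sub>R (K ^^ Suc j) r"
    have "d 0 *\<^sub>R r + ?s = 0"
      using Suc.prems(1) unfolding sum.atMost_Suc_shift by (simp del: funpow.simps(2))
    then have "r = - (1 / d 0) *\<^sub>R ?s"
      using False by (metis (no_types, lifting) add_eq_0_iff divide_self_if minus_minus scaleR_minus_left
          scaleR_minus_right scaleR_one scaleR_scaleR times_divide_eq_left mult_1)
    also have "\<dots> \<in> span ((\<lambda>j. (K ^^ Suc j) r) ` {..<Suc m})"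
      by (intro span_scale span_sum span_base) auto
    finally show ?thesis .
  qed
qed

text \<open>
  The residuals \<open>u m\<close> converge, since the projections are nested. Their limit \<open>u'\<close> is orthogonal to all
  \<open>K\<^sup>j r\<close> with \<open>j \<ge> 1\<close>, whereas \<open>K (u m)\<close> is a combination of exactly these vectors. Hence
  \<open>u' \<bullet> K u' = 0\<close>, and strict positivity of \<open>K\<close> gives \<open>u' = 0\<close>.
\<close>

lemma shifted_krylov_residual_tendsto_0:
  fixes K :: "'h::{real_inner, banach} \<Rightarrow> 'h"
  assumes K: "bounded_linear K" and pos: "\<And>u. u \<bullet> K u = 0 \<Longrightarrow> u = 0"
  shows "(\<lambda>m. r - span_proj (\<lambda>j. (K ^^ Suc j) r) m r) \<longlonglongrightarrow> 0"
proof -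
  let ?v = "\<lambda>j. (K ^^ Suc j) r"
  define u where "u m = r - span_proj ?v m r" for m
  have lin: "linear K" using K by (rule bounded_linear.linear)
  have Pyth: "(norm (u l))\<^sup>2 = (norm (u m))\<^sup>2 + (norm (u l - u m))\<^sup>2" if "l \<le> m" for l m
  proof -
    have "span_proj ?v l r \<in> span (?v ` {..<m})"
      using span_proj_in_span[of ?v l r] span_mono[of "?v ` {..<l}" "?v ` {..<m}"] that by fastforce
    from norm_diff_orthogonal_residual[OF subspace_span span_proj_in_span this
        span_proj_orthogonal_span[of _ ?v m r]]
    show ?thesis by (simp add: u_def algebra_simps)
  qed
  have dec: "decseq (\<lambda>m. (norm (u m))\<^sup>2)"
    using Pyth by (auto simp: decseq_def)
  then have "convergent (\<lambda>m. (norm (u m))\<^sup>2)"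
    by (rule decseq_convergent[where B=0]) (auto simp: convergent_def)
  then have Cau: "Cauchy (\<lambda>m. (norm (u m))\<^sup>2)" by (rule convergent_Cauchy)
  have "Cauchy u"
  proof (rule metric_CauchyI)
    fix e :: real assume e: "0 < e"
    then obtain N where N: "\<And>m n. m \<ge> N \<Longrightarrow> n \<ge> N \<Longrightarrow> \<bar>(norm (u m))\<^sup>2 - (norm (u n))\<^sup>2\<bar> < e\<^sup>2"
      using metric_CauchyD[OF Cau, of "e\<^sup>2"] by (auto simp: dist_real_def)
    have *: "dist (u l) (u m) < e" if "N \<le> l" "l \<le> m" for l m
    proof -
      have "(dist (u l) (u m))\<^sup>2 < e\<^sup>2"
        using Pyth[OF that(2)] N[of l m] that by (simp add: dist_norm)
      then show ?thesis using e by (simp add: power2_less_imp_less)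
    qed
    show "\<exists>N. \<forall>m\<ge>N. \<forall>n\<ge>N. dist (u m) (u n) < e"
      using * by (metis dist_commute nle_le)
  qed
  then obtain u' where u': "u \<longlonglongrightarrow> u'" using Cauchy_convergent convergent_def by metis
  have orth: "u' \<bullet> ?v j = 0" for j
  proof (rule LIMSEQ_unique)
    show "(\<lambda>m. u m \<bullet> ?v j) \<longlonglongrightarrow> u' \<bullet> ?v j" by (intro tendsto_intros u')
    have "\<forall>\<^sub>F m in sequentially. u m \<bullet> ?v j = 0"
      using eventually_gt_at_top[of j] 
    proof eventually_elim
      case (elim m)
      then show ?case unfolding u_def by (rule span_proj_orthogonal[of j m r ?v])
    qed
    then show "(\<lambda>m. u m \<bullet> ?v j) \<longlonglongrightarrow> 0" by (rule tendsto_eventually)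
  qed
  have "u' \<bullet> K (u m) = 0" for m
  proof -
    obtain c where c: "span_proj ?v m r = (\<Sum>j<m. c j *\<^sub>R ?v j)"
      using span_proj_in_span[of ?v m r] unfolding in_span_image_lessThan by blast
    have "K (u m) = ?v 0 - (\<Sum>j<m. c j *\<^sub>R ?v (Suc j))"
      unfolding u_def c by (simp add: linear_diff[OF lin] linear_sum[OF lin] linear_scale[OF lin])
    then show ?thesis by (simp only: inner_diff_right inner_sum_right inner_scaleR_right orth) simp
  qed
  moreover have "(\<lambda>m. u' \<bullet> K (u m)) \<longlonglongrightarrow> u' \<bullet> K u'"
    by (intro tendsto_intros bounded_linear.tendsto[OF K] u')
  ultimately have "u' \<bullet> K u' = 0" by (simp add: LIMSEQ_const_iff)
  then have "u' = 0" by (rule pos)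
  with u' show ?thesis by (simp add: u_def[abs_def])
qed

section \<open>Consistency of the test\<close>

lemma norm_K_hat_le: "norm (K_hat n x h) \<le> (1 / real n * (\<Sum>i<n. (norm (x i))\<^sup>2)) * norm h"
proof -
  have "norm (\<Sum>i<n. rank_one (x i) h) \<le> (\<Sum>i<n. (norm (x i))\<^sup>2 * norm h)"
    by (intro sum_norm_le norm_rank_one_le)
  then have "1 / real n * norm (\<Sum>i<n. rank_one (x i) h) \<le> 1 / real n * (\<Sum>i<n. (norm (x i))\<^sup>2 * norm h)"
    by (rule mult_left_mono) simp
  then show ?thesis by (simp add: K_hat_def sum_distrib_right)
qed

text \<open>
  \<open>K_hat\<close> need not converge to \<open>K\<close> in operator norm. Strong convergence at the countably many vectors
  \<open>K\<^sup>j r\<close> suffices because the operators \<open>K_hat\<close> are uniformly bounded by the mean of \<open>\<parallel>X\<^sub>i\<parallel>\<^sup>2\<close>.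
\<close>

lemma empirical_krylov_tendsto:
  assumes r: "(\<lambda>n. r_hat n x y) \<longlonglongrightarrow> r"
    and K: "\<And>j. (\<lambda>n. K_hat n x ((K ^^ j) r)) \<longlonglongrightarrow> (K ^^ Suc j) r"
    and s: "convergent (\<lambda>n. 1 / real n * (\<Sum>i<n. (norm (x i))\<^sup>2))"
  shows "(\<lambda>n. (K_hat n x ^^ j) (r_hat n x y)) \<longlonglongrightarrow> (K ^^ j) r"
proof (induction j)
  case 0
  show ?case using r by simp
next
  case (Suc j)
  let ?s = "\<lambda>n. 1 / real n * (\<Sum>i<n. (norm (x i))\<^sup>2)"
  let ?d = "\<lambda>n. (K_hat n x ^^ j) (r_hat n x y) - (K ^^ j) r"
  obtain l where l: "?s \<longlonglongrightarrow> l" using s by (auto simp: convergent_def)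
  have d: "?d \<longlonglongrightarrow> 0" using Suc by (simp add: LIM_zero)
  have "(\<lambda>n. K_hat n x (?d n)) \<longlonglongrightarrow> 0"
  proof (rule Lim_null_comparison)
    show "\<forall>\<^sub>F n in sequentially. norm (K_hat n x (?d n)) \<le> ?s n * norm (?d n)"
      by (intro always_eventually allI norm_K_hat_le)
    show "(\<lambda>n. ?s n * norm (?d n)) \<longlonglongrightarrow> 0"
      using tendsto_mult[OF l tendsto_norm_zero[OF d]] by simp
  qed
  from tendsto_add[OF this K[of j]]
  show ?case by (simp add: linear_diff[OF linear_K_hat])
qed

text \<open>
  Fix a tolerance. Some fixed Krylov order \<open>L\<close> achieves it for the limit problem, which settles all \<open>n\<close>
  with \<open>m n \<ge> L\<close>. Each of the finitely many smaller orders either occurs only finitely often or, by the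
  last hypothesis, solves the limit problem exactly.
\<close>

lemma pls_residual_tendsto_0:
  fixes K :: "'h::{real_inner, banach} \<Rightarrow> 'h"
  assumes K: "bounded_linear K" and pos: "\<And>u. u \<bullet> K u = 0 \<Longrightarrow> u = 0"
    and V: "\<And>j. (\<lambda>n. (K_hat n x ^^ j) (r_hat n x y)) \<longlonglongrightarrow> (K ^^ j) r"
    and rec: "\<And>l. infinite {n. m n = l} \<Longrightarrow> r \<in> span ((\<lambda>j. (K ^^ Suc j) r) ` {..<l})"
  shows "(\<lambda>n. pls_residual n x y (m n)) \<longlonglongrightarrow> 0"
proof (rule tendstoI)
  fix \<delta> :: real assume \<delta>: "0 < \<delta>"
  have res0: "0 \<le> pls_residual n x y k" for n k by (simp add: pls_residual_def)
  have approx: "\<forall>\<^sub>F n in sequentially. l \<le> m n \<longrightarrow> pls_residual n x y (m n) < \<delta>"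
    if s: "s \<in> span ((\<lambda>j. (K ^^ Suc j) r) ` {..<l})" "norm (r - s) < \<delta>" for l s
  proof -
    obtain c where c: "s = (\<Sum>j<l. c j *\<^sub>R (K ^^ Suc j) r)" using s(1) unfolding in_span_image_lessThan by blast
    let ?s = "\<lambda>n. \<Sum>j<l. c j *\<^sub>R (K_hat n x ^^ Suc j) (r_hat n x y)"
    have "(\<lambda>n. norm (r_hat n x y - ?s n)) \<longlonglongrightarrow> norm (r - s)"
      unfolding c using V[of 0] by (intro tendsto_norm tendsto_diff tendsto_sum tendsto_scaleR tendsto_const V) simp
    then have "\<forall>\<^sub>F n in sequentially. norm (r_hat n x y - ?s n) < \<delta>"
      by (rule order_tendstoD(2)) (rule s(2))
    then show ?thesis
    proof eventually_elim
      case (elim n)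
      show ?case
      proof
        assume "l \<le> m n"
        then have "?s n \<in> span ((\<lambda>j. (K_hat n x ^^ Suc j) (r_hat n x y)) ` {..<m n})"
          by (intro span_sum span_scale span_base) auto
        from pls_residual_le[OF this] elim show "pls_residual n x y (m n) < \<delta>" by linarith
      qed
    qed
  qed
  obtain L where L: "norm (r - span_proj (\<lambda>j. (K ^^ Suc j) r) L r) < \<delta>"
    using tendstoD[OF shifted_krylov_residual_tendsto_0[OF K pos] \<delta>, of r]
    by (auto simp: eventually_sequentially dist_norm simp del: funpow.simps)
  have large: "\<forall>\<^sub>F n in sequentially. L \<le> m n \<longrightarrow> pls_residual n x y (m n) < \<delta>"
    by (rule approx[OF span_proj_in_span L])
  have small: "\<forall>\<^sub>F n in sequentially. m n = l \<longrightarrow> pls_residual n x y (m n) < \<delta>" for l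
  proof (cases "infinite {n. m n = l}")
    case True
    show ?thesis
      using approx[OF rec[OF True]] \<delta> by (auto elim: eventually_mono)
  next
    case False
    then have "\<forall>\<^sub>F n in cofinite. m n \<noteq> l" by (simp add: eventually_cofinite)
    then show ?thesis unfolding cofinite_eq_sequentially by (auto elim: eventually_mono)
  qed
  have "\<forall>\<^sub>F n in sequentially. \<forall>l\<in>{..<L}. m n = l \<longrightarrow> pls_residual n x y (m n) < \<delta>"
    by (intro eventually_ball_finite ballI small) simp
  with large show "\<forall>\<^sub>F n in sequentially. dist (pls_residual n x y (m n)) 0 < \<delta>"
  proof eventually_elim
    case (elim n)
    then show ?case using res0 by (cases "L \<le> m n") auto
  qed
qed

text \<open>
  The quadratic form of \<open>K\<close> at \<open>u\<close> is the second moment of \<open>u \<bullet> X\<close>. If it is zero, then \<open>X\<close> is almost surely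
  orthogonal to \<open>u\<close>, hence \<open>K u = 0\<close>. So the absence of the eigenvalue zero means strict positivity.
\<close>

lemma
  fixes X :: "'p \<Rightarrow> 'h::{real_inner, banach, second_countable_topology}"
  assumes X: "X \<in> borel_measurable P" and sq: "integrable P (\<lambda>\<omega>. (norm (X \<omega>))\<^sup>2)"
  shows bounded_linear_cov_op: "bounded_linear (cov_op P X)"
    and cov_op_positive: "\<lbrakk>\<not> eigenvalue_of (cov_op P X) 0; u \<bullet> cov_op P X u = 0\<rbrakk> \<Longrightarrow> u = 0"
proof -
  note [measurable] = X
  have int: "integrable P (\<lambda>\<omega>. rank_one (X \<omega>) h)" for h
    by (rule cov_op_inner(1)[OF X sq])
  show "bounded_linear (cov_op P X)"
  proof (rule bounded_linear_intro[where K="\<integral>\<omega>. (norm (X \<omega>))\<^sup>2 \<partial>P"])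
    show "cov_op P X (g + h) = cov_op P X g + cov_op P X h" for g h
      by (simp add: cov_op_def linear_add[OF linear_rank_one] int)
    show "cov_op P X (c *\<^sub>R h) = c *\<^sub>R cov_op P X h" for c h
      by (simp add: cov_op_def linear_scale[OF linear_rank_one])
    show "norm (cov_op P X h) \<le> norm h * (\<integral>\<omega>. (norm (X \<omega>))\<^sup>2 \<partial>P)" for h
    proof -
      have "norm (cov_op P X h) \<le> (\<integral>\<omega>. norm (rank_one (X \<omega>) h) \<partial>P)"
        unfolding cov_op_def by (rule integral_norm_bound)
      also have "\<dots> \<le> (\<integral>\<omega>. norm h * (norm (X \<omega>))\<^sup>2 \<partial>P)"
        using int sq norm_rank_one_le[of "X _" h]
        by (intro integral_mono) (auto simp: mult.commute)
      finally show ?thesis by simp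
    qed
  qed
  assume ev: "\<not> eigenvalue_of (cov_op P X) 0" and u: "u \<bullet> cov_op P X u = 0"
  have "(\<integral>\<omega>. (u \<bullet> X \<omega>)\<^sup>2 \<partial>P) = 0" using cov_op_square(2)[OF X sq, of u] u by simp
  then have "AE \<omega> in P. (u \<bullet> X \<omega>)\<^sup>2 = 0"
    using cov_op_square(1)[OF X sq, of u] by (subst (asm) integral_nonneg_eq_0_iff_AE) auto
  then have "AE \<omega> in P. rank_one (X \<omega>) u = 0"
    by eventually_elim (simp add: rank_one_def inner_commute)
  then have "cov_op P X u = 0" unfolding cov_op_def by (rule integral_eq_zero_AE)
  with ev show "u = 0" by (auto simp: eigenvalue_of_def)
qed

lemma min_one_tendsto_0D:
  fixes f :: "nat \<Rightarrow> real"
  assumes "(\<lambda>k. min 1 (f k)) \<longlonglongrightarrow> 0"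
  shows "f \<longlonglongrightarrow> 0"
proof (rule Lim_transform_eventually[OF assms])
  have "\<forall>\<^sub>F k in sequentially. min 1 (f k) < 1"
    using order_tendstoD(2)[OF assms, of 1] by simp
  then show "\<forall>\<^sub>F k in sequentially. min 1 (f k) = f k"
    by eventually_elim (simp add: min_def split: if_splits)
qed

lemma L1_tendsto_0_of_probability:
  fixes R :: "nat \<Rightarrow> 's \<Rightarrow> real"
  assumes M: "prob_space M" and R[measurable]: "\<And>n. R n \<in> borel_measurable M" and R0: "\<And>n \<omega>. 0 \<le> R n \<omega>"
    and lim: "\<And>\<delta>. 0 < \<delta> \<Longrightarrow> (\<lambda>n. measure M {\<omega> \<in> space M. \<delta> < R n \<omega>}) \<longlonglongrightarrow> 0"
  shows "(\<lambda>n. \<integral>\<omega>. norm (min 1 (R n \<omega>)) \<partial>M) \<longlonglongrightarrow> 0" "integrable M (\<lambda>\<omega>. min 1 (R n \<omega>))"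
proof -
  interpret prob_space M by fact
  have int: "integrable M (\<lambda>\<omega>. min 1 (R n \<omega>))" for n
    by (rule integrable_const_bound[where B=1]) (auto simp: R0 min_def)
  then show "integrable M (\<lambda>\<omega>. min 1 (R n \<omega>))" .
  have bound: "(\<integral>\<omega>. norm (min 1 (R n \<omega>)) \<partial>M) \<le> \<delta> + measure M {\<omega> \<in> space M. \<delta> < R n \<omega>}" if \<delta>: "0 < \<delta>" for n \<delta>
  proof -
    let ?E = "{\<omega> \<in> space M. \<delta> < R n \<omega>}"
    have "(\<integral>\<omega>. norm (min 1 (R n \<omega>)) \<partial>M) \<le> (\<integral>\<omega>. \<delta> + indicator ?E \<omega> \<partial>M)"
    proof (rule integral_mono)
      show "integrable M (\<lambda>\<omega>. \<delta> + indicator ?E \<omega>)"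
        by (intro Bochner_Integration.integrable_add) (auto simp: emeasure_eq_measure)
      show "norm (min 1 (R n \<omega>)) \<le> \<delta> + indicator ?E \<omega>" if "\<omega> \<in> space M" for \<omega>
        using that \<delta> R0[of n \<omega>] by (auto simp: indicator_def min_def)
    qed (rule integrable_norm[OF int])
    also have "\<dots> = \<delta> + measure M ?E"
      by (subst Bochner_Integration.integral_add) (auto simp: emeasure_eq_measure prob_space)
    finally show ?thesis .
  qed
  show "(\<lambda>n. \<integral>\<omega>. norm (min 1 (R n \<omega>)) \<partial>M) \<longlonglongrightarrow> 0"
  proof (rule tendstoI)
    fix e :: real assume e: "0 < e"
    then have "\<forall>\<^sub>F n in sequentially. dist (measure M {\<omega> \<in> space M. e / 2 < R n \<omega>}) 0 < e / 2"
      by (intro tendstoD lim) auto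
    then show "\<forall>\<^sub>F n in sequentially. dist (\<integral>\<omega>. norm (min 1 (R n \<omega>)) \<partial>M) 0 < e"
    proof eventually_elim
      case (elim n)
      then show ?case using bound[of "e / 2" n] e by (simp add: dist_real_def)
    qed
  qed
qed

text \<open>
  A value \<open>l\<close> taken infinitely often by \<open>m\<close> is treated at a single sample point: convergence in
  probability gives almost sure convergence of the residual along a subsequence of \<open>{n. m n = l}\<close>, and
  the resulting membership of \<open>r\<close> in the span is free of randomness. It can therefore be used at all
  other sample points and along the whole sequence.
\<close>

lemma test_stat_at_top:
  fixes P :: "'p measure"
    and X :: "'p \<Rightarrow> 'h::{real_inner, banach, second_countable_topology}"
    and M :: "'s measure"
  assumes P: "prob_space P"
    and X: "X \<in> borel_measurable P" and \<epsilon>: "\<epsilon> \<in> borel_measurable P"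
    and mean: "(\<integral>\<omega>. \<epsilon> \<omega> *\<^sub>R X \<omega> \<partial>P) = 0"
    and X4: "integrable P (\<lambda>\<omega>. norm (X \<omega>) ^ 4)"
    and sq: "integrable P (\<lambda>\<omega>. (norm (\<epsilon> \<omega> *\<^sub>R X \<omega>))\<^sup>2)"
    and ev: "\<not> eigenvalue_of (cov_op P X) 0"
    and M: "prob_space M"
    and S: "iid_copies M UNIV (\<lambda>i \<omega>. (Xs i \<omega>, Ys i \<omega>)) P (\<lambda>\<omega>. (X \<omega>, \<beta> \<bullet> X \<omega> + \<epsilon> \<omega>))"
    and res: "small_oP (\<lambda>_. M) (\<lambda>n \<omega>. pls_residual n (\<lambda>i. Xs i \<omega>) (\<lambda>i. Ys i \<omega>) (m n))
          (\<lambda>n. 1 / sqrt (real n))"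
    and \<beta>: "\<beta> \<noteq> b"
  shows "AE \<omega> in M. filterlim
            (\<lambda>n. test_stat n (\<lambda>i. Xs i \<omega>) (\<lambda>i. Ys i \<omega>) (m n) b) at_top sequentially"
proof -
  interpret P: prob_space P by fact
  interpret M: prob_space M by fact
  note [measurable] = X \<epsilon>
  define K where "K = cov_op P X"
  define r where "r = K \<beta>"
  have X2: "integrable P (\<lambda>\<omega>. (norm (X \<omega>))\<^sup>2)"
    by (rule P.square_integrable_imp_integrable) (use X4 in \<open>auto simp: power_mult[symmetric]\<close>)
  have K: "bounded_linear K" unfolding K_def by (rule bounded_linear_cov_op[OF X X2])
  note K_lin = bounded_linear.linear[OF K]
  have pos: "u = 0" if "u \<bullet> K u = 0" for u
    using cov_op_positive[OF X X2 ev] that by (simp add: K_def)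
  have XY: "(\<lambda>\<omega>. (X \<omega>, \<beta> \<bullet> X \<omega> + \<epsilon> \<omega>)) \<in> borel_measurable P"
    by (rule borel_measurable_Pair) measurable
  have fst_borel: "(\<lambda>z::'h \<times> real. fst z) \<in> borel_measurable borel"
    and snd_borel: "(\<lambda>z::'h \<times> real. snd z) \<in> borel_measurable borel"
    and scale_borel: "(\<lambda>z::'h \<times> real. snd z *\<^sub>R fst z) \<in> borel_measurable borel"
    and norm_borel: "(\<lambda>z::'h \<times> real. (norm (fst z))\<^sup>2) \<in> borel_measurable borel"
    by (intro borel_measurable_continuous_onI continuous_intros)+
  have rank_borel: "(\<lambda>z::'h \<times> real. rank_one (fst z) h) \<in> borel_measurable borel" for h
    unfolding rank_one_def by (intro borel_measurable_continuous_onI continuous_intros)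
  have Xsm: "Xs i \<in> borel_measurable M" and Ysm: "Ys i \<in> borel_measurable M" for i
    using measurable_compose[OF iid_copies_measurable[OF M S, of i] fst_borel]
      measurable_compose[OF iid_copies_measurable[OF M S, of i] snd_borel] by auto

  have K_conv: "AE \<omega> in M. (\<lambda>n. K_hat n (\<lambda>i. Xs i \<omega>) h) \<longlonglongrightarrow> K h" for h
  proof -
    have "iid_copies M UNIV (\<lambda>i \<omega>. rank_one (Xs i \<omega>) h) P (\<lambda>\<omega>. rank_one (X \<omega>) h)"
      using iid_copies_compose[OF M S XY rank_borel] by simp
    from SLLN_second_moment[OF M P this _ rank_one_second_moment[OF X X4]]
    show ?thesis by (simp add: K_hat_def K_def cov_op_def rank_one_def)
  qed
  have r_conv: "AE \<omega> in M. (\<lambda>n. r_hat n (\<lambda>i. Xs i \<omega>) (\<lambda>i. Ys i \<omega>)) \<longlonglongrightarrow> r"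
  proof -
    let ?f = "\<lambda>\<omega>. (\<beta> \<bullet> X \<omega> + \<epsilon> \<omega>) *\<^sub>R X \<omega>"
    have f: "?f \<omega> = rank_one (X \<omega>) \<beta> + \<epsilon> \<omega> *\<^sub>R X \<omega>" for \<omega>
      by (simp add: rank_one_def scaleR_add_left inner_commute)
    have "iid_copies M UNIV (\<lambda>i \<omega>. Ys i \<omega> *\<^sub>R Xs i \<omega>) P ?f"
      using iid_copies_compose[OF M S XY scale_borel] by simp
    moreover have "integrable P (\<lambda>\<omega>. (norm (?f \<omega>))\<^sup>2)"
    proof (rule Bochner_Integration.integrable_bound)
      show "integrable P (\<lambda>\<omega>. 2 * (norm (rank_one (X \<omega>) \<beta>))\<^sup>2 + 2 * (norm (\<epsilon> \<omega> *\<^sub>R X \<omega>))\<^sup>2)"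
        by (intro Bochner_Integration.integrable_add integrable_mult_right rank_one_second_moment[OF X X4] sq)
      show "AE \<omega> in P. norm ((norm (?f \<omega>))\<^sup>2) \<le> norm (2 * (norm (rank_one (X \<omega>) \<beta>))\<^sup>2 + 2 * (norm (\<epsilon> \<omega> *\<^sub>R X \<omega>))\<^sup>2)"
      proof (rule AE_I2)
        fix \<omega>
        let ?a = "rank_one (X \<omega>) \<beta>" and ?b = "\<epsilon> \<omega> *\<^sub>R X \<omega>"
        have "(norm (?a + ?b))\<^sup>2 \<le> (norm ?a + norm ?b)\<^sup>2"
          by (intro power_mono norm_triangle_ineq) simp
        also have "\<dots> \<le> 2 * (norm ?a)\<^sup>2 + 2 * (norm ?b)\<^sup>2"
          using zero_le_power2[of "norm ?a - norm ?b"] unfolding power2_diff power2_sum by linarith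
        finally show "norm ((norm (?f \<omega>))\<^sup>2) \<le> norm (2 * (norm ?a)\<^sup>2 + 2 * (norm ?b)\<^sup>2)"
          using zero_le_power2[of "norm (?a + ?b)"] unfolding f real_norm_def by linarith
      qed
    qed simp
    moreover have "(\<integral>\<omega>. ?f \<omega> \<partial>P) = r"
    proof -
      have "integrable P (\<lambda>\<omega>. \<epsilon> \<omega> *\<^sub>R X \<omega>)"
        by (rule integrable_of_norm_square[OF P _ sq]) measurable
      then show ?thesis
        unfolding f using cov_op_inner(1)[OF X X2, of \<beta>] by (simp add: mean r_def K_def cov_op_def)
    qed
    ultimately show ?thesis
      using SLLN_second_moment[OF M P, of "\<lambda>i \<omega>. Ys i \<omega> *\<^sub>R Xs i \<omega>" ?f] by (simp add: r_hat_def)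
  qed
  have s_conv: "AE \<omega> in M. convergent (\<lambda>n. 1 / real n * (\<Sum>i<n. (norm (Xs i \<omega>))\<^sup>2))"
  proof -
    have "iid_copies M UNIV (\<lambda>i \<omega>. (norm (Xs i \<omega>))\<^sup>2) P (\<lambda>\<omega>. (norm (X \<omega>))\<^sup>2)"
      using iid_copies_compose[OF M S XY norm_borel] by simp
    moreover have "integrable P (\<lambda>\<omega>. (norm ((norm (X \<omega>))\<^sup>2))\<^sup>2)"
      using X4 by (simp add: power_mult[symmetric])
    ultimately have "AE \<omega> in M. (\<lambda>n. (1 / real n) *\<^sub>R (\<Sum>i<n. (norm (Xs i \<omega>))\<^sup>2)) \<longlonglongrightarrow> (\<integral>\<omega>. (norm (X \<omega>))\<^sup>2 \<partial>P)"
      by (intro SLLN_second_moment[OF M P]) auto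
    then show ?thesis
      by eventually_elim (auto simp: convergent_def)
  qed

  let ?V = "\<lambda>\<omega> n j. (K_hat n (\<lambda>i. Xs i \<omega>) ^^ j) (r_hat n (\<lambda>i. Xs i \<omega>) (\<lambda>i. Ys i \<omega>))"
  let ?R = "\<lambda>n \<omega>. pls_residual n (\<lambda>i. Xs i \<omega>) (\<lambda>i. Ys i \<omega>) (m n)"
  have "AE \<omega> in M. \<forall>j. (\<lambda>n. K_hat n (\<lambda>i. Xs i \<omega>) ((K ^^ j) r)) \<longlonglongrightarrow> (K ^^ Suc j) r"
    using K_conv by (simp add: AE_all_countable)
  with r_conv s_conv have V_conv: "AE \<omega> in M. \<forall>j. (\<lambda>n. ?V \<omega> n j) \<longlonglongrightarrow> (K ^^ j) r"
  proof eventually_elim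
    case (elim \<omega>)
    show ?case
      by (intro allI empirical_krylov_tendsto elim(1,2)) (use elim(3) in blast)
  qed

  have R_meas[measurable]: "?R n \<in> borel_measurable M" for n
    by (rule pls_residual_measurable) (rule Xsm Ysm)+
  have R0: "0 \<le> ?R n \<omega>" for n \<omega> by (simp add: pls_residual_def)
  have R_prob: "(\<lambda>n. measure M {\<omega> \<in> space M. \<delta> < ?R n \<omega>}) \<longlonglongrightarrow> 0" if \<delta>: "0 < \<delta>" for \<delta>
  proof (rule tendsto_sandwich[OF _ _ tendsto_const])
    show "(\<lambda>n. measure M {\<omega> \<in> space M. \<delta> < \<bar>?R n \<omega> / (1 / sqrt (real n))\<bar>}) \<longlonglongrightarrow> 0"
      using res \<delta> by (simp add: small_oP_def)
    show "\<forall>\<^sub>F n in sequentially. measure M {\<omega> \<in> space M. \<delta> < ?R n \<omega>}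
        \<le> measure M {\<omega> \<in> space M. \<delta> < \<bar>?R n \<omega> / (1 / sqrt (real n))\<bar>}"
      using eventually_ge_at_top[of 1]
    proof eventually_elim
      case (elim n)
      have "?R n \<omega> \<le> \<bar>?R n \<omega> / (1 / sqrt (real n))\<bar>" for \<omega>
        using mult_left_mono[of 1 "sqrt (real n)" "?R n \<omega>"] R0[of n \<omega>] elim by simp
      then show ?case
        by (intro M.finite_measure_mono) (auto intro: less_le_trans)
    qed
  qed simp

  have recurrent: "r \<in> span ((\<lambda>j. (K ^^ Suc j) r) ` {..<l})" if inf: "infinite {n. m n = l}" for l
  proof -
    let ?e = "enumerate {n. m n = l}"
    have e: "strict_mono ?e" using inf by (rule strict_mono_enumerate)
    have e_m: "m (?e k) = l" for k using enumerate_in_set[OF inf, of k] by simp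
    have "(\<lambda>k. measure M {\<omega> \<in> space M. \<delta> < ?R (?e k) \<omega>}) \<longlonglongrightarrow> 0" if "0 < \<delta>" for \<delta>
      using LIMSEQ_subseq_LIMSEQ[OF R_prob[OF that] e] by (simp add: comp_def)
    note L1 = L1_tendsto_0_of_probability[where R="\<lambda>k. ?R (?e k)", OF M R_meas R0 this]
    obtain q where q: "strict_mono (q :: nat \<Rightarrow> nat)" "AE \<omega> in M. (\<lambda>k. min 1 (?R (?e (q k)) \<omega>)) \<longlonglongrightarrow> 0"
      using tendsto_L1_AE_subseq[OF L1(2) L1(1)] by blast
    have "AE \<omega> in M. (\<forall>j. (\<lambda>n. ?V \<omega> n j) \<longlonglongrightarrow> (K ^^ j) r) \<and> (\<lambda>k. min 1 (?R (?e (q k)) \<omega>)) \<longlonglongrightarrow> 0"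
      using V_conv q(2) by eventually_elim blast
    then obtain \<omega> where \<omega>: "\<And>j. (\<lambda>n. ?V \<omega> n j) \<longlonglongrightarrow> (K ^^ j) r" "(\<lambda>k. min 1 (?R (?e (q k)) \<omega>)) \<longlonglongrightarrow> 0"
      using eventually_happens'[OF M.ae_filter_bot] by blast
    define p where "p k = ?e (q k)" for k
    have p: "strict_mono p" using strict_mono_o[OF e q(1)] by (simp add: p_def[abs_def] comp_def)
    have p_m: "m (p k) = l" for k by (simp add: p_def e_m)
    let ?s = "\<lambda>k. K_hat (p k) (\<lambda>i. Xs i \<omega>) (pls (p k) (\<lambda>i. Xs i \<omega>) (\<lambda>i. Ys i \<omega>) l)"
    have "\<exists>d. (\<exists>j\<le>l. d j \<noteq> 0) \<and> (\<Sum>j\<le>l. d j *\<^sub>R (K ^^ j) r) = 0"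
    proof (rule dependent_limit[where V="\<lambda>k. ?V \<omega> (p k)" and s="?s"])
      show "(\<lambda>k. ?V \<omega> (p k) j) \<longlonglongrightarrow> (K ^^ j) r" for j
        using LIMSEQ_subseq_LIMSEQ[OF \<omega>(1) p, of j] by (simp add: comp_def)
      show "?s k \<in> span ((\<lambda>j. ?V \<omega> (p k) (Suc j)) ` {..<l})" for k
        unfolding K_hat_pls by (rule span_proj_in_span)
      show "(\<lambda>k. norm (?V \<omega> (p k) 0 - ?s k)) \<longlonglongrightarrow> 0"
        using min_one_tendsto_0D[OF \<omega>(2)] by (simp add: pls_residual_def p_def e_m)
    qed
    then obtain d where "\<exists>j\<le>l. d j \<noteq> 0" "(\<Sum>j\<le>l. d j *\<^sub>R (K ^^ j) r) = 0" by blast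
    then show ?thesis
      using pos by (intro in_shifted_krylov_of_relation[OF K_lin]) auto
  qed

  have K\<beta>: "K \<beta> - K b \<noteq> 0"
  proof
    assume "K \<beta> - K b = 0"
    then have "K (\<beta> - b) = 0" by (simp add: linear_diff[OF K_lin])
    then show False using pos[of "\<beta> - b"] \<beta> by simp
  qed
  show ?thesis
    using V_conv r_conv K_conv[of b]
  proof eventually_elim
    case (elim \<omega>)
    let ?K\<beta> = "\<lambda>n. K_hat n (\<lambda>i. Xs i \<omega>) (pls n (\<lambda>i. Xs i \<omega>) (\<lambda>i. Ys i \<omega>) (m n))"
    have "(\<lambda>n. ?R n \<omega>) \<longlonglongrightarrow> 0"
      using elim(1) recurrent by (intro pls_residual_tendsto_0[OF K pos, where r=r]) auto
    then have res0: "(\<lambda>n. r_hat n (\<lambda>i. Xs i \<omega>) (\<lambda>i. Ys i \<omega>) - ?K\<beta> n) \<longlonglongrightarrow> 0"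
      unfolding pls_residual_def by (rule tendsto_norm_zero_cancel)
    have "(\<lambda>n. (norm (r_hat n (\<lambda>i. Xs i \<omega>) (\<lambda>i. Ys i \<omega>)
          - (r_hat n (\<lambda>i. Xs i \<omega>) (\<lambda>i. Ys i \<omega>) - ?K\<beta> n) - K_hat n (\<lambda>i. Xs i \<omega>) b))\<^sup>2) \<longlonglongrightarrow> (norm (r - 0 - K b))\<^sup>2"
      by (intro tendsto_intros res0 elim(2,3))
    then have "(\<lambda>n. (norm (?K\<beta> n - K_hat n (\<lambda>i. Xs i \<omega>) b))\<^sup>2) \<longlonglongrightarrow> (norm (r - K b))\<^sup>2"
      by simp
    then have "filterlim (\<lambda>n. (norm (?K\<beta> n - K_hat n (\<lambda>i. Xs i \<omega>) b))\<^sup>2 * real n) at_top sequentially"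
      by (rule filterlim_tendsto_pos_mult_at_top[OF _ _ filterlim_real_sequentially]) (use K\<beta> in \<open>simp add: r_def\<close>)
    then show ?case by (simp add: test_stat_eq mult.commute)
  qed
qed

theorem theorem6:
  fixes P :: "'p measure"
    and X :: "'p \<Rightarrow> 'h::{real_inner, banach, second_countable_topology}"
    and \<epsilon> :: "'p \<Rightarrow> real"
    and \<sigma> :: real
    and J :: "nat set" and w :: "nat \<Rightarrow> real" and \<phi> :: "nat \<Rightarrow> 'h"
    and Q :: "'q measure" and Z :: "nat \<Rightarrow> 'q \<Rightarrow> real"
    and b :: 'h
  assumes "prob_space P"
    and "X \<in> borel_measurable P" and "\<epsilon> \<in> borel_measurable P"
    and "(\<integral>\<omega>. \<epsilon> \<omega> *\<^sub>R X \<omega> \<partial>P) = 0"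
    and "(\<integral>\<omega>. X \<omega> \<partial>P) = 0"
    and "integrable P (\<lambda>\<omega>. norm (X \<omega>) ^ 4)"
    and "AE \<omega> in P. nn_cond_exp P (vimage_algebra (space P) X borel)
           (\<lambda>\<omega>. ennreal ((\<epsilon> \<omega>)\<^sup>2)) \<omega> \<le> ennreal (\<sigma>\<^sup>2)"
    and "\<not> eigenvalue_of (cov_op P X) 0"
    and "spectral_decomposition (var_op P X \<epsilon>) J w \<phi>"
    and "prob_space Q"
    and "prob_space.indep_vars Q (\<lambda>_. borel) Z UNIV"
    and "\<forall>j. distributed Q lborel (Z j) std_normal_density"
  shows
    "(\<forall>(M :: 's measure) Xs Ys \<beta> m.
        prob_space M \<and>
        iid_copies M (UNIV :: nat set) (\<lambda>i \<omega>. (Xs i \<omega>, Ys i \<omega>))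
          P (\<lambda>\<omega>. (X \<omega>, \<beta> \<bullet> X \<omega> + \<epsilon> \<omega>)) \<and>
        (\<forall>n. 1 \<le> m n) \<and>
        small_oP (\<lambda>_. M) (\<lambda>n \<omega>. pls_residual n (\<lambda>i. Xs i \<omega>) (\<lambda>i. Ys i \<omega>) (m n))
          (\<lambda>n. 1 / sqrt (real n)) \<longrightarrow>
        (\<beta> = b \<longrightarrow>
          weak_conv_m
            (\<lambda>n. distr M borel (\<lambda>\<omega>. test_stat n (\<lambda>i. Xs i \<omega>) (\<lambda>i. Ys i \<omega>) (m n) b))
            (distr Q borel (\<lambda>q. \<Sum>\<^sub>\<infinity>j\<in>J. w j * (Z j q)\<^sup>2))) \<and>
        (\<beta> \<noteq> b \<longrightarrow>
          (AE \<omega> in M. filterlim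
            (\<lambda>n. test_stat n (\<lambda>i. Xs i \<omega>) (\<lambda>i. Ys i \<omega>) (m n) b) at_top sequentially)))
     \<and>
     (\<forall>(M :: nat \<Rightarrow> 's measure) Xs Es Ys \<Delta> m.
        (\<forall>n. prob_space (M n)) \<and>
        (\<forall>n. iid_copies (M n) {..<n} (\<lambda>i \<omega>. (Xs n i \<omega>, Es n i \<omega>))
          P (\<lambda>\<omega>. (X \<omega>, \<epsilon> \<omega>))) \<and>
        (\<forall>n. \<forall>i<n. \<forall>\<omega>. Ys n i \<omega> = (b + (1 / sqrt (real n)) *\<^sub>R \<Delta>) \<bullet> Xs n i \<omega> + Es n i \<omega>) \<and>
        (\<forall>n. 1 \<le> m n) \<and>
        small_oP M (\<lambda>n \<omega>. pls_residual n (\<lambda>i. Xs n i \<omega>) (\<lambda>i. Ys n i \<omega>) (m n))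
          (\<lambda>n. 1 / sqrt (real n)) \<longrightarrow>
        weak_conv_m
          (\<lambda>n. distr (M n) borel
             (\<lambda>\<omega>. test_stat n (\<lambda>i. Xs n i \<omega>) (\<lambda>i. Ys n i \<omega>) (m n) b))
          (distr Q borel (\<lambda>q. (\<Sum>\<^sub>\<infinity>j\<in>J. w j * (Z j q)\<^sup>2)
             + 2 * (\<Sum>\<^sub>\<infinity>j\<in>J. sqrt (w j) * Z j q * (\<phi> j \<bullet> cov_op P X \<Delta>))
             + (norm (cov_op P X \<Delta>))\<^sup>2)))"
proof -
  note [measurable] = assms(2,3)
  have P: "prob_space P" and X: "X \<in> borel_measurable P" and \<epsilon>: "\<epsilon> \<in> borel_measurable P"
    and Q: "prob_space Q" using assms by auto
  have Z: "distributed Q lborel (Z j) std_normal_density" for j using assms(12) by blast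
  have sq: "integrable P (\<lambda>\<omega>. (norm (\<epsilon> \<omega> *\<^sub>R X \<omega>))\<^sup>2)"
    by (rule error_second_moment[OF P X \<epsilon> assms(6,7)])
  note conv = test_stat_weak_conv[where 's='s, OF P X \<epsilon> assms(4,6) sq assms(9) Q assms(11) Z]
  have GQ: "Gaussian_quadratic J w \<phi> (cov_op P X \<Delta>) Z = (\<lambda>q. (\<Sum>\<^sub>\<infinity>j\<in>J. w j * (Z j q)\<^sup>2)
             + 2 * (\<Sum>\<^sub>\<infinity>j\<in>J. sqrt (w j) * Z j q * (\<phi> j \<bullet> cov_op P X \<Delta>))
             + (norm (cov_op P X \<Delta>))\<^sup>2)" for \<Delta>
    by (rule ext) (simp add: Gaussian_quadratic_def)
  have K0: "cov_op P X 0 = 0" by (simp add: cov_op_def rank_one_def)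
  show ?thesis
  proof (intro conjI allI impI; (elim conjE)?)
    fix M :: "'s measure" and Xs Ys \<beta> m
    assume M: "prob_space M"
      and S: "iid_copies M (UNIV :: nat set) (\<lambda>i \<omega>. (Xs i \<omega>, Ys i \<omega>)) P (\<lambda>\<omega>. (X \<omega>, \<beta> \<bullet> X \<omega> + \<epsilon> \<omega>))"
      and res: "small_oP (\<lambda>_. M) (\<lambda>n \<omega>. pls_residual n (\<lambda>i. Xs i \<omega>) (\<lambda>i. Ys i \<omega>) (m n))
          (\<lambda>n. 1 / sqrt (real n))"
    show "AE \<omega> in M. filterlim (\<lambda>n. test_stat n (\<lambda>i. Xs i \<omega>) (\<lambda>i. Ys i \<omega>) (m n) b) at_top sequentially"
      if "\<beta> \<noteq> b"
      by (rule test_stat_at_top[OF P X \<epsilon> assms(4,6) sq assms(8) M S res that])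
    show "weak_conv_m
            (\<lambda>n. distr M borel (\<lambda>\<omega>. test_stat n (\<lambda>i. Xs i \<omega>) (\<lambda>i. Ys i \<omega>) (m n) b))
            (distr Q borel (\<lambda>q. \<Sum>\<^sub>\<infinity>j\<in>J. w j * (Z j q)\<^sup>2))" if b: "\<beta> = b"
    proof -
      have XY: "(\<lambda>\<omega>. (X \<omega>, \<beta> \<bullet> X \<omega> + \<epsilon> \<omega>)) \<in> borel_measurable P"
        by (rule borel_measurable_Pair) measurable
      \<comment> \<open>The errors are recovered from the observations, which makes the null hypothesis the local alternative with \<open>\<Delta> = 0\<close>.\<close>
      have g: "(\<lambda>z::'h \<times> real. (fst z, snd z - b \<bullet> fst z)) \<in> borel_measurable borel"
        by (intro borel_measurable_continuous_onI continuous_intros)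
      have "iid_copies M {..<n} (\<lambda>i \<omega>. (Xs i \<omega>, Ys i \<omega> - b \<bullet> Xs i \<omega>)) P (\<lambda>\<omega>. (X \<omega>, \<epsilon> \<omega>))" for n
        using iid_copies_subset[OF M iid_copies_compose[OF M S XY g], of "{..<n}"] by (simp add: b)
      from conv[where M="\<lambda>_. M" and Xs="\<lambda>_. Xs" and Ys="\<lambda>_. Ys" and b=b and \<Delta>=0, OF M this _ res]
      moreover have "Gaussian_quadratic J w \<phi> (cov_op P X 0) Z = (\<lambda>q. \<Sum>\<^sub>\<infinity>j\<in>J. w j * (Z j q)\<^sup>2)"
        using GQ[of 0] by (simp add: K0)
      ultimately show ?thesis by simp
    qed
  next
    fix M :: "nat \<Rightarrow> 's measure" and Xs Es Ys \<Delta> m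
    assume M: "\<forall>n. prob_space (M n)"
      and S: "\<forall>n. iid_copies (M n) {..<n} (\<lambda>i \<omega>. (Xs n i \<omega>, Es n i \<omega>)) P (\<lambda>\<omega>. (X \<omega>, \<epsilon> \<omega>))"
      and Ys: "\<forall>n. \<forall>i<n. \<forall>\<omega>. Ys n i \<omega> = (b + (1 / sqrt (real n)) *\<^sub>R \<Delta>) \<bullet> Xs n i \<omega> + Es n i \<omega>"
      and res: "small_oP M (\<lambda>n \<omega>. pls_residual n (\<lambda>i. Xs n i \<omega>) (\<lambda>i. Ys n i \<omega>) (m n))
          (\<lambda>n. 1 / sqrt (real n))"
    show "weak_conv_m
          (\<lambda>n. distr (M n) borel
             (\<lambda>\<omega>. test_stat n (\<lambda>i. Xs n i \<omega>) (\<lambda>i. Ys n i \<omega>) (m n) b))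
          (distr Q borel (\<lambda>q. (\<Sum>\<^sub>\<infinity>j\<in>J. w j * (Z j q)\<^sup>2)
             + 2 * (\<Sum>\<^sub>\<infinity>j\<in>J. sqrt (w j) * Z j q * (\<phi> j \<bullet> cov_op P X \<Delta>))
             + (norm (cov_op P X \<Delta>))\<^sup>2))"
      unfolding GQ[symmetric] by (rule conv[where Es=Es and Xs=Xs, OF _ _ _ res]) (use M S Ys in blast)+
  qed
qed

end
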